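(* The following problem (minimum placement of VNFs to achieve the original maximum flow) is NP-hard: given a finite directed graph $G=(\mathcal{V},\mathcal{E})$ with nonnegative integer edge capacities $c_e$, a source $s$ and a destination $d$, find a set $K\subseteq\mathcal{V}\setminus\{s,d\}$ of virtualized nodes of minimum cardinality such that the original maximum flow value $F_{s,d}$ can be achieved using only admissible paths, i.e. such that there exist $x_p\ge 0$ for $p\in\mathcal{P}'_{sd}(K)$ with $$\sum_{p\in\mathcal{P}'_{sd}(K)}x_p=F_{s,d}\qquad\text{and}\qquad \sum_{p\in\mathcal{P}'_{sd}(K):\,e\in p}x_p\le c_e\quad\text{for all }e\in\mathcal{E},$$ where $\mathcal{P}'_{sd}(K)$ is the set of admissible paths from $s$ to $d$ when $K$ is the set of virtualized nodes.
   Context: $F_{s,d}$ denotes the standard maximum flow value from $s$ to $d$ in $G$ (without any service function chain (SFC) constraint). An SFC constraint $(s,\phi_1,\dots,\phi_r,d)$, $r\ge 1$, requires all flow to be processed by the virtual network functions (VNFs) $\phi_1,\dots,\phi_r$ in this order before reaching $d$. All VNFs can be hosted at any node; a virtualized node hosts all the required VNFs, and a non-virtualized node hosts none. Hence a path from $s$ to $d$ is admissible (belongs to $\mathcal{P}'_{sd}(K)$) if and only if it contains at least one node of $K$. Paths may revisit vertices; an edge traversed several times by a path $p$ contributes $x_p$ to the load of that edge once per traversal. NP-hardness of the minimization problem is understood as NP-hardness of its decision version: given $G$, $(c_e)$, $s$, $d$ and an integer $k$, decide whether there is a feasible set $K$ with $|K|\le k$. *)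

theory Defs
  imports
    "HOL-Analysis.Infinite_Sum"
    "HOL-Computational_Algebra.Polynomial"
    "Graph_Theory.Pair_Digraph"
begin

section \<open>Polynomial time on multitape Turing machines\<close>

text \<open>
  A machine has finitely many two-way infinite tapes. States and tape symbols are initial segments
  of the naturals: state 0 is the start state, state 1 the halting state; symbol 0 is the blank,
  symbols 1 and 2 stand for the bits. The transition function maps the current state and the
  list of scanned symbols to the next state and, for each tape, the symbol to write and the move
  of the head; only its values on actual states and symbols matter.
\<close>

datatype dir = ToLeft | Stay | ToRight

fun offset :: "dir \<Rightarrow> int" where
  "offset ToLeft = -1"
| "offset Stay = 0"
| "offset ToRight = 1"

record tm =
  ntapes :: nat
  nsyms :: nat
  nstates :: nat
  delta :: "nat \<Rightarrow> nat list \<Rightarrow> nat \<times> (nat \<times> dir) list"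

definition wf_tm :: "tm \<Rightarrow> bool" where
  "wf_tm M \<longleftrightarrow> 1 \<le> ntapes M \<and> 3 \<le> nsyms M \<and> 2 \<le> nstates M \<and>
     (\<forall>q rs. q < nstates M \<and> length rs = ntapes M \<and> set rs \<subseteq> {..<nsyms M} \<longrightarrow>
        fst (delta M q rs) < nstates M \<and>
        length (snd (delta M q rs)) = ntapes M \<and>
        fst ` set (snd (delta M q rs)) \<subseteq> {..<nsyms M})"

text \<open>A tape is given by its contents together with the position of the head.\<close>

type_synonym tape = "(int \<Rightarrow> nat) \<times> int"
type_synonym config = "nat \<times> tape list"

definition scan :: "tape \<Rightarrow> nat" where
  "scan t = fst t (snd t)"

definition act :: "tape \<Rightarrow> nat \<times> dir \<Rightarrow> tape" where
  "act t a = ((fst t)(snd t := fst a), snd t + offset (snd a))"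

definition tm_step :: "tm \<Rightarrow> config \<Rightarrow> config" where
  "tm_step M cf =
     (let q = fst cf; ts = snd cf; r = delta M q (map scan ts)
      in if q = 1 then cf else (fst r, map2 act ts (snd r)))"

definition bit_sym :: "bool \<Rightarrow> nat" where
  "bit_sym b = (if b then 2 else 1)"

definition input_tape :: "bool list \<Rightarrow> tape" where
  "input_tape xs =
     (\<lambda>i. if 0 \<le> i \<and> i < int (length xs) then bit_sym (xs ! nat i) else 0, 0)"

definition init_config :: "tm \<Rightarrow> bool list \<Rightarrow> config" where
  "init_config M xs = (0, input_tape xs # replicate (ntapes M - 1) (input_tape []))"

text \<open>
  The output is the string on the first tape that starts at the head and extends to the first blank.
\<close>

definition shows_output :: "tape \<Rightarrow> bool list \<Rightarrow> bool" where
  "shows_output t ys \<longleftrightarrow>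
     (\<forall>i<length ys. fst t (snd t + int i) = bit_sym (ys ! i)) \<and>
     fst t (snd t + int (length ys)) = 0"

text \<open>
  As \<^const>\<open>tm_step\<close> leaves halting configurations unchanged, the following says that
  the machine halts after at most \<open>T\<close> steps.
\<close>

definition computes_within :: "tm \<Rightarrow> bool list \<Rightarrow> bool list \<Rightarrow> nat \<Rightarrow> bool" where
  "computes_within M xs ys T \<longleftrightarrow>
     fst ((tm_step M ^^ T) (init_config M xs)) = 1 \<and>
     shows_output (hd (snd ((tm_step M ^^ T) (init_config M xs)))) ys"

definition polytime_computable :: "(bool list \<Rightarrow> bool list) \<Rightarrow> bool" where
  "polytime_computable f \<longleftrightarrow>
     (\<exists>M (p :: nat poly). wf_tm M \<and>
        (\<forall>xs. computes_within M xs (f xs) (poly p (length xs))))"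


section \<open>NP and NP-hardness\<close>

type_synonym language = "bool list set"

definition in_P :: "language \<Rightarrow> bool" where
  "in_P A \<longleftrightarrow> polytime_computable (\<lambda>xs. [xs \<in> A])"

text \<open>Self-delimiting code: every bit is preceded by \<open>True\<close>, and \<open>False\<close> ends the string.\<close>

definition enc_bits :: "bool list \<Rightarrow> bool list" where
  "enc_bits xs = concat (map (\<lambda>b. [True, b]) xs) @ [False]"

definition enc_pair :: "bool list \<Rightarrow> bool list \<Rightarrow> bool list" where
  "enc_pair xs ws = enc_bits xs @ ws"

definition in_NP :: "language \<Rightarrow> bool" where
  "in_NP A \<longleftrightarrow>
     (\<exists>V (p :: nat poly). in_P V \<and>
        (\<forall>xs. xs \<in> A \<longleftrightarrow> (\<exists>ws. length ws \<le> poly p (length xs) \<and> enc_pair xs ws \<in> V)))"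

definition polytime_reducible :: "language \<Rightarrow> language \<Rightarrow> bool" where
  "polytime_reducible A B \<longleftrightarrow>
     (\<exists>f. polytime_computable f \<and> (\<forall>xs. xs \<in> A \<longleftrightarrow> f xs \<in> B))"

definition np_hard :: "language \<Rightarrow> bool" where
  "np_hard B \<longleftrightarrow> (\<forall>A. in_NP A \<longrightarrow> polytime_reducible A B)"


section \<open>Flows and admissible paths\<close>

definition is_flow ::
  "('a, 'b) pre_digraph \<Rightarrow> ('b \<Rightarrow> nat) \<Rightarrow> 'a \<Rightarrow> 'a \<Rightarrow> ('b \<Rightarrow> real) \<Rightarrow> bool" where
  "is_flow G c s d f \<longleftrightarrow>
     (\<forall>e\<in>arcs G. 0 \<le> f e \<and> f e \<le> real (c e)) \<and>
     (\<forall>v\<in>verts G - {s, d}. sum f (in_arcs G v) = sum f (out_arcs G v))"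

definition flow_value :: "('a, 'b) pre_digraph \<Rightarrow> 'a \<Rightarrow> ('b \<Rightarrow> real) \<Rightarrow> real" where
  "flow_value G s f = sum f (out_arcs G s) - sum f (in_arcs G s)"

definition max_flow :: "('a, 'b) pre_digraph \<Rightarrow> ('b \<Rightarrow> nat) \<Rightarrow> 'a \<Rightarrow> 'a \<Rightarrow> real" where
  "max_flow G c s d = Sup {flow_value G s f | f. is_flow G c s d f}"

lemma zero_is_flow: "is_flow G c s d (\<lambda>_. 0)"
  by (simp add: is_flow_def)

lemma bdd_above_flow_values:
  assumes "finite (arcs G)"
  shows "bdd_above {flow_value G s f | f. is_flow G c s d f}"
proof (rule bdd_aboveI)
  fix y assume "y \<in> {flow_value G s f | f. is_flow G c s d f}"
  then obtain f where y: "y = flow_value G s f" and f: "is_flow G c s d f"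
    by blast
  have "sum f (out_arcs G s) \<le> (\<Sum>e\<in>out_arcs G s. real (c e))"
    using f by (intro sum_mono) (auto simp: is_flow_def)
  moreover have "0 \<le> sum f (in_arcs G s)"
    using f by (intro sum_nonneg) (auto simp: is_flow_def)
  ultimately show "y \<le> (\<Sum>e\<in>out_arcs G s. real (c e))"
    by (simp add: y flow_value_def)
qed

text \<open>
  Walks are lists of arcs and may repeat vertices and arcs, so this set may be infinite.
\<close>

definition admissible_paths ::
  "('a, 'b) pre_digraph \<Rightarrow> 'a \<Rightarrow> 'a \<Rightarrow> 'a set \<Rightarrow> 'b list set" where
  "admissible_paths G s d K =
     {p. pre_digraph.awalk G s p d \<and> set (pre_digraph.awalk_verts G s p) \<inter> K \<noteq> {}}"

definition feasible_placement ::
  "('a, 'b) pre_digraph \<Rightarrow> ('b \<Rightarrow> nat) \<Rightarrow> 'a \<Rightarrow> 'a \<Rightarrow> 'a set \<Rightarrow> bool" where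
  "feasible_placement G c s d K \<longleftrightarrow>
     K \<subseteq> verts G - {s, d} \<and>
     (\<exists>x :: 'b list \<Rightarrow> real.
        (\<forall>p\<in>admissible_paths G s d K. 0 \<le> x p) \<and>
        (x has_sum max_flow G c s d) (admissible_paths G s d K) \<and>
        (\<forall>e\<in>arcs G.
           (\<lambda>p. real (count_list p e) * x p) summable_on admissible_paths G s d K \<and>
           (\<Sum>\<^sub>\<infinity>p\<in>admissible_paths G s d K. real (count_list p e) * x p) \<le> real (c e)))"


section \<open>The decision problem as a language\<close>

text \<open>
  Vertices are named by natural numbers. An instance lists the vertices, the edges
  \<open>(u, v, c)\<close> from \<open>u\<close> to \<open>v\<close> with capacity \<open>c\<close>, the source, the destination and the bound
  on the number of virtualized nodes. All numbers are written in binary.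
\<close>

record placement_instance =
  inst_verts :: "nat list"
  inst_edges :: "(nat \<times> nat \<times> nat) list"
  inst_source :: nat
  inst_dest :: nat
  inst_bound :: int

definition inst_graph :: "placement_instance \<Rightarrow> (nat, nat \<times> nat) pre_digraph" where
  "inst_graph I = with_proj
     \<lparr> pverts = set (inst_verts I), parcs = (\<lambda>(u, v, c). (u, v)) ` set (inst_edges I) \<rparr>"

definition inst_cap :: "placement_instance \<Rightarrow> nat \<times> nat \<Rightarrow> nat" where
  "inst_cap I e = the (map_of (map (\<lambda>(u, v, c). ((u, v), c)) (inst_edges I)) e)"

definition valid_instance :: "placement_instance \<Rightarrow> bool" where
  "valid_instance I \<longleftrightarrow>
     distinct (inst_verts I) \<and>
     distinct (map (\<lambda>(u, v, c). (u, v)) (inst_edges I)) \<and>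
     fin_digraph (inst_graph I) \<and>
     inst_source I \<in> set (inst_verts I) \<and>
     inst_dest I \<in> set (inst_verts I) \<and>
     inst_source I \<noteq> inst_dest I"

definition yes_instance :: "placement_instance \<Rightarrow> bool" where
  "yes_instance I \<longleftrightarrow>
     (\<exists>K. feasible_placement (inst_graph I) (inst_cap I) (inst_source I) (inst_dest I) K \<and>
          int (card K) \<le> inst_bound I)"

text \<open>Binary digits, least significant first; zero has no digits.\<close>

fun binary :: "nat \<Rightarrow> bool list" where
  "binary n = (if n = 0 then [] else odd n # binary (n div 2))"

declare binary.simps [simp del]

lemma binary_0: "binary 0 = []"
  by (subst binary.simps) (rule if_P, rule refl)

lemma binary_pos: "n \<noteq> 0 \<Longrightarrow> binary n = odd n # binary (n div 2)"
  by (subst binary.simps) (rule if_not_P)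

definition enc_nat :: "nat \<Rightarrow> bool list" where
  "enc_nat n = enc_bits (binary n)"

definition enc_int :: "int \<Rightarrow> bool list" where
  "enc_int k = (k < 0) # enc_nat (nat \<bar>k\<bar>)"

definition enc_list :: "('a \<Rightarrow> bool list) \<Rightarrow> 'a list \<Rightarrow> bool list" where
  "enc_list f xs = concat (map (\<lambda>x. True # f x) xs) @ [False]"

definition enc_edge :: "nat \<times> nat \<times> nat \<Rightarrow> bool list" where
  "enc_edge = (\<lambda>(u, v, c). enc_nat u @ enc_nat v @ enc_nat c)"

definition enc_instance :: "placement_instance \<Rightarrow> bool list" where
  "enc_instance I =
     enc_list enc_nat (inst_verts I) @ enc_list enc_edge (inst_edges I) @
     enc_nat (inst_source I) @ enc_nat (inst_dest I) @ enc_int (inst_bound I)"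

definition vnf_placement :: language where
  "vnf_placement = {enc_instance I | I. valid_instance I \<and> yes_instance I}"

text \<open>The code is injective, so membership in the language is a property of the instance.\<close>

lemma enc_bits_simps:
  "enc_bits [] = [False]"
  "enc_bits (b # xs) = True # b # enc_bits xs"
  by (simp_all add: enc_bits_def)

lemma enc_bits_prefix_free: "enc_bits xs @ us = enc_bits ys @ vs \<longleftrightarrow> xs = ys \<and> us = vs"
proof (induction xs arbitrary: ys)
  case Nil
  show ?case by (cases ys) (auto simp: enc_bits_simps)
next
  case (Cons x xs)
  then show ?case by (cases ys) (auto simp: enc_bits_simps)
qed

lemma binary_inject: "binary m = binary n \<longleftrightarrow> m = n"
proof (induction m arbitrary: n rule: less_induct)
  case (less m)
  show ?case
  proof (cases "m = 0 \<or> n = 0")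
    case True
    then show ?thesis
      by (cases "m = 0"; cases "n = 0") (simp_all add: binary_0 binary_pos)
  next
    case False
    then have "binary m = binary n \<longleftrightarrow> odd m = odd n \<and> m div 2 = n div 2"
      using less.IH[of "m div 2" "n div 2"] by (simp add: binary_pos)
    also have "\<dots> \<longleftrightarrow> m = n"
      by presburger
    finally show ?thesis .
  qed
qed

lemma enc_nat_prefix_free: "enc_nat m @ us = enc_nat n @ vs \<longleftrightarrow> m = n \<and> us = vs"
  by (simp add: enc_nat_def enc_bits_prefix_free binary_inject)

lemma enc_int_inject: "enc_int k = enc_int l \<longleftrightarrow> k = l"
  using enc_nat_prefix_free[of "nat \<bar>k\<bar>" "[]" "nat \<bar>l\<bar>" "[]"] by (auto simp: enc_int_def)

lemma enc_edge_prefix_free: "enc_edge e @ us = enc_edge e' @ vs \<longleftrightarrow> e = e' \<and> us = vs"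
  by (auto simp: enc_edge_def enc_nat_prefix_free split: prod.split)

lemma enc_list_prefix_free:
  assumes "\<And>x y us vs. f x @ us = f y @ vs \<longleftrightarrow> x = y \<and> us = vs"
  shows "enc_list f xs @ us = enc_list f ys @ vs \<longleftrightarrow> xs = ys \<and> us = vs"
proof (induction xs arbitrary: ys)
  case Nil
  show ?case by (cases ys) (auto simp: enc_list_def)
next
  case (Cons x xs)
  then show ?case by (cases ys) (auto simp: enc_list_def assms)
qed

lemma enc_instance_inject: "enc_instance I = enc_instance J \<longleftrightarrow> I = J"
  by (auto simp: enc_instance_def enc_list_prefix_free enc_nat_prefix_free
      enc_edge_prefix_free enc_int_inject)

lemma enc_instance_in_vnf_placement:
  "enc_instance I \<in> vnf_placement \<longleftrightarrow> valid_instance I \<and> yes_instance I"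
  by (auto simp: vnf_placement_def enc_instance_inject)

end

theory Submission
  imports Defs
begin

text \<open>
  That the verifier accepts some witness is expressed by the satisfiability of clauses (Cook and
  Levin). Cells are addressed relative to the heads, so that a step of a machine with several tapes
  only shifts its tapes. Satisfiability becomes a hitting set problem: with as many elements allowed
  as there are variables, exactly one of the two literals of every variable is chosen. A hitting set
  problem is a placement problem on a network with three layers of arcs, from the source to the sets,
  from each set to its elements and from the elements to the destination, in which every set
  receives one unit of flow.

  The reduction has to run on a Turing machine. Its output is described by nested loops over unary
  counters, a counter being the position of a head on a tape with end markers. For this reason names
  of vertices contain their coordinates in unary, and the only conversion to binary is that of the
  bound on the number of virtualized nodes.
\<close>

section \<open>Structured programs for Turing machines\<close>

text \<open>Every walk from the source to the destination uses exactly one arc of each layer, so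
  there are only finitely many paths and no vertex is revisited. A flow of maximum value saturates
  every arc leaving the source. A set loses its unit if neither it nor one of its elements is
  virtualized, and this argument does not care whether flows are integral. Virtualizing a set vertex
  is no better than virtualizing one of its elements, so elements may be taken as the only
  candidates. The arcs into the destination merely have to be wide enough for all sets together;
  their capacity has the form \<open>2 ^ m - 1\<close> because its digits can be written without any
  conversion. The bound on the virtualized nodes must in contrast be exactly the number of
  variables: one unit of slack would allow both literals of some variable. This is why it alone
  needs arithmetic on the machine. Polynomial time is obtained once and for all for a small loop
  language, whose cost can be read off the syntax.\<close>

datatype prog =
    Step nat "nat option" dir
  | Then prog prog
  | Cond nat nat prog prog
  | Until nat nat prog

type_synonym cells = "(nat \<Rightarrow> nat) \<times> nat"
type_synonym store = "nat \<Rightarrow> cells"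

definition seen :: "cells \<Rightarrow> nat" where
  "seen t = fst t (snd t)"

fun shifted :: "dir \<Rightarrow> nat \<Rightarrow> nat" where
  "shifted ToLeft v = v - 1"
| "shifted Stay v = v"
| "shifted ToRight v = Suc v"

definition put :: "nat option \<Rightarrow> dir \<Rightarrow> cells \<Rightarrow> cells" where
  "put w d t =
     ((fst t)(snd t := (case w of None \<Rightarrow> seen t | Some s \<Rightarrow> s)), shifted d (snd t))"

text \<open>
  \<open>exec p \<sigma> t \<sigma>'\<close>: the program takes \<open>t\<close> steps from \<open>\<sigma>\<close> to \<open>\<sigma>'\<close>. A store describes only the part
  of a tape to the right of some origin, which the head never leaves; rule \<open>shift\<close> forgets
  an initial part of a tape by moving that origin.
\<close>

inductive exec :: "prog \<Rightarrow> store \<Rightarrow> nat \<Rightarrow> store \<Rightarrow> bool" where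
  step: "(d = ToLeft \<Longrightarrow> 0 < snd (\<sigma> i)) \<Longrightarrow> exec (Step i w d) \<sigma> 1 (\<sigma>(i := put w d (\<sigma> i)))"
| seq: "exec p \<sigma> t \<sigma>' \<Longrightarrow> exec q \<sigma>' t' \<sigma>'' \<Longrightarrow> exec (Then p q) \<sigma> (Suc (t + t')) \<sigma>''"
| cond_true: "seen (\<sigma> i) = s \<Longrightarrow> exec p \<sigma> t \<sigma>' \<Longrightarrow> exec (Cond i s p q) \<sigma> (Suc t) \<sigma>'"
| cond_false: "seen (\<sigma> i) \<noteq> s \<Longrightarrow> exec q \<sigma> t \<sigma>' \<Longrightarrow> exec (Cond i s p q) \<sigma> (Suc t) \<sigma>'"
| until_true: "seen (\<sigma> i) = s \<Longrightarrow> exec (Until i s p) \<sigma> 1 \<sigma>"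
| until_false: "seen (\<sigma> i) \<noteq> s \<Longrightarrow> exec p \<sigma> t \<sigma>' \<Longrightarrow> exec (Until i s p) \<sigma>' t' \<sigma>'' \<Longrightarrow>
    exec (Until i s p) \<sigma> (Suc (t + t')) \<sigma>''"
| shift: "\<sigma> i = (f, v + m) \<Longrightarrow> exec p (\<sigma>(i := (\<lambda>j. f (j + m), v))) t \<sigma>' \<Longrightarrow> exec p \<sigma> t \<sigma>'"

text \<open>The five symbols are the blank, the two bits and the markers 3 and 4.\<close>

fun wf_prog :: "nat \<Rightarrow> prog \<Rightarrow> bool" where
  "wf_prog n (Step i w d) \<longleftrightarrow> i < n \<and> (\<forall>s. w = Some s \<longrightarrow> s < 5)"
| "wf_prog n (Then p q) \<longleftrightarrow> wf_prog n p \<and> wf_prog n q"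
| "wf_prog n (Cond i s p q) \<longleftrightarrow> i < n \<and> wf_prog n p \<and> wf_prog n q"
| "wf_prog n (Until i s p) \<longleftrightarrow> i < n \<and> wf_prog n p"

subsection \<open>Running programs with a stack of continuations\<close>

fun successor :: "prog list \<Rightarrow> nat list \<Rightarrow> prog list" where
  "successor [] rs = []"
| "successor (Step i w d # ps) rs = ps"
| "successor (Then p q # ps) rs = p # q # ps"
| "successor (Cond i s p q # ps) rs = (if rs ! i = s then p else q) # ps"
| "successor (Until i s p # ps) rs = (if rs ! i = s then ps else p # Until i s p # ps)"

fun effect :: "prog list \<Rightarrow> nat list \<Rightarrow> nat \<Rightarrow> nat \<times> dir" where
  "effect (Step i w d # ps) rs j =
     (if j = i then (case w of None \<Rightarrow> rs ! j | Some s \<Rightarrow> s, d) else (rs ! j, Stay))"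
| "effect _ rs j = (rs ! j, Stay)"

text \<open>A step executes the elementary program on top or merely unfolds a compound one.
  Unfolding takes a step too, which is why \<open>exec\<close> charges one unit for
  \<open>Then\<close>, for \<open>Cond\<close> and for each test of \<open>Until\<close>; the two
  clocks agree exactly.\<close>

fun stack_step :: "prog list \<times> tape list \<Rightarrow> prog list \<times> tape list" where
  "stack_step (ps, ts) = (successor ps (map scan ts),
     map2 act ts (map (effect ps (map scan ts)) [0..<length ts]))"

text \<open>The origin of \<open>c\<close> lies \<open>snd c\<close> cells to the left of the head
  of \<open>t\<close>. Nothing is said about the cells further left, which makes the rule
  \<open>shift\<close> sound.\<close>

definition cells_of_tape :: "tape \<Rightarrow> cells \<Rightarrow> bool" where
  "cells_of_tape t c \<longleftrightarrow> (\<forall>j. fst t (snd t - int (snd c) + int j) = fst c j)"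

definition store_of_tapes :: "tape list \<Rightarrow> store \<Rightarrow> bool" where
  "store_of_tapes ts \<sigma> \<longleftrightarrow> (\<forall>i<length ts. cells_of_tape (ts ! i) (\<sigma> i))"

lemma scan_eq_seen: "cells_of_tape t c \<Longrightarrow> scan t = seen c"
  unfolding cells_of_tape_def scan_def seen_def by (metis diff_add_cancel)

lemma scan_nth: "store_of_tapes ts \<sigma> \<Longrightarrow> i < length ts \<Longrightarrow> scan (ts ! i) = seen (\<sigma> i)"
  by (simp add: store_of_tapes_def scan_eq_seen)

lemma cells_of_tape_put:
  assumes "cells_of_tape t c" "d = ToLeft \<Longrightarrow> 0 < snd c"
  shows "cells_of_tape (act t (case w of None \<Rightarrow> scan t | Some s \<Rightarrow> s, d)) (put w d c)"
  using assms scan_eq_seen[OF assms(1)]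
  by (cases d; cases w) (auto simp: cells_of_tape_def act_def put_def seen_def)

lemma act_stay: "act t (scan t, Stay) = t"
  by (simp add: act_def scan_def)

lemma cells_of_tape_shift:
  "cells_of_tape t (f, v + m) \<Longrightarrow> cells_of_tape t (\<lambda>j. f (j + m), v)"
  unfolding cells_of_tape_def
proof (intro allI)
  fix j assume a: "\<forall>j. fst t (snd t - int (snd (f, v + m)) + int j) = fst (f, v + m) j"
  have "snd t - int (snd (\<lambda>j. f (j + m), v)) + int j = snd t - int (snd (f, v + m)) + int (j + m)"
    by simp
  then show "fst t (snd t - int (snd (\<lambda>j. f (j + m), v)) + int j) = fst (\<lambda>j. f (j + m), v) j"
    using a[rule_format, of "j + m"] by (simp add: algebra_simps)
qed

lemma stack_step_same:
  assumes "\<And>j. j < length ts \<Longrightarrow> effect ps (map scan ts) j = (map scan ts ! j, Stay)"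
  shows "stack_step (ps, ts) = (successor ps (map scan ts), ts)"
proof -
  have "map2 act ts (map (effect ps (map scan ts)) [0..<length ts]) = ts"
    by (rule nth_equalityI) (simp_all add: assms act_stay)
  then show ?thesis by simp
qed

text \<open>The rest \<open>ps\<close> of the stack is arbitrary, so that the induction hypothesis
  for the first half of \<open>Then\<close>, or for the body of a loop, applies while further work
  is waiting. A \<open>shift\<close> takes no step and changes only the view of the tapes.\<close>

lemma exec_stack_steps:
  assumes "exec p \<sigma> t \<sigma>'" "wf_prog (length ts) p" "store_of_tapes ts \<sigma>"
  shows "\<exists>ts'. length ts' = length ts \<and> store_of_tapes ts' \<sigma>' \<and>
    (stack_step ^^ t) (p # ps, ts) = (ps, ts')"
  using assms
proof (induction arbitrary: ts ps rule: exec.induct)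
  case (step d \<sigma> i w)
  let ?ts = "map2 act ts (map (effect (Step i w d # ps) (map scan ts)) [0..<length ts])"
  have "store_of_tapes ?ts (\<sigma>(i := put w d (\<sigma> i)))"
    unfolding store_of_tapes_def
  proof (intro allI impI)
    fix j assume j: "j < length ?ts"
    then have "cells_of_tape (ts ! j) (\<sigma> j)"
      using step.prems by (simp add: store_of_tapes_def)
    then show "cells_of_tape (?ts ! j) ((\<sigma>(i := put w d (\<sigma> i))) j)"
      using j step.hyps cells_of_tape_put[of "ts ! j" "\<sigma> j" d w] act_stay[of "ts ! j"]
      by (auto split: option.splits)
  qed
  moreover have "length ?ts = length ts" by simp
  moreover have "(stack_step ^^ 1) (Step i w d # ps, ts) = (ps, ?ts)" by simp
  ultimately show ?case by blast
next
  case (seq p \<sigma> t \<sigma>' q t' \<sigma>'')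
  from seq.IH(1)[of ts "q # ps"] seq.prems obtain ts1 where
    1: "length ts1 = length ts" "store_of_tapes ts1 \<sigma>'" "(stack_step ^^ t) (p # q # ps, ts) = (q # ps, ts1)"
    by auto
  from seq.IH(2)[of ts1 ps] seq.prems 1 obtain ts2 where
    2: "length ts2 = length ts" "store_of_tapes ts2 \<sigma>''" "(stack_step ^^ t') (q # ps, ts1) = (ps, ts2)"
    by auto
  have "(stack_step ^^ Suc (t' + t)) (Then p q # ps, ts) = (ps, ts2)"
    using 1(3) 2(3) by (simp add: funpow_add funpow_Suc_right stack_step_same del: funpow.simps stack_step.simps)
  with 2 show ?case by (metis add.commute)
next
  case (cond_true \<sigma> i s p t \<sigma>' q)
  from cond_true.IH[of ts ps] cond_true.prems obtain ts1 where
    1: "length ts1 = length ts" "store_of_tapes ts1 \<sigma>'" "(stack_step ^^ t) (p # ps, ts) = (ps, ts1)"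
    by auto
  have "map scan ts ! i = s"
    using cond_true by (simp add: scan_nth)
  then have "(stack_step ^^ Suc t) (Cond i s p q # ps, ts) = (ps, ts1)"
    using 1(3) by (simp add: funpow_Suc_right stack_step_same del: funpow.simps stack_step.simps)
  with 1 show ?case by metis
next
  case (cond_false \<sigma> i s q t \<sigma>' p)
  from cond_false.IH[of ts ps] cond_false.prems obtain ts1 where
    1: "length ts1 = length ts" "store_of_tapes ts1 \<sigma>'" "(stack_step ^^ t) (q # ps, ts) = (ps, ts1)"
    by auto
  have "map scan ts ! i \<noteq> s"
    using cond_false by (simp add: scan_nth)
  then have "(stack_step ^^ Suc t) (Cond i s p q # ps, ts) = (ps, ts1)"
    using 1(3) by (simp add: funpow_Suc_right stack_step_same del: funpow.simps stack_step.simps)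
  with 1 show ?case by metis
next
  case (until_true \<sigma> i s p)
  have "map scan ts ! i = s"
    using until_true by (simp add: scan_nth)
  then have "(stack_step ^^ 1) (Until i s p # ps, ts) = (ps, ts)"
    by (simp add: stack_step_same del: stack_step.simps)
  with until_true show ?case by metis
next
  case (until_false \<sigma> i s p t \<sigma>' t' \<sigma>'')
  from until_false.IH(1)[of ts "Until i s p # ps"] until_false.prems obtain ts1 where
    1: "length ts1 = length ts" "store_of_tapes ts1 \<sigma>'"
      "(stack_step ^^ t) (p # Until i s p # ps, ts) = (Until i s p # ps, ts1)"
    by auto
  from until_false.IH(2)[of ts1 ps] until_false.prems 1 obtain ts2 where
    2: "length ts2 = length ts" "store_of_tapes ts2 \<sigma>''"
      "(stack_step ^^ t') (Until i s p # ps, ts1) = (ps, ts2)"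
    by auto
  have "map scan ts ! i \<noteq> s"
    using until_false by (simp add: scan_nth)
  then have "(stack_step ^^ Suc (t' + t)) (Until i s p # ps, ts) = (ps, ts2)"
    using 1(3) 2(3) by (simp add: funpow_add funpow_Suc_right stack_step_same del: funpow.simps stack_step.simps)
  with 2 show ?case by (metis add.commute)
next
  case (shift \<sigma> i f v m p t \<sigma>')
  have "store_of_tapes ts (\<sigma>(i := (\<lambda>j. f (j + m), v)))"
    using shift.hyps(1) shift.prems(2)
    by (auto simp: store_of_tapes_def intro: cells_of_tape_shift) (metis cells_of_tape_shift)
  from shift.IH[OF shift.prems(1) this] show ?case .
qed

section \<open>Continuation stacks as the finitely many states of a machine\<close>

fun reachable :: "prog \<Rightarrow> prog list \<Rightarrow> prog list set" where
  "reachable (Step i w d) ps = {Step i w d # ps}"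
| "reachable (Then p q) ps = insert (Then p q # ps) (reachable p (q # ps) \<union> reachable q ps)"
| "reachable (Cond i s p q) ps = insert (Cond i s p q # ps) (reachable p ps \<union> reachable q ps)"
| "reachable (Until i s p) ps = insert (Until i s p # ps) (reachable p (Until i s p # ps))"

text \<open>Loops do not make the stacks grow: when the body of \<open>Until\<close> is finished,
  the loop is on top of the same stack as before.\<close>

lemma finite_reachable: "finite (reachable p ps)"
  by (induction p ps rule: reachable.induct) auto

lemma reachable_self: "p # ps \<in> reachable p ps"
  by (cases p) auto

lemma Nil_notin_reachable: "[] \<notin> reachable p ps"
  by (induction p ps rule: reachable.induct) auto

lemma successor_reachable:
  "qs \<in> reachable p ps \<Longrightarrow> successor qs rs \<in> insert ps (reachable p ps)"
proof (induction p ps rule: reachable.induct)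
  case (2 p q ps)
  then show ?case using reachable_self[of q ps] reachable_self[of p "q # ps"] by auto
next
  case (3 i s p q ps)
  then show ?case using reachable_self[of q ps] reachable_self[of p ps] by auto
next
  case (4 i s p ps)
  then show ?case using reachable_self[of p "Until i s p # ps"] by (auto split: if_splits)
qed auto

lemma effect_reachable:
  assumes "qs \<in> reachable p ps" "wf_prog n p" "set rs \<subseteq> {..<5}" "length rs = n" "j < n"
  shows "fst (effect qs rs j) < 5"
proof -
  have "rs ! j < 5"
    using assms(3-5) by (metis lessThan_iff nth_mem subset_iff)
  then show ?thesis using assms(1,2)
    by (induction p ps rule: reachable.induct) (auto split: option.splits)
qed

lemma exec_tm:
  assumes "wf_prog n p" "1 \<le> n"
  obtains M where "wf_tm M" "ntapes M = n"
    "\<And>ts \<sigma> t \<sigma>'. exec p \<sigma> t \<sigma>' \<Longrightarrow> length ts = n \<Longrightarrow> store_of_tapes ts \<sigma> \<Longrightarrow>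
       \<exists>ts'. length ts' = n \<and> store_of_tapes ts' \<sigma>' \<and> (tm_step M ^^ t) (0, ts) = (1, ts')"
proof -
  let ?Q = "insert [] (reachable p [])"
  let ?R = "reachable p [] - {[p]}"
  obtain rest where rest: "set rest = ?R" "distinct rest"
    using finite_distinct_list[of ?R] finite_reachable by auto
  \<comment> \<open>This order gives the initial stack the number 0 and the empty stack the number
    1, the start and the halting state.\<close>
  define qs where "qs = [p] # [] # rest"
  have set_qs: "set qs = ?Q"
    using rest reachable_self[of p "[]"] by (auto simp: qs_def)
  have dist: "distinct qs"
    using rest Nil_notin_reachable[of p "[]"] by (auto simp: qs_def)
  define code where "code = the_inv_into {..<length qs} ((!) qs)"
  have inj: "inj_on ((!) qs) {..<length qs}"
    using dist by (simp add: inj_on_nth)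
  have img: "(!) qs ` {..<length qs} = ?Q"
    using set_qs by (metis atLeast0LessThan atLeast_upt list.set_map map_nth)
  have code_lt: "code st < length qs" if "st \<in> ?Q" for st
    using the_inv_into_into[OF inj, of st "{..<length qs}"] that img by (auto simp: code_def)
  have nth_code: "qs ! code st = st" if "st \<in> ?Q" for st
    using f_the_inv_into_f[OF inj, of st] that img by (simp add: code_def)
  have code_nth: "code (qs ! i) = i" if "i < length qs" for i
    using the_inv_into_f_f[OF inj, of i] that by (simp add: code_def)
  define M where "M = \<lparr>ntapes = n, nsyms = 5, nstates = length qs,
    delta = (\<lambda>q rs. (code (successor (qs ! q) rs), map (effect (qs ! q) rs) [0..<n]))\<rparr>"
  have succ: "successor st rs \<in> ?Q" if "st \<in> ?Q" for st rs
    using that successor_reachable[of st p "[]" rs] by auto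
  have "wf_tm M"
    unfolding wf_tm_def
  proof (intro conjI allI impI)
    fix q rs assume a: "q < nstates M \<and> length rs = ntapes M \<and> set rs \<subseteq> {..<nsyms M}"
    then have q: "qs ! q \<in> ?Q" using img by (auto simp: M_def)
    show "fst (delta M q rs) < nstates M"
      using code_lt[OF succ[OF q]] by (simp add: M_def)
    show "length (snd (delta M q rs)) = ntapes M" by (simp add: M_def)
    show "fst ` set (snd (delta M q rs)) \<subseteq> {..<nsyms M}"
    proof (cases "qs ! q = []")
      case True
      with a show ?thesis by (auto simp: M_def subset_iff dest!: nth_mem)
    next
      case False
      with q have "qs ! q \<in> reachable p []" by auto
      from effect_reachable[OF this assms(1)] a show ?thesis by (auto simp: M_def)
    qed
  qed (use assms in \<open>auto simp: M_def qs_def\<close>)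
  have sim: "tm_step M (code st, ts) = (code (fst (stack_step (st, ts))), snd (stack_step (st, ts)))"
    if "st \<in> ?Q" "length ts = n" for st ts
  proof (cases "st = []")
    case True
    then have "code st = 1" using code_nth[of 1] by (simp add: qs_def)
    with True show ?thesis using stack_step_same[of ts "[]"] by (simp add: tm_step_def)
  next
    case False
    have "code st \<noteq> 1"
    proof
      assume "code st = 1"
      then have "qs ! 1 = st" using nth_code[OF that(1)] by simp
      with False show False by (simp add: qs_def)
    qed
    then show ?thesis using that nth_code[OF that(1)]
      by (simp add: tm_step_def M_def Let_def)
  qed
  have sims: "(tm_step M ^^ t) (code st, ts) =
      (code (fst ((stack_step ^^ t) (st, ts))), snd ((stack_step ^^ t) (st, ts)))
    \<and> fst ((stack_step ^^ t) (st, ts)) \<in> ?Q \<and> length (snd ((stack_step ^^ t) (st, ts))) = n"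
    if "st \<in> ?Q" "length ts = n" for st ts t
  proof (induction t)
    case (Suc t)
    obtain st' ts' where e: "(stack_step ^^ t) (st, ts) = (st', ts')" by fastforce
    with Suc have "st' \<in> ?Q" "length ts' = n" by auto
    then show ?case using Suc e sim[of st' ts'] succ[of st'] by simp
  qed (use that in auto)
  have c0: "code [p] = 0" using code_nth[of 0] by (simp add: qs_def)
  have c1: "code [] = 1" using code_nth[of 1] by (simp add: qs_def)
  show ?thesis
  proof (rule that)
    show "wf_tm M" by fact
    show "ntapes M = n" by (simp add: M_def)
    fix ts \<sigma> t \<sigma>' assume a: "exec p \<sigma> t \<sigma>'" "length ts = n" "store_of_tapes ts \<sigma>"
    from exec_stack_steps[OF a(1) _ a(3), of "[]"] a(2) assms(1) obtain ts' where
      "length ts' = n" "store_of_tapes ts' \<sigma>'" "(stack_step ^^ t) ([p], ts) = ([], ts')" by auto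
    with sims[of "[p]" ts t] a(2) c0 c1 reachable_self[of p "[]"]
    show "\<exists>ts'. length ts' = n \<and> store_of_tapes ts' \<sigma>' \<and> (tm_step M ^^ t) (0, ts) = (1, ts')"
      by auto
  qed
qed

definition init_store :: "bool list \<Rightarrow> store" where
  "init_store xs = (\<lambda>i. (\<lambda>j. if i = 0 \<and> j < length xs then bit_sym (xs ! j) else 0, 0))"

definition store_shows :: "cells \<Rightarrow> bool list \<Rightarrow> bool" where
  "store_shows c ys \<longleftrightarrow>
     (\<forall>i<length ys. fst c (snd c + i) = bit_sym (ys ! i)) \<and> fst c (snd c + length ys) = 0"

lemma tm_step_halted: "fst cf = 1 \<Longrightarrow> (tm_step M ^^ t) cf = cf"
  by (induction t) (simp_all add: tm_step_def)

lemma tm_steps_halted: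
  assumes "(tm_step M ^^ t) cf = (1, ts)" "t \<le> T"
  shows "(tm_step M ^^ T) cf = (1, ts)"
proof -
  have "(tm_step M ^^ (T - t + t)) cf = (1, ts)"
    using assms(1) tm_step_halted[where cf = "(1, ts)"] by (simp add: funpow_add)
  with assms(2) show ?thesis by simp
qed

lemma polytime_computable_exec:
  fixes b :: "nat poly"
  assumes "wf_prog n p" "1 \<le> n"
    and "\<And>xs. \<exists>t \<sigma>. t \<le> poly b (length xs) \<and> exec p (init_store xs) t \<sigma> \<and> store_shows (\<sigma> 0) (f xs)"
  shows "polytime_computable f"
proof -
  from exec_tm[OF assms(1,2)] obtain M where M: "wf_tm M" "ntapes M = n"
    "\<And>ts \<sigma> t \<sigma>'. exec p \<sigma> t \<sigma>' \<Longrightarrow> length ts = n \<Longrightarrow> store_of_tapes ts \<sigma> \<Longrightarrow>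
       \<exists>ts'. length ts' = n \<and> store_of_tapes ts' \<sigma>' \<and> (tm_step M ^^ t) (0, ts) = (1, ts')"
    by blast
  have "computes_within M xs (f xs) (poly b (length xs))" for xs
  proof -
    obtain t \<sigma> where t: "t \<le> poly b (length xs)" "exec p (init_store xs) t \<sigma>" "store_shows (\<sigma> 0) (f xs)"
      using assms(3) by blast
    have "store_of_tapes (input_tape xs # replicate (n - 1) (input_tape [])) (init_store xs)"
      by (auto simp: store_of_tapes_def cells_of_tape_def init_store_def input_tape_def nth_Cons split: nat.splits)
    moreover have "length (input_tape xs # replicate (n - 1) (input_tape [])) = n"
      using assms(2) by simp
    ultimately obtain ts' where ts': "length ts' = n" "store_of_tapes ts' \<sigma>"
      "(tm_step M ^^ t) (init_config M xs) = (1, ts')"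
      using M(3)[OF t(2)] unfolding init_config_def M(2) by blast
    have "cells_of_tape (hd ts') (\<sigma> 0)"
      using ts'(1,2) assms(2) by (cases ts') (auto simp: store_of_tapes_def)
    then have eq: "fst (hd ts') (snd (hd ts') + int i) = fst (\<sigma> 0) (snd (\<sigma> 0) + i)" for i
      unfolding cells_of_tape_def by (metis add.assoc diff_add_cancel of_nat_add)
    have "shows_output (hd ts') (f xs)"
      using t(3) eq by (simp add: shows_output_def store_shows_def)
    then show ?thesis
      using tm_steps_halted[OF ts'(3) t(1)] by (simp add: computes_within_def)
  qed
  with M(1) show ?thesis unfolding polytime_computable_def by blast
qed

section \<open>A language for emitting bit strings\<close>

definition runs :: "prog \<Rightarrow> store \<Rightarrow> nat \<Rightarrow> store \<Rightarrow> bool" where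
  "runs p \<sigma> T \<sigma>' \<longleftrightarrow> (\<exists>t\<le>T. exec p \<sigma> t \<sigma>')"

lemma runs_mono: "runs p \<sigma> T \<sigma>' \<Longrightarrow> T \<le> T' \<Longrightarrow> runs p \<sigma> T' \<sigma>'"
  unfolding runs_def by (meson order.trans)

lemma runs_step:
  "(d = ToLeft \<Longrightarrow> 0 < snd (\<sigma> i)) \<Longrightarrow> \<sigma>' = \<sigma>(i := put w d (\<sigma> i)) \<Longrightarrow> 1 \<le> T \<Longrightarrow>
    runs (Step i w d) \<sigma> T \<sigma>'"
  unfolding runs_def using exec.step by blast

lemma runs_seq:
  assumes "runs p \<sigma> a \<sigma>'" "runs q \<sigma>' b \<sigma>''" "a + b + 1 \<le> T"
  shows "runs (Then p q) \<sigma> T \<sigma>''"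
proof -
  obtain t t' where "t \<le> a" "exec p \<sigma> t \<sigma>'" "t' \<le> b" "exec q \<sigma>' t' \<sigma>''"
    using assms unfolding runs_def by blast
  moreover from this have "Suc (t + t') \<le> T" using assms(3) by linarith
  ultimately show ?thesis unfolding runs_def using exec.seq by blast
qed

lemma runs_cond:
  assumes "if seen (\<sigma> i) = s then runs p \<sigma> a \<sigma>' else runs q \<sigma> a \<sigma>'" "a + 1 \<le> T"
  shows "runs (Cond i s p q) \<sigma> T \<sigma>'"
proof -
  obtain t where "t \<le> a" "if seen (\<sigma> i) = s then exec p \<sigma> t \<sigma>' else exec q \<sigma> t \<sigma>'"
    using assms unfolding runs_def by (metis (full_types))
  moreover from this have "Suc t \<le> T" using assms(2) by linarith
  ultimately show ?thesis unfolding runs_def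
    using exec.cond_true[of \<sigma> i s p t \<sigma>' q] exec.cond_false[of \<sigma> i s q t \<sigma>' p] by metis
qed

lemma runs_until_stop: "seen (\<sigma> i) = s \<Longrightarrow> 1 \<le> T \<Longrightarrow> runs (Until i s p) \<sigma> T \<sigma>"
  unfolding runs_def using exec.until_true by blast

lemma runs_until_step:
  assumes "seen (\<sigma> i) \<noteq> s" "runs p \<sigma> a \<sigma>'" "runs (Until i s p) \<sigma>' b \<sigma>''" "a + b + 1 \<le> T"
  shows "runs (Until i s p) \<sigma> T \<sigma>''"
proof -
  obtain t t' where "t \<le> a" "exec p \<sigma> t \<sigma>'" "t' \<le> b" "exec (Until i s p) \<sigma>' t' \<sigma>''"
    using assms unfolding runs_def by blast
  moreover from this have "Suc (t + t') \<le> T" using assms(4) by linarith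
  ultimately show ?thesis unfolding runs_def using exec.until_false[of \<sigma> i s p t \<sigma>' t' \<sigma>''] assms(1) by blast
qed

text \<open>\<open>S k\<close> is the store after \<open>k\<close> rounds. Each round costs at most
  \<open>c\<close>, plus one unit for its test; the final unit is the test that stops the
  loop.\<close>

lemma runs_until:
  assumes "\<And>k. k < m \<Longrightarrow> seen (S k i) \<noteq> s \<and> runs p (S k) c (S (Suc k))" "seen (S m i) = s"
    "m * (c + 1) + 1 \<le> T"
  shows "runs (Until i s p) (S 0) T (S m)"
proof -
  have "runs (Until i s p) (S (m - k)) (k * (c + 1) + 1) (S m)" if "k \<le> m" for k
    using that
  proof (induction k)
    case 0
    then show ?case using assms(2) by (simp add: runs_until_stop)
  next
    case (Suc k)
    then have "runs (Until i s p) (S (Suc (m - Suc k))) (k * (c + 1) + 1) (S m)"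
      by (simp add: Suc_diff_Suc)
    then show ?case using assms(1)[of "m - Suc k"] Suc.prems
      by (intro runs_until_step[of "S (m - Suc k)" i s p c "S (Suc (m - Suc k))"]) auto
  qed
  from this[of m] show ?thesis using assms(3) runs_mono by force
qed

subsection \<open>Tapes used as counters\<close>

text \<open>
  The head position is the value of a counter. Symbol 3 marks position 0; on a tape that
  bounds a loop, symbol 4 follows the contents.
\<close>

definition marked :: "bool list \<Rightarrow> nat \<Rightarrow> nat" where
  "marked w j = (if j = 0 then 3 else if j \<le> length w then bit_sym (w ! (j - 1)) else 0)"

definition closed_off :: "bool list \<Rightarrow> nat \<Rightarrow> nat" where
  "closed_off w = (marked w)(Suc (length w) := 4)"

lemma bit_sym_less: "bit_sym b < 3" "0 < bit_sym b"
  by (auto simp: bit_sym_def)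

lemma marked_eq_3: "marked w j = 3 \<longleftrightarrow> j = 0"
  using bit_sym_less[of "w ! (j - 1)"] by (auto simp: marked_def)

lemma closed_off_eq_3: "closed_off w j = 3 \<longleftrightarrow> j = 0"
  using marked_eq_3[of w j] by (auto simp: closed_off_def)

lemma closed_off_eq_4: "closed_off w j = 4 \<longleftrightarrow> j = Suc (length w)"
  using bit_sym_less(1)[of "w ! (j - 1)"] by (auto simp: closed_off_def marked_def)

lemma closed_off_eq_2: "closed_off w j = 2 \<longleftrightarrow> 0 < j \<and> j \<le> length w \<and> w ! (j - 1)"
  by (auto simp: closed_off_def marked_def bit_sym_def)

lemma marked_write: "(marked w)(Suc (length w) := bit_sym b) = marked (w @ [b])"
  by (auto simp: marked_def fun_eq_iff nth_append)

abbreviation left :: "nat \<Rightarrow> prog" where "left i \<equiv> Step i None ToLeft"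
abbreviation right :: "nat \<Rightarrow> prog" where "right i \<equiv> Step i None ToRight"
abbreviation skip :: prog where "skip \<equiv> Step 0 None Stay"

lemma put_None [simp]: "put None d (f, v) = (f, shifted d v)"
  by (simp add: put_def seen_def)

lemma put_Some [simp]: "put (Some s) d (f, v) = (f(v := s), shifted d v)"
  by (simp add: put_def)

lemma seen_pair [simp]: "seen (f, v) = f v"
  by (simp add: seen_def)

lemma runs_left: "\<sigma> i = (f, Suc v) \<Longrightarrow> 1 \<le> T \<Longrightarrow> \<sigma>' = \<sigma>(i := (f, v)) \<Longrightarrow> runs (left i) \<sigma> T \<sigma>'"
  by (rule runs_step) auto

lemma runs_right: "\<sigma> i = (f, v) \<Longrightarrow> 1 \<le> T \<Longrightarrow> \<sigma>' = \<sigma>(i := (f, Suc v)) \<Longrightarrow> runs (right i) \<sigma> T \<sigma>'"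
  by (rule runs_step) auto

lemma runs_skip: "1 \<le> T \<Longrightarrow> runs skip \<sigma> T \<sigma>"
  by (rule runs_step, simp, cases "\<sigma> 0") (auto simp: fun_eq_iff)

lemma runs_rewind:
  assumes "\<sigma> i = (f, v)" "\<And>j. f j = 3 \<longleftrightarrow> j = 0" "2 * v + 1 \<le> T" "\<sigma>' = \<sigma>(i := (f, 0))"
  shows "runs (Until i 3 (left i)) \<sigma> T \<sigma>'"
proof -
  let ?S = "\<lambda>k. \<sigma>(i := (f, v - k))"
  have "runs (Until i 3 (left i)) (?S 0) T (?S v)"
  proof (rule runs_until[where S = ?S])
    fix k assume k: "k < v"
    have "runs (left i) (?S k) 1 (?S (Suc k))"
      using k by (intro runs_left[of _ i f "v - Suc k"]) auto
    with k show "seen (?S k i) \<noteq> 3 \<and> runs (left i) (?S k) 1 (?S (Suc k))"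
      by (simp add: assms(2))
  qed (use assms in auto)
  moreover have "?S 0 = \<sigma>" using assms(1) by auto
  ultimately show ?thesis using assms(4) by simp
qed

definition outs :: "nat \<Rightarrow> bool list \<Rightarrow> prog" where
  "outs out w = foldr (\<lambda>b p. Then (Step out (Some (bit_sym b)) ToRight) p) w skip"

abbreviation emitted :: "bool list \<Rightarrow> cells" where
  "emitted w \<equiv> (marked w, Suc (length w))"

lemma runs_out:
  assumes "\<sigma> out = emitted w" "1 \<le> T" "\<sigma>' = \<sigma>(out := emitted (w @ [b]))"
  shows "runs (Step out (Some (bit_sym b)) ToRight) \<sigma> T \<sigma>'"
  using assms by (intro runs_step) (auto simp: marked_write)

lemma runs_outs:
  assumes "\<sigma> out = emitted w" "2 * length u + 1 \<le> T" "\<sigma>' = \<sigma>(out := emitted (w @ u))"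
  shows "runs (outs out u) \<sigma> T \<sigma>'"
  using assms
proof (induction u arbitrary: \<sigma> w T \<sigma>')
  case Nil
  then have "\<sigma>' = \<sigma>" by auto
  with Nil show ?case by (simp add: outs_def runs_skip)
next
  case (Cons b u)
  have "runs (Step out (Some (bit_sym b)) ToRight) \<sigma> 1 (\<sigma>(out := emitted (w @ [b])))"
    using Cons.prems by (intro runs_out) auto
  moreover have "runs (outs out u) (\<sigma>(out := emitted (w @ [b]))) (2 * length u + 1) \<sigma>'"
    using Cons.prems by (intro Cons.IH) auto
  ultimately show ?case using Cons.prems
    by (auto simp: outs_def intro: runs_seq)
qed

subsection \<open>Syntax, meaning and compilation\<close>

datatype gen =
    Nop
  | Out bool
  | Both gen gen
  | Ifb nat gen gen
  | For nat gen
  | Rep nat "bool list"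
  | Bin nat

text \<open>
  Tape \<open>i\<close> has contents \<open>D ! i\<close>, and \<open>e i\<close> is the position of its head, so that a loop over
  the tape counts from 1 to the length of the contents.
\<close>

fun den :: "bool list list \<Rightarrow> (nat \<Rightarrow> nat) \<Rightarrow> gen \<Rightarrow> bool list" where
  "den D e Nop = []"
| "den D e (Out b) = [b]"
| "den D e (Both g h) = den D e g @ den D e h"
| "den D e (Ifb i g h) =
     (if 0 < e i \<and> e i \<le> length (D ! i) \<and> D ! i ! (e i - 1) then den D e g else den D e h)"
| "den D e (For i g) = concat (map (\<lambda>v. den D (e(i := v)) g) [1..<Suc (length (D ! i))])"
| "den D e (Rep i w) = concat (replicate (e i) w)"
| "den D e (Bin i) = concat (map (\<lambda>b. [True, b]) (binary (length (D ! i))))"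

text \<open>
  Tape 1 is scratch. Binary digits arise by halving: move the head of tape \<open>i\<close> two to the left
  for every move of the scratch head to the right, then copy the position back.
\<close>

definition halve :: "nat \<Rightarrow> nat \<Rightarrow> prog" where
  "halve out i = Until i 3 (Then (left i) (Cond i 3 (outs out [True])
     (Then (left i) (Then (right 1) (Cond i 3 (outs out [False]) skip)))))"

definition give_back :: "nat \<Rightarrow> prog" where
  "give_back i = Until 1 3 (Then (left 1) (right i))"

fun compile :: "nat \<Rightarrow> gen \<Rightarrow> prog" where
  "compile out Nop = skip"
| "compile out (Out b) = Step out (Some (bit_sym b)) ToRight"
| "compile out (Both g h) = Then (compile out g) (compile out h)"
| "compile out (Ifb i g h) = Cond i 2 (compile out g) (compile out h)"
| "compile out (For i g) =
     Then (right i) (Then (Until i 4 (Then (compile out g) (right i))) (Until i 3 (left i)))"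
| "compile out (Rep i w) =
     Then (Until i 3 (Then (left i) (Then (right 1) (outs out w)))) (give_back i)"
| "compile out (Bin i) =
     Then (Until i 4 (right i)) (Then (left i)
       (Until i 3 (Then (outs out [True]) (Then (halve out i) (give_back i)))))"

text \<open>Tapes whose heads must stand at position 0 at the start, because \<open>For\<close> and
  \<open>Bin\<close> sweep the whole tape and leave the head at 0. Hence \<open>wf_gen\<close>
  forbids to park a loop tape inside its own loop, whereas \<open>Rep\<close> may use the running
  counter, whose position it restores.\<close>

fun parked :: "gen \<Rightarrow> nat set" where
  "parked (Both g h) = parked g \<union> parked h"
| "parked (Ifb i g h) = parked g \<union> parked h"
| "parked (For i g) = insert i (parked g)"
| "parked (Bin i) = {i}"
| "parked _ = {}"

fun wf_gen :: "nat \<Rightarrow> gen \<Rightarrow> bool" where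
  "wf_gen n (Both g h) \<longleftrightarrow> wf_gen n g \<and> wf_gen n h"
| "wf_gen n (Ifb i g h) \<longleftrightarrow> 2 \<le> i \<and> i < n \<and> wf_gen n g \<and> wf_gen n h"
| "wf_gen n (For i g) \<longleftrightarrow> 2 \<le> i \<and> i < n \<and> i \<notin> parked g \<and> wf_gen n g"
| "wf_gen n (Rep i w) \<longleftrightarrow> 2 \<le> i \<and> i < n"
| "wf_gen n (Bin i) \<longleftrightarrow> 2 \<le> i \<and> i < n"
| "wf_gen n _ \<longleftrightarrow> True"

text \<open>\<open>b\<close> bounds the lengths of the tapes. The constants are generous; what
  matters is that the value is polynomial in \<open>b\<close> for a fixed generator.\<close>

fun cost :: "nat \<Rightarrow> gen \<Rightarrow> nat" where
  "cost b Nop = 1"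
| "cost b (Out _) = 1"
| "cost b (Both g h) = cost b g + cost b h + 1"
| "cost b (Ifb i g h) = cost b g + cost b h + 1"
| "cost b (For i g) = b * (cost b g + 10) + 10"
| "cost b (Rep i w) = b * (2 * length w + 20) + 10"
| "cost b (Bin i) = b * (20 * b + 40) + 10"

lemma wf_prog_outs: "out < m \<Longrightarrow> wf_prog m (outs out w)"
  by (induction w) (auto simp: outs_def bit_sym_def)

lemma wf_prog_compile: "wf_gen n g \<Longrightarrow> n \<le> m \<Longrightarrow> out < m \<Longrightarrow> 2 \<le> m \<Longrightarrow> wf_prog m (compile out g)"
  by (induction g) (auto simp: wf_prog_outs halve_def give_back_def bit_sym_def)

lemma runs_give_back:
  assumes "\<sigma> 1 = (marked [], v)" "\<sigma> i = (f, u)" "i \<noteq> 1" "4 * v + 1 \<le> T"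
    "\<sigma>' = \<sigma>(1 := (marked [], 0), i := (f, u + v))"
  shows "runs (give_back i) \<sigma> T \<sigma>'"
proof -
  let ?S = "\<lambda>k. \<sigma>(1 := (marked [], v - k), i := (f, u + k))"
  have "runs (give_back i) (?S 0) T (?S v)"
    unfolding give_back_def
  proof (rule runs_until[where c = 3])
    fix k assume k: "k < v"
    have "runs (left 1) (?S k) 1 ((?S k)(1 := (marked [], v - Suc k)))"
      using k assms(3) by (intro runs_left[of _ 1 "marked []" "v - Suc k"]) auto
    moreover have "runs (right i) ((?S k)(1 := (marked [], v - Suc k))) 1 (?S (Suc k))"
      using assms(3) by (intro runs_right[of _ i f "u + k"]) auto
    ultimately have "runs (Then (left 1) (right i)) (?S k) 3 (?S (Suc k))"
      by (rule runs_seq) simp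
    with k assms(3) show "seen (?S k 1) \<noteq> 3 \<and> runs (Then (left 1) (right i)) (?S k) 3 (?S (Suc k))"
      by (simp add: marked_eq_3)
  qed (use assms in \<open>auto simp: marked_eq_3\<close>)
  moreover have "?S 0 = \<sigma>" using assms(1-3) by auto
  ultimately show ?thesis using assms(5) by simp
qed

text \<open>Every round removes two positions. In the last round the marker is met after the first
  move if \<open>v\<close> is odd and after the second if \<open>v\<close> is even, so exactly one
  digit is emitted. The scratch head counts the rounds that are complete, which gives
  \<open>v div 2\<close>.\<close>

lemma runs_halve:
  assumes "\<sigma> i = (f, v)" "\<And>j. f j = 3 \<longleftrightarrow> j = 0" "\<sigma> 1 = (marked [], u)" "\<sigma> out = emitted w"
    "i \<noteq> 1" "out \<noteq> 1" "out \<noteq> i" "0 < v" "8 * v + 4 \<le> T"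
    "\<sigma>' = \<sigma>(i := (f, 0), 1 := (marked [], u + v div 2), out := emitted (w @ [odd v]))"
  shows "runs (halve out i) \<sigma> T \<sigma>'"
  using assms
proof (induction v arbitrary: \<sigma> u T rule: less_induct)
  case (less v)
  let ?body = "Then (left i) (Cond i 3 (outs out [True])
     (Then (left i) (Then (right 1) (Cond i 3 (outs out [False]) skip))))"
  let ?s1 = "\<sigma>(i := (f, v - 1))"
  have l1: "runs (left i) \<sigma> 1 ?s1"
    using less.prems by (intro runs_left[of _ i f "v - 1"]) (simp_all add: fun_eq_iff)
  have seen0: "seen (\<sigma> i) \<noteq> 3" using less.prems by simp
  show ?case
  proof (cases "v = 1")
    case True
    have "runs (outs out [True]) ?s1 3 \<sigma>'"
      using less.prems True by (intro runs_outs[of _ out w]) (simp_all add: fun_eq_iff)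
    then have "runs (Cond i 3 (outs out [True])
      (Then (left i) (Then (right 1) (Cond i 3 (outs out [False]) skip)))) ?s1 4 \<sigma>'"
      using True less.prems by (intro runs_cond) auto
    with l1 have "runs ?body \<sigma> 6 \<sigma>'" by (rule runs_seq) simp
    moreover have "runs (Until i 3 ?body) \<sigma>' 1 \<sigma>'"
      using less.prems by (intro runs_until_stop) (simp_all add: fun_eq_iff)
    ultimately show ?thesis unfolding halve_def
      using seen0 less.prems by (intro runs_until_step[of \<sigma> i 3 ?body 6 \<sigma>' 1]) auto
  next
    case False
    let ?s2 = "?s1(i := (f, v - 2))"
    let ?s3 = "?s2(1 := (marked [], Suc u))"
    define s4 where "s4 = (if v = 2 then ?s3(out := emitted (w @ [False])) else ?s3)"
    have l2: "runs (left i) ?s1 1 ?s2"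
      using less.prems False by (intro runs_left[of _ i f "v - 2"]) (simp_all add: fun_eq_iff)
    have l3: "runs (right 1) ?s2 1 ?s3"
      using less.prems by (intro runs_right[of _ 1 "marked []" u]) (simp_all add: fun_eq_iff)
    have "runs (outs out [False]) ?s3 3 s4" if "v = 2"
      using less.prems that by (intro runs_outs[of _ out w]) (simp_all add: s4_def)
    moreover have "runs skip ?s3 3 s4" if "v \<noteq> 2"
      using that by (simp add: s4_def runs_skip)
    moreover have "seen (?s3 i) = 3 \<longleftrightarrow> v = 2"
      using less.prems False by simp presburger
    ultimately have "runs (Cond i 3 (outs out [False]) skip) ?s3 4 s4"
      by (intro runs_cond[where a = 3]) simp_all
    with l3 have "runs (Then (right 1) (Cond i 3 (outs out [False]) skip)) ?s2 6 s4"
      by (rule runs_seq) simp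
    with l2 have "runs (Then (left i) (Then (right 1) (Cond i 3 (outs out [False]) skip))) ?s1 8 s4"
      by (rule runs_seq) simp
    then have "runs (Cond i 3 (outs out [True])
      (Then (left i) (Then (right 1) (Cond i 3 (outs out [False]) skip)))) ?s1 9 s4"
      using False less.prems(1,2,5,8) by (intro runs_cond[where a = 8]) simp_all
    with l1 have body: "runs ?body \<sigma> 11 s4" by (rule runs_seq) simp
    have "runs (Until i 3 ?body) s4 (8 * v - 8) \<sigma>'"
    proof (cases "v = 2")
      case True
      then have "\<sigma>' = s4" "seen (s4 i) = 3" using less.prems by (simp_all add: s4_def fun_eq_iff)
      then show ?thesis using True by (simp add: runs_until_stop)
    next
      case v: False
      have "v div 2 = Suc ((v - 2) div 2)" "odd (v - 2) = odd v"
        using less.prems(8) False v by presburger+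
      then show ?thesis using less.prems False v unfolding halve_def[symmetric]
        by (intro less.IH[of "v - 2" _ "Suc u"]) (simp_all add: s4_def fun_eq_iff)
    qed
    with body show ?thesis unfolding halve_def
      using seen0 less.prems False by (intro runs_until_step[of \<sigma> i 3 ?body 11 s4 "8 * v - 8"]) auto
  qed
qed

lemma runs_binary:
  assumes "\<sigma> i = (f, v)" "\<And>j. f j = 3 \<longleftrightarrow> j = 0" "\<sigma> 1 = (marked [], 0)" "\<sigma> out = emitted w"
    "i \<noteq> 1" "out \<noteq> 1" "out \<noteq> i" "v \<le> b" "v * (12 * b + 15) + 1 \<le> T"
    "\<sigma>' = \<sigma>(i := (f, 0), out := emitted (w @ concat (map (\<lambda>b. [True, b]) (binary v))))"
  shows "runs (Until i 3 (Then (outs out [True]) (Then (halve out i) (give_back i)))) \<sigma> T \<sigma>'"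
  using assms
proof (induction v arbitrary: \<sigma> w T rule: less_induct)
  case (less v)
  show ?case
  proof (cases "v = 0")
    case True
    then have e: "\<sigma>' = \<sigma>" "seen (\<sigma> i) = 3" "1 \<le> T"
      using less.prems by (simp_all add: binary_0 fun_eq_iff)
    show ?thesis unfolding e(1) by (rule runs_until_stop) (use e in auto)
  next
    case False
    let ?s1 = "\<sigma>(out := emitted (w @ [True]))"
    let ?s2 = "?s1(i := (f, 0), 1 := (marked [], v div 2), out := emitted (w @ [True, odd v]))"
    let ?s3 = "?s2(1 := (marked [], 0), i := (f, v div 2))"
    have 1: "runs (outs out [True]) \<sigma> 3 ?s1"
      using less.prems by (intro runs_outs[of _ out w]) (simp_all add: fun_eq_iff)
    have 2: "runs (halve out i) ?s1 (8 * v + 4) ?s2"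
      using less.prems False by (intro runs_halve[of _ i f v 0 out "w @ [True]"]) (simp_all add: fun_eq_iff)
    have 3: "runs (give_back i) ?s2 (4 * v + 1) ?s3"
      using less.prems False by (intro runs_give_back[of _ "v div 2" i f 0]) (simp_all add: fun_eq_iff)
    from 2 3 have "runs (Then (halve out i) (give_back i)) ?s1 (12 * v + 6) ?s3"
      by (rule runs_seq) simp
    with 1 have r: "runs (Then (outs out [True]) (Then (halve out i) (give_back i))) \<sigma> (12 * v + 10) ?s3"
      by (rule runs_seq) simp
    have "runs (Until i 3 (Then (outs out [True]) (Then (halve out i) (give_back i)))) ?s3
       (v div 2 * (12 * b + 15) + 1) \<sigma>'"
      using less.prems False
      by (intro less.IH[of "v div 2" _ "w @ [True, odd v]"]) (simp_all add: binary_pos[of v] fun_eq_iff)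
    moreover have "(12 * v + 10) + (v div 2 * (12 * b + 15) + 1) + 1 \<le> v * (12 * b + 15) + 1"
    proof -
      \<comment> \<open>For positive \<open>v\<close> the quotient is at most \<open>v - 1\<close>;
        the multiple of \<open>12 * b + 15\<close> saved in this way pays for the present
        round.\<close>
      have "Suc (v div 2) * (12 * b + 15) \<le> v * (12 * b + 15)"
        using False by (intro mult_right_mono) auto
      then show ?thesis using less.prems(8) by (simp add: algebra_simps)
    qed
    ultimately show ?thesis using r False less.prems
      by (intro runs_until_step[OF _ r, where b = "v div 2 * (12 * b + 15) + 1"]) auto
  qed
qed

text \<open>All heads return to their places and the scratch tape is reset, so that only the output
  tape changes. This is what allows a generator to be run again and again as the body of a
  loop.\<close>

theorem runs_compile:
  assumes "wf_gen n g" "out \<noteq> 1" "out \<notin> {2..<n}"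
    "\<And>i. i \<in> {2..<n} \<Longrightarrow> \<sigma> i = (closed_off (D ! i), e i) \<and> e i \<le> length (D ! i) \<and> length (D ! i) \<le> b"
    "\<And>i. i \<in> parked g \<Longrightarrow> e i = 0"
    "\<sigma> 1 = (marked [], 0)" "\<sigma> out = emitted w"
  shows "runs (compile out g) \<sigma> (cost b g) (\<sigma>(out := emitted (w @ den D e g)))"
  using assms
proof (induction g arbitrary: \<sigma> e w)
  case Nop
  then have e: "\<sigma>(out := emitted (w @ den D e Nop)) = \<sigma>" by (simp add: fun_eq_iff)
  show ?case unfolding e compile.simps by (rule runs_skip) simp
next
  case (Out x)
  show ?case unfolding compile.simps den.simps cost.simps by (rule runs_out[of \<sigma> out w, OF Out.prems(7) _ refl]) simp
next
  case (Both g h)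
  let ?s = "\<sigma>(out := emitted (w @ den D e g))"
  have "runs (compile out g) \<sigma> (cost b g) ?s"
    using Both.prems by (intro Both.IH(1)) auto
  moreover have "runs (compile out h) ?s (cost b h) (?s(out := emitted ((w @ den D e g) @ den D e h)))"
    using Both.prems by (intro Both.IH(2)) auto
  ultimately have "runs (Then (compile out g) (compile out h)) \<sigma> (cost b (Both g h))
      (?s(out := emitted ((w @ den D e g) @ den D e h)))"
    by (rule runs_seq) simp
  moreover have "?s(out := emitted ((w @ den D e g) @ den D e h)) = \<sigma>(out := emitted (w @ den D e (Both g h)))"
    by simp
  ultimately show ?case unfolding compile.simps by (simp only:)
next
  case (Ifb i g h)
  have i: "seen (\<sigma> i) = 2 \<longleftrightarrow> 0 < e i \<and> e i \<le> length (D ! i) \<and> D ! i ! (e i - 1)"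
    using Ifb.prems(1) Ifb.prems(4)[of i] by (simp add: closed_off_eq_2)
  have "runs (compile out g) \<sigma> (cost b g) (\<sigma>(out := emitted (w @ den D e g)))"
    using Ifb.prems by (intro Ifb.IH(1)) auto
  then have g: "runs (compile out g) \<sigma> (cost b g + cost b h) (\<sigma>(out := emitted (w @ den D e g)))"
    by (rule runs_mono) simp
  have "runs (compile out h) \<sigma> (cost b h) (\<sigma>(out := emitted (w @ den D e h)))"
    using Ifb.prems by (intro Ifb.IH(2)) auto
  then have h: "runs (compile out h) \<sigma> (cost b g + cost b h) (\<sigma>(out := emitted (w @ den D e h)))"
    by (rule runs_mono) simp
  show ?case unfolding compile.simps den.simps i[symmetric]
    by (rule runs_cond[where a = "cost b g + cost b h"]) (use g h in \<open>auto simp: fun_upd_def\<close>)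
next
  case (For i g)
  let ?B = "length (D ! i)" and ?c = "closed_off (D ! i)"
  let ?S = "\<lambda>k. \<sigma>(i := (?c, Suc k), out := emitted (w @ concat (map (\<lambda>v. den D (e(i := v)) g) [1..<Suc k])))"
  have i: "\<sigma> i = (?c, 0)" "i \<noteq> 1" "i \<noteq> out" "?B \<le> b"
    using For.prems(1,3) For.prems(4)[of i] For.prems(5)[of i] by auto
  have r: "runs (right i) \<sigma> 1 (?S 0)"
    using i For.prems(7) by (intro runs_right[of _ i ?c 0]) auto
  have l: "runs (Until i 4 (Then (compile out g) (right i))) (?S 0) (b * (cost b g + 3) + 1) (?S ?B)"
  proof (rule runs_until[where S = ?S and c = "cost b g + 2"])
    fix k assume k: "k < ?B"
    let ?s = "(?S k)(out := emitted (w @ concat (map (\<lambda>v. den D (e(i := v)) g) [1..<Suc (Suc k)])))"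
    have s: "?s = (?S k)(out := emitted ((w @ concat (map (\<lambda>v. den D (e(i := v)) g) [1..<Suc k])) @ den D (e(i := Suc k)) g))"
    proof -
      have u: "[1..<Suc (Suc k)] = [1..<Suc k] @ [Suc k]" by simp
      show ?thesis unfolding u by (simp only: map_append concat_append list.map concat.simps append_Nil2 append_assoc)
    qed
    have "runs (compile out g) (?S k) (cost b g) ?s"
      unfolding s
    proof (rule For.IH)
      show "\<And>j. j \<in> {2..<n} \<Longrightarrow> ?S k j = (closed_off (D ! j), (e(i := Suc k)) j) \<and>
          (e(i := Suc k)) j \<le> length (D ! j) \<and> length (D ! j) \<le> b"
        using For.prems(3,4) k i by auto
      show "\<And>j. j \<in> parked g \<Longrightarrow> (e(i := Suc k)) j = 0"
        using For.prems(1,5) by auto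
    qed (use For.prems i in auto)
    moreover have "runs (right i) ?s 1 (?S (Suc k))"
      using i(2,3) by (intro runs_right[of _ i ?c "Suc k"]) (simp_all add: fun_eq_iff del: upt_Suc)
    ultimately have "runs (Then (compile out g) (right i)) (?S k) (cost b g + 2) (?S (Suc k))"
      by (rule runs_seq) simp
    with k i show "seen (?S k i) \<noteq> 4 \<and> runs (Then (compile out g) (right i)) (?S k) (cost b g + 2) (?S (Suc k))"
      by (simp add: closed_off_eq_4 del: upt_Suc)
  next
    show "seen (?S ?B i) = 4" using i by (simp add: closed_off_eq_4)
    have "?B * (cost b g + 2 + 1) \<le> b * (cost b g + 3)" using i(4) by (intro mult_mono) auto
    then show "?B * (cost b g + 2 + 1) + 1 \<le> b * (cost b g + 3) + 1" by simp
  qed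
  have e: "runs (Until i 3 (left i)) (?S ?B) (2 * b + 3) (\<sigma>(out := emitted (w @ den D e (For i g))))"
    using i
    by (intro runs_rewind[of _ i ?c "Suc ?B"]) (simp_all add: closed_off_eq_3 fun_eq_iff del: upt_Suc)
  from l e have "runs (Then (Until i 4 (Then (compile out g) (right i))) (Until i 3 (left i))) (?S 0)
      (b * (cost b g + 5) + 5) (\<sigma>(out := emitted (w @ den D e (For i g))))"
    by (rule runs_seq) (simp add: algebra_simps)
  with r show ?case unfolding compile.simps cost.simps
    by (rule runs_seq) (simp add: algebra_simps)
next
  case (Rep i u)
  let ?c = "closed_off (D ! i)"
  let ?S = "\<lambda>k. \<sigma>(i := (?c, e i - k), 1 := (marked [], k), out := emitted (w @ concat (replicate k u)))"
  have i: "\<sigma> i = (?c, e i)" "i \<noteq> 1" "i \<noteq> out" "e i \<le> b"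
    using Rep.prems(1,3) Rep.prems(4)[of i] by auto
  have l: "runs (Until i 3 (Then (left i) (Then (right 1) (outs out u)))) (?S 0)
      (b * (2 * length u + 6) + 1) (?S (e i))"
  proof (rule runs_until[where S = ?S and c = "2 * length u + 5"])
    fix k assume k: "k < e i"
    let ?s1 = "(?S k)(i := (?c, e i - Suc k))" let ?s2 = "?s1(1 := (marked [], Suc k))"
    have 1: "runs (left i) (?S k) 1 ?s1"
      using i k by (intro runs_left[of _ i ?c "e i - Suc k"]) auto
    have 2: "runs (right 1) ?s1 1 ?s2"
      using i Rep.prems(2) by (intro runs_right[of _ 1 "marked []" k]) auto
    have app: "w @ concat (replicate (Suc k) u) = (w @ concat (replicate k u)) @ u"
      by (simp add: replicate_append_same[symmetric])
    have 3: "runs (outs out u) ?s2 (2 * length u + 1) (?S (Suc k))"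
      unfolding app using i Rep.prems(2) by (intro runs_outs[of _ out "w @ concat (replicate k u)"]) (auto simp: fun_upd_twist)
    from 2 3 have "runs (Then (right 1) (outs out u)) ?s1 (2 * length u + 3) (?S (Suc k))"
      by (rule runs_seq) simp
    with 1 have "runs (Then (left i) (Then (right 1) (outs out u))) (?S k) (2 * length u + 5) (?S (Suc k))"
      by (rule runs_seq) simp
    with k i show "seen (?S k i) \<noteq> 3 \<and>
        runs (Then (left i) (Then (right 1) (outs out u))) (?S k) (2 * length u + 5) (?S (Suc k))"
      by (simp add: closed_off_eq_3)
  next
    show "seen (?S (e i) i) = 3" using i by (simp add: closed_off_eq_3)
    have "e i * (2 * length u + 5 + 1) \<le> b * (2 * length u + 6)" using i(4) by (intro mult_mono) auto
    then show "e i * (2 * length u + 5 + 1) + 1 \<le> b * (2 * length u + 6) + 1" by simp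
  qed
  have "?S 0 = \<sigma>" using i Rep.prems(6,7) by auto
  with l have l: "runs (Until i 3 (Then (left i) (Then (right 1) (outs out u)))) \<sigma>
      (b * (2 * length u + 6) + 1) (?S (e i))" by simp
  have "runs (give_back i) (?S (e i)) (4 * b + 1) (\<sigma>(out := emitted (w @ den D e (Rep i u))))"
    using i Rep.prems by (intro runs_give_back[of _ "e i" i ?c 0]) auto
  with l show ?case unfolding compile.simps cost.simps
    by (rule runs_seq) (simp add: algebra_simps)
next
  case (Bin i)
  let ?c = "closed_off (D ! i)" and ?B = "length (D ! i)"
  have i: "\<sigma> i = (?c, 0)" "i \<noteq> 1" "i \<noteq> out" "?B \<le> b"
    using Bin.prems(1,3) Bin.prems(4)[of i] Bin.prems(5)[of i] by auto
  let ?S = "\<lambda>k. \<sigma>(i := (?c, k))"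
  have "runs (Until i 4 (right i)) (?S 0) (2 * b + 3) (?S (Suc ?B))"
  proof (rule runs_until[where S = ?S])
    fix k assume "k < Suc ?B"
    moreover have "runs (right i) (?S k) 1 (?S (Suc k))"
      by (intro runs_right[of _ i ?c k]) auto
    ultimately show "seen (?S k i) \<noteq> 4 \<and> runs (right i) (?S k) 1 (?S (Suc k))"
      by (simp add: closed_off_eq_4)
  qed (use i in \<open>auto simp: closed_off_eq_4\<close>)
  moreover have "?S 0 = \<sigma>" using i(1) by auto
  ultimately have 1: "runs (Until i 4 (right i)) \<sigma> (2 * b + 3) (?S (Suc ?B))" by simp
  have 2: "runs (left i) (?S (Suc ?B)) 1 (?S ?B)"
    by (intro runs_left[of _ i ?c ?B]) auto
  have 3: "runs (Until i 3 (Then (outs out [True]) (Then (halve out i) (give_back i)))) (?S ?B)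
      (b * (12 * b + 15) + 1) (\<sigma>(out := emitted (w @ den D e (Bin i))))"
    using i Bin.prems
    by (intro runs_binary[of _ i ?c ?B out w b]) (auto simp: closed_off_eq_3 fun_upd_twist)
  from 2 3 have "runs (Then (left i) (Until i 3 (Then (outs out [True]) (Then (halve out i) (give_back i)))))
      (?S (Suc ?B)) (b * (12 * b + 15) + 3) (\<sigma>(out := emitted (w @ den D e (Bin i))))"
    by (rule runs_seq) simp
  with 1 show ?case unfolding compile.simps cost.simps
    by (rule runs_seq) (simp add: algebra_simps)
qed

subsection \<open>Emitted strings are computable in polynomial time\<close>

definition poly_bounded :: "(nat \<Rightarrow> nat) \<Rightarrow> bool" where
  "poly_bounded f \<longleftrightarrow> (\<exists>p :: nat poly. \<forall>n. f n \<le> poly p n)"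

lemma poly_bounded_const: "poly_bounded (\<lambda>n. c)"
  unfolding poly_bounded_def by (rule exI[of _ "[:c:]"]) simp

lemma poly_bounded_id: "poly_bounded (\<lambda>n. n)"
  unfolding poly_bounded_def by (rule exI[of _ "[:0, 1:]"]) simp

lemma poly_bounded_add:
  assumes "poly_bounded f" "poly_bounded g"
  shows "poly_bounded (\<lambda>n. f n + g n)"
proof -
  obtain p q :: "nat poly" where "\<And>n. f n \<le> poly p n" "\<And>n. g n \<le> poly q n"
    using assms unfolding poly_bounded_def by blast
  then show ?thesis
    unfolding poly_bounded_def by (intro exI[of _ "p + q"]) (simp add: add_mono)
qed

lemma poly_bounded_mult:
  assumes "poly_bounded f" "poly_bounded g"
  shows "poly_bounded (\<lambda>n. f n * g n)"
proof -
  obtain p q :: "nat poly" where "\<And>n. f n \<le> poly p n" "\<And>n. g n \<le> poly q n"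
    using assms unfolding poly_bounded_def by blast
  then show ?thesis
    unfolding poly_bounded_def by (intro exI[of _ "p * q"]) (simp add: mult_le_mono)
qed

lemmas poly_bounded_intros =
  poly_bounded_const poly_bounded_id poly_bounded_add poly_bounded_mult

lemma poly_bounded_cost: "poly_bounded b \<Longrightarrow> poly_bounded (\<lambda>n. cost (b n) g)"
  by (induction g) (auto simp only: cost.simps intro!: poly_bounded_intros)

lemma length_concat_le: "(\<And>x. x \<in> set xs \<Longrightarrow> length x \<le> c) \<Longrightarrow> length (concat xs) \<le> length xs * c"
proof (induction xs)
  case (Cons x xs)
  then have "length x \<le> c" "length (concat xs) \<le> length xs * c" by auto
  then show ?case by simp
qed simp

lemma length_binary_le: "length (binary n) \<le> n"
proof (induction n rule: less_induct)
  case (less n)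
  show ?case
  proof (cases "n = 0")
    case False
    then have "length (binary n) = Suc (length (binary (n div 2)))"
      by (subst binary_pos[of n]) simp_all
    moreover have d: "n div 2 < n" using False by simp
    moreover have "length (binary (n div 2)) \<le> n div 2" by (rule less[OF d])
    ultimately show ?thesis by linarith
  qed (simp add: binary_0)
qed

text \<open>The cost doubles as a bound on the output. A tape filled by a generator can therefore
  bound later loops, and the growth stays polynomial.\<close>

lemma length_den:
  assumes "wf_gen n g" "\<forall>i\<in>{2..<n}. e i \<le> b \<and> length (D ! i) \<le> b"
  shows "length (den D e g) \<le> cost b g"
  using assms
proof (induction g arbitrary: e)
  case (Both g h)
  then have "length (den D e g) \<le> cost b g" "length (den D e h) \<le> cost b h" by auto
  then show ?case by simp
next
  case (Ifb i g h)
  then have "length (den D e g) \<le> cost b g" "length (den D e h) \<le> cost b h" by auto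
  then show ?case by simp
next
  case (For i g)
  then have i: "length (D ! i) \<le> b" by simp
  have "length (den D (e(i := v)) g) \<le> cost b g" if "v \<in> {1..<Suc (length (D ! i))}" for v
  proof (rule For.IH)
    have "v \<le> b" using that i by simp
    then show "\<forall>j\<in>{2..<n}. (e(i := v)) j \<le> b \<and> length (D ! j) \<le> b"
      using For.prems(2) by simp
  qed (use For.prems(1) in simp)
  then have "length (den D e (For i g)) \<le> length (map (\<lambda>v. den D (e(i := v)) g) [1..<Suc (length (D ! i))]) * cost b g"
    unfolding den.simps by (intro length_concat_le) auto
  also have "\<dots> \<le> b * cost b g" using i by (simp del: upt_Suc)
  finally show ?case by (simp add: algebra_simps)
next
  case (Rep i w)
  then have "e i \<le> b" by simp
  have "length (den D e (Rep i w)) \<le> length (replicate (e i) w) * length w"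
    unfolding den.simps by (intro length_concat_le) auto
  also have "\<dots> \<le> b * length w" using \<open>e i \<le> b\<close> by simp
  finally show ?case by (simp add: algebra_simps)
next
  case (Bin i)
  then have i: "length (D ! i) \<le> b" by simp
  have "length (den D e (Bin i)) \<le> length (map (\<lambda>b. [True, b]) (binary (length (D ! i)))) * 2"
    unfolding den.simps by (intro length_concat_le) auto
  also have "\<dots> \<le> b * 2" using i length_binary_le[of "length (D ! i)"] by simp
  finally show ?case by (simp add: algebra_simps)
qed auto

text \<open>
  Tape 2 holds the input, and every further tape is filled by a generator that uses only
  the tapes before it.
\<close>

definition contents :: "gen list \<Rightarrow> bool list \<Rightarrow> bool list list" where
  "contents gs xs = foldl (\<lambda>D g. D @ [den D (\<lambda>_. 0) g]) [[], [], xs] gs"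

definition wf_gens :: "gen list \<Rightarrow> bool" where
  "wf_gens gs \<longleftrightarrow> (\<forall>k<length gs. wf_gen (3 + k) (gs ! k))"

lemma contents_Nil: "contents [] xs = [[], [], xs]"
  by (simp add: contents_def)

lemma contents_snoc: "contents (gs @ [g]) xs = contents gs xs @ [den (contents gs xs) (\<lambda>_. 0) g]"
  by (simp add: contents_def)

lemma length_contents: "length (contents gs xs) = 3 + length gs"
  by (induction gs rule: rev_induct) (simp_all add: contents_Nil contents_snoc)

lemma wf_gens_snoc: "wf_gens (gs @ [g]) \<longleftrightarrow> wf_gens gs \<and> wf_gen (3 + length gs) g"
  by (auto simp: wf_gens_def nth_append less_Suc_eq)

text \<open>Each new tape replaces the bound \<open>b\<close> by \<open>b + cost b g\<close>. The
  list of generators is fixed, so finitely many such replacements keep it polynomial in the length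
  of the input.\<close>

lemma contents_bounded:
  assumes "wf_gens gs"
  obtains b where "poly_bounded b"
    "\<And>xs i. i < 3 + length gs \<Longrightarrow> length (contents gs xs ! i) \<le> b (length xs)"
proof -
  have "\<exists>b. poly_bounded b \<and> (\<forall>xs. \<forall>i < 3 + length gs. length (contents gs xs ! i) \<le> b (length xs))"
    using assms
  proof (induction gs rule: rev_induct)
    case Nil
    show ?case
      by (rule exI[of _ "\<lambda>n. n"]) (auto simp: contents_Nil poly_bounded_intros less_Suc_eq numeral_3_eq_3)
  next
    case (snoc g gs)
    then obtain b where b: "poly_bounded b"
      "\<And>xs i. i < 3 + length gs \<Longrightarrow> length (contents gs xs ! i) \<le> b (length xs)"
      by (auto simp: wf_gens_snoc)
    have "length (contents (gs @ [g]) xs ! i) \<le> b (length xs) + cost (b (length xs)) g"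
      if "i < 3 + length (gs @ [g])" for xs i
    proof (cases "i < 3 + length gs")
      case True
      then show ?thesis using b(2)[of i xs] by (simp add: contents_snoc nth_append length_contents)
    next
      case False
      then have "i = 3 + length gs" using that by simp
      moreover have "length (den (contents gs xs) (\<lambda>_. 0) g) \<le> cost (b (length xs)) g"
        using snoc.prems b(2) by (intro length_den[of "3 + length gs"]) (auto simp: wf_gens_snoc)
      ultimately show ?thesis by (simp add: contents_snoc nth_append length_contents)
    qed
    then show ?case
      by (intro exI[of _ "\<lambda>n. b n + cost (b n) g"]) (auto intro!: poly_bounded_intros poly_bounded_cost b)
  qed
  then show ?thesis using that by blast
qed

section \<open>Preparing the tapes and writing the output\<close>

abbreviation start :: "nat \<Rightarrow> prog" where
  "start i \<equiv> Step i (Some 3) ToRight"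

definition finish :: "nat \<Rightarrow> prog" where
  "finish i = Then (Step i (Some 4) Stay) (Until i 3 (left i))"

definition copy_input :: prog where
  "copy_input = Then (start 2) (Then
     (Until 0 0 (Then (Cond 0 1 (Step 2 (Some (bit_sym False)) ToRight)
        (Step 2 (Some (bit_sym True)) ToRight)) (right 0)))
     (finish 2))"

definition fill :: "nat \<Rightarrow> gen \<Rightarrow> prog" where
  "fill i g = Then (start i) (Then (compile i g) (finish i))"

fun fills :: "nat \<Rightarrow> gen list \<Rightarrow> prog" where
  "fills i [] = skip"
| "fills i (g # gs) = Then (fill i g) (fills (Suc i) gs)"

text \<open>Tape 0 serves for input and output. After the copy its head stands on the first blank
  behind the input, where the marker 3 is written and the output begins. At the end the head returns
  to that marker and moves to the first symbol of the output; the old input to the left is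
  harmless.\<close>

definition emitter :: "gen list \<Rightarrow> gen \<Rightarrow> prog" where
  "emitter gs g = Then copy_input (Then (Step 1 (Some 3) Stay) (Then (fills 3 gs)
     (Then (start 0) (Then (compile 0 g) (Then (Until 0 3 (left 0)) (right 0))))))"

definition blank :: cells where
  "blank = (\<lambda>_. 0, 0)"

lemma runs_start:
  assumes "\<sigma> i = blank"
  shows "runs (start i) \<sigma> 1 (\<sigma>(i := emitted []))"
proof -
  have "(\<lambda>_. 0)(0 := 3) = marked []" by (auto simp: marked_def)
  with assms show ?thesis by (intro runs_step) (auto simp: blank_def)
qed

lemma runs_finish:
  assumes "\<sigma> i = emitted w"
  shows "runs (finish i) \<sigma> (2 * length w + 6) (\<sigma>(i := (closed_off w, 0)))"
proof -
  have "runs (Step i (Some 4) Stay) \<sigma> 1 (\<sigma>(i := (closed_off w, Suc (length w))))"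
    using assms by (intro runs_step) (auto simp: closed_off_def)
  moreover have "runs (Until i 3 (left i)) (\<sigma>(i := (closed_off w, Suc (length w))))
      (2 * length w + 3) (\<sigma>(i := (closed_off w, 0)))"
    by (intro runs_rewind[of _ i "closed_off w" "Suc (length w)"]) (simp_all add: closed_off_eq_3)
  ultimately show ?thesis unfolding finish_def by (rule runs_seq) simp
qed

lemma runs_shift:
  "\<sigma> i = (f, v + m) \<Longrightarrow> runs p (\<sigma>(i := (\<lambda>j. f (j + m), v))) T \<sigma>' \<Longrightarrow> runs p \<sigma> T \<sigma>'"
  unfolding runs_def using exec.shift by blast

definition input_cells :: "bool list \<Rightarrow> nat \<Rightarrow> nat" where
  "input_cells xs j = (if j < length xs then bit_sym (xs ! j) else 0)"

lemma runs_copy_input: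
  "runs copy_input (init_store xs) (8 * length xs + 12)
     ((init_store xs)(0 := (input_cells xs, length xs), 2 := (closed_off xs, 0)))"
proof -
  let ?S = "\<lambda>k. (init_store xs)(0 := (input_cells xs, k), 2 := emitted (take k xs))"
  let ?c = "Cond 0 1 (Step 2 (Some (bit_sym False)) ToRight) (Step 2 (Some (bit_sym True)) ToRight)"
  have init: "(init_store xs)(0 := (input_cells xs, 0)) = init_store xs"
    by (auto simp: init_store_def input_cells_def fun_eq_iff)
  have "init_store xs 2 = blank" by (auto simp: init_store_def blank_def)
  from runs_start[of "init_store xs" 2, OF this]
  have 1: "runs (start 2) (init_store xs) 1 (?S 0)" unfolding init by simp
  have 2: "runs (Until 0 0 (Then ?c (right 0))) (?S 0) (6 * length xs + 1) (?S (length xs))"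
  proof (rule runs_until[where S = ?S and c = 4])
    fix k assume k: "k < length xs"
    let ?s = "(?S k)(2 := emitted (take k xs @ [xs ! k]))"
    have "runs (Step 2 (Some (bit_sym b)) ToRight) (?S k) 1 ?s" if "xs ! k = b" for b
      using k that by (intro runs_out[of _ 2 "take k xs"]) auto
    moreover have "seen (?S k 0) = 1 \<longleftrightarrow> \<not> xs ! k"
      using k by (auto simp: input_cells_def bit_sym_def)
    ultimately have "runs ?c (?S k) 2 ?s"
      by (intro runs_cond[where a = 1]) auto
    moreover have "?S (Suc k) = ?s(0 := (input_cells xs, Suc k))"
      using k by (simp add: fun_eq_iff take_Suc_conv_app_nth)
    then have "runs (right 0) ?s 1 (?S (Suc k))"
      by (intro runs_right[of _ 0 "input_cells xs" k]) simp_all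
    ultimately have "runs (Then ?c (right 0)) (?S k) 4 (?S (Suc k))" by (rule runs_seq) simp
    moreover have "seen (?S k 0) \<noteq> 0"
      using k by (auto simp: input_cells_def bit_sym_def)
    ultimately show "seen (?S k 0) \<noteq> 0 \<and> runs (Then ?c (right 0)) (?S k) 4 (?S (Suc k))" by simp
  qed (auto simp: input_cells_def)
  have 3: "runs (finish 2) (?S (length xs)) (2 * length xs + 6)
     ((?S (length xs))(2 := (closed_off xs, 0)))"
    using runs_finish[of "?S (length xs)" 2 xs] by simp
  from 2 3 have "runs (Then (Until 0 0 (Then ?c (right 0))) (finish 2)) (?S 0) (8 * length xs + 8)
     ((?S (length xs))(2 := (closed_off xs, 0)))"
    by (rule runs_seq) simp
  with 1 have "runs copy_input (init_store xs) (8 * length xs + 12) ((?S (length xs))(2 := (closed_off xs, 0)))"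
    unfolding copy_input_def by (rule runs_seq) simp
  then show ?thesis by simp
qed

definition layout :: "bool list \<Rightarrow> bool list list \<Rightarrow> store" where
  "layout xs D i =
     (if i = 0 then (input_cells xs, length xs) else if i = 1 then (marked [], 0)
      else if i < length D then (closed_off (D ! i), 0) else blank)"

lemma runs_fill:
  assumes "wf_gen (length D) g" "2 \<le> length D" "\<And>i. i < length D \<Longrightarrow> length (D ! i) \<le> b"
  shows "runs (fill (length D) g) (layout xs D) (3 * cost b g + 9) (layout xs (D @ [den D (\<lambda>_. 0) g]))"
proof -
  let ?n = "length D" and ?w = "den D (\<lambda>_. 0) g"
  let ?s1 = "(layout xs D)(?n := emitted [])" let ?s2 = "?s1(?n := emitted ([] @ ?w))"
  have "D \<noteq> []" using assms(2) by auto
  then have 1: "runs (start ?n) (layout xs D) 1 ?s1"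
    using assms(2) by (intro runs_start) (simp add: layout_def)
  have 2: "runs (compile ?n g) ?s1 (cost b g) ?s2"
    using assms by (intro runs_compile) (auto simp: layout_def)
  have "length ?w \<le> cost b g"
    using assms by (intro length_den[of "length D"]) auto
  then have 3: "runs (finish ?n) ?s2 (2 * cost b g + 6) (?s2(?n := (closed_off ?w, 0)))"
    by (intro runs_mono[OF runs_finish[of _ ?n ?w]]) simp_all
  from 2 3 have "runs (Then (compile ?n g) (finish ?n)) ?s1 (3 * cost b g + 7) (?s2(?n := (closed_off ?w, 0)))"
    by (rule runs_seq) simp
  with 1 have "runs (fill ?n g) (layout xs D) (3 * cost b g + 9) (?s2(?n := (closed_off ?w, 0)))"
    unfolding fill_def by (rule runs_seq) simp
  moreover have "?s2(?n := (closed_off ?w, 0)) = layout xs (D @ [?w])"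
  proof -
    have "D \<noteq> []" using assms(2) by auto
    with assms(2) show ?thesis by (auto simp: layout_def fun_eq_iff nth_append)
  qed
  ultimately show ?thesis by (simp only:)
qed

lemma foldl_extends: "\<exists>E. foldl (\<lambda>D g. D @ [f D g]) D gs = D @ E"
proof (induction gs arbitrary: D)
  case (Cons g gs)
  from Cons[of "D @ [f D g]"] show ?case by auto
qed simp

lemma runs_fills:
  assumes "\<And>k. k < length gs \<Longrightarrow> wf_gen (length D + k) (gs ! k)" "2 \<le> length D"
    "D' = foldl (\<lambda>D g. D @ [den D (\<lambda>_. 0) g]) D gs" "\<And>i. i < length D' \<Longrightarrow> length (D' ! i) \<le> b"
  shows "runs (fills (length D) gs) (layout xs D) ((\<Sum>g\<leftarrow>gs. 3 * cost b g + 10) + 1) (layout xs D')"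
  using assms(1-3)
proof (induction gs arbitrary: D)
  case Nil
  then show ?case by (simp add: runs_skip)
next
  case (Cons g gs)
  let ?D = "D @ [den D (\<lambda>_. 0) g]"
  obtain E where E: "D' = ?D @ E"
    using foldl_extends[of "\<lambda>D. den D (\<lambda>_. 0)" ?D gs] Cons.prems(3) by auto
  have "runs (fill (length D) g) (layout xs D) (3 * cost b g + 9) (layout xs ?D)"
  proof (rule runs_fill)
    show "wf_gen (length D) g" using Cons.prems(1)[of 0] by simp
    show "length (D ! i) \<le> b" if "i < length D" for i
      using assms(4)[of i] that by (simp add: E nth_append)
  qed (rule Cons.prems(2))
  moreover have "runs (fills (length ?D) gs) (layout xs ?D) ((\<Sum>g\<leftarrow>gs. 3 * cost b g + 10) + 1) (layout xs D')"
  proof (rule Cons.IH)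
    show "wf_gen (length ?D + k) (gs ! k)" if "k < length gs" for k
      using Cons.prems(1)[of "Suc k"] that by simp
  qed (use Cons.prems in simp_all)
  then have "runs (fills (Suc (length D)) gs) (layout xs ?D) ((\<Sum>g\<leftarrow>gs. 3 * cost b g + 10) + 1) (layout xs D')"
    by simp
  ultimately show ?case unfolding fills.simps by (rule runs_seq[where \<sigma>' = "layout xs ?D"]) simp_all
qed

theorem polytime_computable_den:
  assumes "wf_gens gs" "wf_gen (3 + length gs) g"
  shows "polytime_computable (\<lambda>xs. den (contents gs xs) (\<lambda>_. 0) g)"
proof -
  obtain b where b: "poly_bounded b"
    "\<And>xs i. i < 3 + length gs \<Longrightarrow> length (contents gs xs ! i) \<le> b (length xs)"
    using contents_bounded[OF assms(1)] by blast
  define T where "T n = 8 * n + 12 + ((\<Sum>g\<leftarrow>gs. 3 * cost (b n) g + 10) + 1) + 3 * cost (b n) g + 20" for n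
  have "poly_bounded (\<lambda>n. (\<Sum>g\<leftarrow>gs. 3 * cost (b n) g + 10))" for gs
    by (induction gs) (auto intro!: poly_bounded_intros poly_bounded_cost b)
  then have "poly_bounded T"
    unfolding T_def by (intro poly_bounded_intros poly_bounded_cost b)
  then obtain p where p: "\<And>n. T n \<le> poly p n" unfolding poly_bounded_def by blast
  show ?thesis
  proof (rule polytime_computable_exec[where n = "3 + length gs" and p = "emitter gs g" and b = p])
    have "wf_prog (3 + length gs) (fills i hs)"
      if "\<And>k. k < length hs \<Longrightarrow> wf_gen (i + k) (hs ! k)" "i + length hs \<le> 3 + length gs" "3 \<le> i" for i hs
      using that
    proof (induction hs arbitrary: i)
      case (Cons h hs)
      have "wf_gen i h" using Cons.prems(1)[of 0] by simp
      moreover have "wf_prog (3 + length gs) (fills (Suc i) hs)"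
        using Cons.prems(1)[of "Suc k" for k] Cons.prems by (intro Cons.IH) auto
      ultimately show ?case using Cons.prems
        by (auto simp: fill_def finish_def intro: wf_prog_compile)
    qed simp
    then have "wf_prog (3 + length gs) (fills 3 gs)" using assms(1) by (simp add: wf_gens_def)
    moreover have "wf_prog (3 + length gs) (compile 0 g)"
      using assms(2) by (intro wf_prog_compile) auto
    ultimately show "wf_prog (3 + length gs) (emitter gs g)"
      by (simp add: emitter_def copy_input_def finish_def bit_sym_def)
    show "1 \<le> 3 + length gs" by simp
    fix xs
    let ?n = "length xs" and ?D = "contents gs xs"
    let ?w = "den ?D (\<lambda>_. 0) g" and ?b = "b (length xs)"
    let ?s = "(init_store xs)(0 := (input_cells xs, ?n), 2 := (closed_off xs, 0))"
    let ?lay = "layout xs [[], [], xs]"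
    let ?l = "(layout xs ?D)(0 := blank)"
    let ?l1 = "?l(0 := emitted [])" let ?l2 = "?l1(0 := emitted ([] @ ?w))"
    have "?lay = ?s(1 := (marked [], 0))"
      by (auto simp: layout_def fun_eq_iff init_store_def blank_def nth_Cons split: nat.splits)
    moreover have "?s 1 = blank" by (auto simp: init_store_def blank_def)
    moreover have "(\<lambda>_. 0)(0 := 3) = marked []" by (auto simp: marked_def)
    ultimately have "?lay = ?s(1 := put (Some 3) Stay (?s 1))"
      by (simp only: blank_def put_Some shifted.simps)
    then have 1: "runs (Step 1 (Some 3) Stay) ?s 1 ?lay"
      by (intro runs_step) (simp_all only: order.refl dir.distinct)
    have 2: "runs (fills 3 gs) ?lay ((\<Sum>g\<leftarrow>gs. 3 * cost ?b g + 10) + 1) (layout xs ?D)"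
    proof -
      have l: "length [[], [], xs] = 3" by simp
      have "runs (fills (length [[], [], xs]) gs) ?lay ((\<Sum>g\<leftarrow>gs. 3 * cost ?b g + 10) + 1) (layout xs ?D)"
      proof (rule runs_fills)
        show "\<And>k. k < length gs \<Longrightarrow> wf_gen (length [[], [], xs] + k) (gs ! k)"
          using assms(1) unfolding l wf_gens_def by blast
        show "\<And>i. i < length ?D \<Longrightarrow> length (?D ! i) \<le> ?b"
          by (rule b(2)) (simp only: length_contents)
      qed (simp_all add: contents_def)
      then show ?thesis unfolding l .
    qed
    \<comment> \<open>With the input cells forgotten, tape 0 looks like a fresh blank tape whose
      origin is the first cell behind the input.\<close>
    have shift: "(layout xs ?D)(0 := (\<lambda>j. input_cells xs (j + ?n), 0)) = ?l"
      by (auto simp: input_cells_def blank_def)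
    have 3: "runs (start 0) (layout xs ?D) 1 ?l1"
      by (rule runs_shift[where i = 0 and f = "input_cells xs" and v = 0 and m = ?n])
        (simp add: layout_def, unfold shift, rule runs_start, simp)
    have 4: "runs (compile 0 g) ?l1 (cost ?b g) ?l2"
      using assms(2) b(2)[of _ xs]
      by (intro runs_compile[where n = "3 + length gs"]) (auto simp: layout_def length_contents)
    have "length ?w \<le> cost ?b g"
      using assms(2) b(2)[of _ xs] by (intro length_den[of "3 + length gs"]) auto
    then have 5: "runs (Until 0 3 (left 0)) ?l2 (2 * cost ?b g + 3) (?l2(0 := (marked ?w, 0)))"
      by (intro runs_rewind[of _ 0 "marked ?w" "Suc (length ?w)"]) (simp_all add: marked_eq_3)
    have 6: "runs (right 0) (?l2(0 := (marked ?w, 0))) 1 (?l2(0 := (marked ?w, 1)))"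
      by (intro runs_right[of _ 0 "marked ?w" 0]) simp_all
    note runs_seq[OF 5 6 order.refl]
    note runs_seq[OF 4 this order.refl]
    note runs_seq[OF 3 this order.refl]
    note runs_seq[OF 2 this order.refl]
    note runs_seq[OF 1 this order.refl]
    note runs_seq[OF runs_copy_input this order.refl]
    then have "runs (emitter gs g) (init_store xs) (poly p ?n) (?l2(0 := (marked ?w, 1)))"
      unfolding emitter_def by (rule runs_mono) (use p[of ?n] in \<open>simp add: T_def\<close>)
    moreover have "store_shows (marked ?w, 1) ?w"
      by (simp add: store_shows_def marked_def)
    ultimately show "\<exists>t \<sigma>. t \<le> poly p (length xs) \<and> exec (emitter gs g) (init_store xs) t \<sigma> \<and>
        store_shows (\<sigma> 0) (den (contents gs xs) (\<lambda>_. 0) g)"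
      unfolding runs_def by fastforce
  qed
qed

section \<open>Hitting sets as placements\<close>

definition hitting_instance ::
  "nat \<Rightarrow> nat \<Rightarrow> nat list \<Rightarrow> nat list \<Rightarrow> (nat \<Rightarrow> nat list) \<Rightarrow> nat \<Rightarrow> nat \<Rightarrow> placement_instance" where
  "hitting_instance s d E U els cap k = \<lparr>
     inst_verts = s # d # E @ U,
     inst_edges = map (\<lambda>e. (e, d, cap)) E @ concat (map (\<lambda>u. (s, u, 1) # map (\<lambda>e. (u, e, 1)) (els u)) U),
     inst_source = s, inst_dest = d, inst_bound = int k \<rparr>"

text \<open>
  Every element of \<open>U\<close> stands for a set \<open>els u\<close>. It receives one unit of flow, which can be sent
  on through any of the elements of that set.
\<close>

locale hitting =
  fixes s d :: nat and E U :: "nat list" and els :: "nat \<Rightarrow> nat list" and cap k :: nat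
  assumes distinct_verts: "distinct (s # d # E @ U)"
    and els: "u \<in> set U \<Longrightarrow> els u \<noteq> [] \<and> distinct (els u) \<and> set (els u) \<subseteq> set E"
    and cap: "length U \<le> cap"
begin

abbreviation "I \<equiv> hitting_instance s d E U els cap k"
abbreviation "G \<equiv> inst_graph I"

lemma els_in: "u \<in> set U \<Longrightarrow> e \<in> set (els u) \<Longrightarrow> e \<in> set E"
  and els_ne: "u \<in> set U \<Longrightarrow> els u \<noteq> []"
  using els by auto

lemma neqs:
  "s \<noteq> d" "s \<notin> set E" "s \<notin> set U" "d \<notin> set E" "d \<notin> set U" "set E \<inter> set U = {}" "distinct E" "distinct U"
  using distinct_verts by auto

lemma els_notin: "u \<in> set U \<Longrightarrow> e \<in> set (els u) \<Longrightarrow> e \<notin> set U \<and> e \<noteq> s \<and> e \<noteq> d"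
  using els_in[of u e] neqs by blast

lemma verts_G: "verts G = {s, d} \<union> set E \<union> set U"
  by (auto simp: inst_graph_def hitting_instance_def)

lemma arcs_G:
  "arcs G = (\<lambda>e. (e, d)) ` set E \<union> (\<lambda>u. (s, u)) ` set U \<union> {(u, e) | u e. u \<in> set U \<and> e \<in> set (els u)}"
proof -
  have "arcs G = (\<lambda>(u, v, c). (u, v)) ` ((\<lambda>e. (e, d, cap)) ` set E \<union>
      (\<Union>u\<in>set U. insert (s, u, 1) ((\<lambda>e. (u, e, 1)) ` set (els u))))"
    by (simp add: inst_graph_def hitting_instance_def)
  also have "\<dots> = (\<lambda>e. (e, d)) ` set E \<union> (\<Union>u\<in>set U. insert (s, u) ((\<lambda>e. (u, e)) ` set (els u)))"
    by (simp only: image_Un image_UN image_insert image_image case_prod_conv)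
  also have "\<dots> = (\<lambda>e. (e, d)) ` set E \<union> (\<lambda>u. (s, u)) ` set U \<union>
      {(u, e) | u e. u \<in> set U \<and> e \<in> set (els u)}"
    by blast
  finally show ?thesis .
qed

lemma tail_head_G: "tail G = fst" "head G = snd"
  by (simp_all add: inst_graph_def)

lemma in_arc_cases:
  assumes "a \<in> arcs G"
  obtains e where "e \<in> set E" "a = (e, d)" | u where "u \<in> set U" "a = (s, u)"
    | u e where "u \<in> set U" "e \<in> set (els u)" "e \<in> set E" "a = (u, e)"
  using assms els_in unfolding arcs_G by blast

lemma distinct_edges: "distinct (map (\<lambda>(u, v, c). (u, v)) (inst_edges I))"
proof -
  let ?f = "\<lambda>u. (s, u) # map (\<lambda>e. (u, e)) (els u)"
  have eq: "map (\<lambda>(u, v, c). (u, v)) (inst_edges I) = map (\<lambda>e. (e, d)) E @ concat (map ?f U)"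
    by (simp add: hitting_instance_def map_concat comp_def)
  have "distinct (concat (map ?f V))" if "set V \<subseteq> set U" "distinct V" for V
    using that
  proof (induction V)
    case (Cons u V)
    then have u: "u \<in> set U" "u \<notin> set V" "set V \<subseteq> set U" by auto
    have "distinct (?f u)"
      using els[OF u(1)] neqs u by (auto simp: distinct_map inj_on_def)
    moreover have "set (?f u) \<inter> set (concat (map ?f V)) = {}"
      using u neqs by auto
    ultimately show ?case using Cons by simp
  qed simp
  then have "distinct (concat (map ?f U))" using neqs by blast
  moreover have "set (map (\<lambda>e. (e, d)) E) \<inter> set (concat (map ?f U)) = {}"
    using neqs by auto
  moreover have "distinct (map (\<lambda>e. (e, d)) E)"
    using neqs by (auto simp: distinct_map inj_on_def)
  ultimately show ?thesis unfolding eq by simp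
qed

lemma cap_G:
  "e \<in> set E \<Longrightarrow> inst_cap I (e, d) = cap"
  "u \<in> set U \<Longrightarrow> inst_cap I (s, u) = 1"
  "u \<in> set U \<Longrightarrow> e \<in> set (els u) \<Longrightarrow> inst_cap I (u, e) = 1"
proof -
  have c: "inst_cap I (u, v) = c" if "(u, v, c) \<in> set (inst_edges I)" for u v c
  proof -
    let ?l = "map (\<lambda>(u, v, c). ((u, v), c)) (inst_edges I)"
    have "distinct (map fst ?l)"
      using distinct_edges by (simp add: comp_def case_prod_unfold)
    moreover have "((u, v), c) \<in> set ?l" using that by force
    ultimately show ?thesis unfolding inst_cap_def by simp
  qed
  show "e \<in> set E \<Longrightarrow> inst_cap I (e, d) = cap"
    by (rule c) (simp add: hitting_instance_def)
  show "u \<in> set U \<Longrightarrow> inst_cap I (s, u) = 1"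
    by (rule c) (auto simp: hitting_instance_def)
  show "u \<in> set U \<Longrightarrow> e \<in> set (els u) \<Longrightarrow> inst_cap I (u, e) = 1"
    by (rule c) (auto simp: hitting_instance_def)
qed

lemma fin_digraph_G: "fin_digraph G"
proof
  fix a assume "a \<in> arcs G"
  then show "tail G a \<in> verts G" "head G a \<in> verts G"
    by (auto elim!: in_arc_cases simp: verts_G tail_head_G)
qed (auto simp: inst_graph_def)

lemma valid_I: "valid_instance I"
  using distinct_verts distinct_edges fin_digraph_G neqs
  by (auto simp: valid_instance_def) (simp_all add: hitting_instance_def)

subsection \<open>The maximum flow\<close>

lemma in_arcs_G:
  "in_arcs G s = {}"
  "u \<in> set U \<Longrightarrow> in_arcs G u = {(s, u)}"
  "e \<in> set E \<Longrightarrow> in_arcs G e = (\<lambda>u. (u, e)) ` {u \<in> set U. e \<in> set (els u)}"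
  using neqs by (auto simp: in_arcs_def tail_head_G arcs_G dest: els_in els_notin)

lemma out_arcs_G:
  "out_arcs G s = (\<lambda>u. (s, u)) ` set U"
  "out_arcs G d = {}"
  "u \<in> set U \<Longrightarrow> out_arcs G u = (\<lambda>e. (u, e)) ` set (els u)"
  "e \<in> set E \<Longrightarrow> out_arcs G e = {(e, d)}"
  using neqs by (auto simp: out_arcs_def tail_head_G arcs_G dest: els_in els_notin)

text \<open>Every set sends its unit through the first of its elements; the arcs into
  \<open>d\<close> can carry this even if all sets agree on the element. The arcs leaving
  \<open>s\<close> form a cut of capacity \<open>length U\<close>, so no flow has a larger
  value.\<close>

lemma max_flow_G: "max_flow G (inst_cap I) s d = real (length U)"
proof -
  define f :: "nat \<times> nat \<Rightarrow> real" where
    "f = (\<lambda>(u, v). if u = s then 1 else if v = d then real (card {w \<in> set U. hd (els w) = u})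
       else of_bool (v = hd (els u)))"
  have card_U: "card (set U) = length U" using neqs by (simp add: distinct_card)
  have bound: "card {w \<in> set U. hd (els w) = e} \<le> cap" for e
    using card_mono[of "set U" "{w \<in> set U. hd (els w) = e}"] card_U cap by auto
  have "is_flow G (inst_cap I) s d f"
    unfolding is_flow_def
  proof (intro conjI ballI)
    fix a assume a: "a \<in> arcs G"
    then show "0 \<le> f a" by (auto simp: f_def split: prod.split)
    from a show "f a \<le> real (inst_cap I a)"
      using bound neqs by (cases rule: in_arc_cases) (auto simp: f_def cap_G)
  next
    fix v assume "v \<in> verts G - {s, d}"
    then consider "v \<in> set E" | "v \<in> set U" by (auto simp: verts_G)
    then show "sum f (in_arcs G v) = sum f (out_arcs G v)"
    proof cases
      case 1
      have "sum f (in_arcs G v) = (\<Sum>u\<in>{u \<in> set U. v \<in> set (els u)}. f (u, v))"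
        unfolding in_arcs_G(3)[OF 1] by (subst sum.reindex) (auto simp: inj_on_def)
      also have "\<dots> = (\<Sum>u\<in>{u \<in> set U. v \<in> set (els u)}. of_bool (v = hd (els u)))"
        using 1 neqs by (intro sum.cong) (auto simp: f_def)
      also have "\<dots> = real (card {u \<in> set U. hd (els u) = v})"
      proof -
        have "{u \<in> set U. v \<in> set (els u)} \<inter> {u. v = hd (els u)} = {u \<in> set U. hd (els u) = v}"
          using els_ne by auto
        then show ?thesis by (simp add: sum_of_bool_eq)
      qed
      also have "\<dots> = sum f (out_arcs G v)"
        using 1 neqs by (auto simp: out_arcs_G f_def)
      finally show ?thesis .
    next
      case 2
      have "sum f (out_arcs G v) = (\<Sum>e\<in>set (els v). f (v, e))"
        unfolding out_arcs_G(3)[OF 2] by (subst sum.reindex) (auto simp: inj_on_def)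
      also have "\<dots> = (\<Sum>e\<in>set (els v). if e = hd (els v) then 1 else 0)"
        using 2 neqs els[OF 2] by (intro sum.cong) (auto simp: f_def)
      also have "\<dots> = 1"
        using els[OF 2] by simp
      also have "1 = sum f (in_arcs G v)"
        using 2 neqs by (auto simp: in_arcs_G f_def)
      finally show ?thesis by simp
    qed
  qed
  moreover have "flow_value G s f = real (length U)"
  proof -
    have "sum f (out_arcs G s) = (\<Sum>u\<in>set U. f (s, u))"
      unfolding out_arcs_G(1) by (subst sum.reindex) (auto simp: inj_on_def)
    also have "\<dots> = real (length U)" using card_U by (simp add: f_def)
    finally show ?thesis by (simp add: flow_value_def in_arcs_G)
  qed
  moreover have "flow_value G s g \<le> real (length U)" if g: "is_flow G (inst_cap I) s d g" for g
  proof -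
    have "sum g (out_arcs G s) = (\<Sum>u\<in>set U. g (s, u))"
      unfolding out_arcs_G(1) by (subst sum.reindex) (auto simp: inj_on_def)
    also have "\<dots> \<le> (\<Sum>u\<in>set U. 1)"
    proof (rule sum_mono)
      fix u assume u: "u \<in> set U"
      then have "(s, u) \<in> arcs G" by (auto simp: arcs_G)
      with g have "g (s, u) \<le> real (inst_cap I (s, u))" unfolding is_flow_def by blast
      then show "g (s, u) \<le> 1" using cap_G(2)[OF u] by simp
    qed
    also have "\<dots> = real (length U)" using card_U by simp
    finally show ?thesis by (simp add: flow_value_def in_arcs_G)
  qed
  ultimately show ?thesis
    unfolding max_flow_def by (intro cSup_eq_maximum CollectI exI[of _ f]) auto
qed

subsection \<open>Admissible paths\<close>

definition route :: "nat \<Rightarrow> nat \<Rightarrow> (nat \<times> nat) list" where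
  "route u e = [(s, u), (u, e), (e, d)]"

lemma route_inject: "route u e = route u' e' \<longleftrightarrow> u = u' \<and> e = e'"
  by (auto simp: route_def)

text \<open>The out-arcs are known layer by layer, so the arcs of a walk can be peeled off one at a
  time; after the third the walk is at \<open>d\<close>, which no arc leaves.\<close>

lemma awalk_G:
  "pre_digraph.awalk G s p d \<longleftrightarrow> (\<exists>u e. u \<in> set U \<and> e \<in> set (els u) \<and> p = route u e)"
proof
  assume p: "pre_digraph.awalk G s p d"
  have arcs: "set p \<subseteq> arcs G" and cas: "pre_digraph.cas G s p d"
    using p by (auto simp: pre_digraph.awalk_def)
  obtain a p1 where p1: "p = a # p1" using cas neqs by (cases p) (auto simp: pre_digraph.cas.simps)
  then have "a \<in> arcs G" "fst a = s" using arcs cas by (auto simp: pre_digraph.cas.simps tail_head_G)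
  then have "a \<in> out_arcs G s" by (simp add: tail_head_G)
  then obtain u where u: "u \<in> set U" "a = (s, u)"
    unfolding out_arcs_G by blast
  have cas1: "pre_digraph.cas G u p1 d" using cas p1 u by (simp add: pre_digraph.cas.simps tail_head_G)
  obtain b p2 where p2: "p1 = b # p2" using cas1 neqs u by (cases p1) (auto simp: pre_digraph.cas.simps)
  then have "b \<in> arcs G" "fst b = u" using arcs cas1 p1 by (auto simp: pre_digraph.cas.simps tail_head_G)
  then have "b \<in> out_arcs G u" by (simp add: tail_head_G)
  then obtain e where e: "e \<in> set (els u)" "e \<in> set E" "b = (u, e)"
    unfolding out_arcs_G(3)[OF u(1)] using els_in[OF u(1)] by blast
  have cas2: "pre_digraph.cas G e p2 d" using cas1 p2 e by (simp add: pre_digraph.cas.simps tail_head_G)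
  obtain c p3 where p3: "p2 = c # p3" using cas2 neqs e by (cases p2) (auto simp: pre_digraph.cas.simps)
  then have "c \<in> arcs G" "fst c = e" using arcs cas2 p1 p2 by (auto simp: pre_digraph.cas.simps tail_head_G)
  then have "c \<in> out_arcs G e" by (simp add: tail_head_G)
  then have c: "c = (e, d)"
    unfolding out_arcs_G(4)[OF e(2)] by blast
  have cas3: "pre_digraph.cas G d p3 d" using cas2 p3 c by (simp add: pre_digraph.cas.simps tail_head_G)
  have "p3 = []"
  proof (cases p3)
    case (Cons x xs)
    then have "x \<in> arcs G" "fst x = d" using arcs cas3 p1 p2 p3 by (auto simp: pre_digraph.cas.simps tail_head_G)
    then have "x \<in> out_arcs G d" by (simp add: tail_head_G)
    then show ?thesis unfolding out_arcs_G by blast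
  qed
  with u e c p1 p2 p3 show "\<exists>u e. u \<in> set U \<and> e \<in> set (els u) \<and> p = route u e"
    by (auto simp: route_def)
next
  assume "\<exists>u e. u \<in> set U \<and> e \<in> set (els u) \<and> p = route u e"
  then obtain u e where "u \<in> set U" "e \<in> set (els u)" "p = route u e" by blast
  then show "pre_digraph.awalk G s p d"
    using els[of u] by (auto simp: pre_digraph.awalk_def pre_digraph.cas.simps tail_head_G route_def verts_G arcs_G)
qed

lemma admissible_G:
  assumes "K \<subseteq> verts G - {s, d}"
  shows "admissible_paths G s d K =
    (\<lambda>(u, e). route u e) ` {(u, e). u \<in> set U \<and> e \<in> set (els u) \<and> (u \<in> K \<or> e \<in> K)}"
proof -
  have "set (pre_digraph.awalk_verts G s (route u e)) = {s, u, e, d}" for u e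
    by (auto simp: route_def pre_digraph.awalk_verts.simps tail_head_G)
  with assms show ?thesis
    unfolding admissible_paths_def awalk_G by auto
qed

lemma finite_pairs: "finite {(u, e). u \<in> set U \<and> e \<in> set (els u) \<and> Q u e}"
  by (rule finite_subset[of _ "Sigma (set U) (\<lambda>u. set (els u))"]) auto

text \<open>If \<open>u\<close> and its elements avoid \<open>K\<close>, no admissible route passes
  \<open>u\<close>. The other sets receive at most one unit each through their arcs from
  \<open>s\<close>, so the total falls short of the maximum by at least one.\<close>

lemma feasible_imp_hit:
  assumes "feasible_placement G (inst_cap I) s d K" "u \<in> set U"
  shows "u \<in> K \<or> set (els u) \<inter> K \<noteq> {}"
proof (rule ccontr)
  assume u: "\<not> ?thesis"
  let ?A = "admissible_paths G s d K"
  let ?P = "{(u, e). u \<in> set U \<and> e \<in> set (els u) \<and> (u \<in> K \<or> e \<in> K)}"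
  have K: "K \<subseteq> verts G - {s, d}" using assms(1) by (simp add: feasible_placement_def)
  obtain x where x: "\<forall>p\<in>?A. 0 \<le> x p" "(x has_sum real (length U)) ?A"
    "\<forall>e\<in>arcs G. (\<Sum>\<^sub>\<infinity>p\<in>?A. real (count_list p e) * x p) \<le> real (inst_cap I e)"
    using assms(1) unfolding feasible_placement_def max_flow_G by blast
  have fin: "finite ?A" unfolding admissible_G[OF K] using finite_pairs by (intro finite_imageI)
  have inj: "inj_on (\<lambda>(u, e). route u e) ?P" by (auto simp: inj_on_def route_inject)
  have "real (length U) = sum x ?A"
    using x(2) fin has_sum_finite has_sum_unique by blast
  also have "\<dots> = (\<Sum>(v, e)\<in>?P. x (route v e))"
    unfolding admissible_G[OF K] by (subst sum.reindex[OF inj]) (simp add: case_prod_unfold comp_def)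
  \<comment> \<open>The flow is grouped by the set that a route passes.\<close>
  also have "\<dots> = (\<Sum>v\<in>set U. \<Sum>q\<in>{q \<in> ?P. fst q = v}. x (route (fst q) (snd q)))"
    using finite_pairs by (subst sum.group) (auto simp: case_prod_unfold)
  also have "\<dots> \<le> (\<Sum>v\<in>set U. if v = u then 0 else 1)"
  proof (rule sum_mono)
    fix v assume v: "v \<in> set U"
    let ?L = "\<Sum>q\<in>{q \<in> ?P. fst q = v}. x (route (fst q) (snd q))"
    have count: "count_list (route w e) (s, v) = of_bool (w = v)" if "w \<in> set U" "e \<in> set (els w)" for w e
      using that neqs v els[of w] by (auto simp: route_def)
    show "?L \<le> (if v = u then 0 else 1)"
    proof (cases "v = u")
      case True
      then have e: "{q \<in> ?P. fst q = v} = {}" using u by auto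
      show ?thesis unfolding e using True by simp
    next
      case False
      have "?L = (\<Sum>q\<in>?P. if fst q = v then x (route (fst q) (snd q)) else 0)"
        by (rule sum.inter_filter[OF finite_pairs])
      \<comment> \<open>The multiplicity of the arc \<open>(s, v)\<close> in a route is 1 if the
        route passes \<open>v\<close> and 0 otherwise; the sum thus becomes the load of this
        arc.\<close>
      also have "\<dots> = (\<Sum>(w, e)\<in>?P. real (count_list (route w e) (s, v)) * x (route w e))"
        by (intro sum.cong) (auto simp: count)
      also have "\<dots> = (\<Sum>p\<in>?A. real (count_list p (s, v)) * x p)"
        unfolding admissible_G[OF K] by (subst sum.reindex[OF inj]) (simp add: case_prod_unfold comp_def)
      also have "\<dots> \<le> real (inst_cap I (s, v))"
        using x(3) fin v by (auto simp: arcs_G)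
      finally show ?thesis using False cap_G(2)[OF v] by simp
    qed
  qed
  also have "\<dots> = real (card (set U - {u}))"
    by (subst sum.If_cases) (auto simp: Int_def set_diff_eq)
  also have "\<dots> = real (length U) - 1"
    using assms(2) neqs by (simp add: distinct_card card_Diff_singleton) (metis of_nat_diff length_pos_if_in_set Suc_leI of_nat_1 One_nat_def)
  finally show False by simp
qed

text \<open>Each set chooses an element \<open>h u\<close> in \<open>H\<close> and sends its whole
  unit along the route through it. Arcs at the sets carry at most one unit, and an arc into
  \<open>d\<close> at most one unit for each set, which \<open>cap\<close> permits.\<close>

lemma hit_imp_feasible:
  assumes "H \<subseteq> set E" "\<And>u. u \<in> set U \<Longrightarrow> set (els u) \<inter> H \<noteq> {}"
  shows "feasible_placement G (inst_cap I) s d H"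
proof -
  let ?A = "admissible_paths G s d H"
  let ?P = "{(u, e). u \<in> set U \<and> e \<in> set (els u) \<and> (u \<in> H \<or> e \<in> H)}"
  have H: "H \<subseteq> verts G - {s, d}" using assms(1) neqs by (auto simp: verts_G)
  define h where "h u = (SOME e. e \<in> set (els u) \<inter> H)" for u
  have h: "h u \<in> set (els u) \<and> h u \<in> H" if "u \<in> set U" for u
    using assms(2)[OF that] someI_ex[of "\<lambda>e. e \<in> set (els u) \<inter> H"] by (auto simp: h_def)
  have hE: "h u \<in> set E" "h u \<notin> set U" "h u \<noteq> s" "h u \<noteq> d" "u \<noteq> s" "u \<noteq> d" if "u \<in> set U" for u
    using h[OF that] els_in[OF that] els_notin[OF that] that neqs by blast+
  define x :: "(nat \<times> nat) list \<Rightarrow> real" where "x p = of_bool (p \<in> (\<lambda>u. route u (h u)) ` set U)" for p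
  have fin: "finite ?A" unfolding admissible_G[OF H] using finite_pairs by (intro finite_imageI)
  have sub: "(\<lambda>u. route u (h u)) ` set U \<subseteq> ?A"
    unfolding admissible_G[OF H] using h by auto
  have inj: "inj_on (\<lambda>u. route u (h u)) (set U)" by (auto simp: inj_on_def route_inject)
  have sums: "(\<Sum>p\<in>?A. g p * x p) = (\<Sum>u\<in>set U. g (route u (h u)))" for g
  proof -
    have "(\<Sum>p\<in>?A. g p * x p) = (\<Sum>p\<in>(\<lambda>u. route u (h u)) ` set U. g p * x p)"
      using sub fin by (intro sum.mono_neutral_right) (auto simp: x_def)
    also have "\<dots> = (\<Sum>u\<in>set U. g (route u (h u)) * x (route u (h u)))"
      by (subst sum.reindex[OF inj]) (simp add: comp_def)
    also have "\<dots> = (\<Sum>u\<in>set U. g (route u (h u)))"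
      by (intro sum.cong) (auto simp: x_def)
    finally show ?thesis .
  qed
  have card_U: "card (set U) = length U" using neqs by (simp add: distinct_card)
  show ?thesis
    unfolding feasible_placement_def max_flow_G
  proof (intro conjI exI[of _ x] ballI)
    show "H \<subseteq> verts G - {s, d}" by fact
    show "0 \<le> x p" for p by (simp add: x_def)
    have "sum x ?A = real (length U)" using sums[of "\<lambda>_. 1"] card_U by simp
    then show "(x has_sum real (length U)) ?A" using has_sum_finite[OF fin, of x] by simp
    fix a assume a: "a \<in> arcs G"
    show "(\<lambda>p. real (count_list p a) * x p) summable_on ?A" using fin by (rule summable_on_finite)
    have "(\<Sum>\<^sub>\<infinity>p\<in>?A. real (count_list p a) * x p) = real (\<Sum>u\<in>set U. count_list (route u (h u)) a)"
      using fin sums[of "\<lambda>p. real (count_list p a)"] by simp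
    also have "(\<Sum>u\<in>set U. count_list (route u (h u)) a) \<le> inst_cap I a"
      using a
    proof (cases rule: in_arc_cases)
      case (1 e)
      have "(\<Sum>u\<in>set U. count_list (route u (h u)) a) \<le> (\<Sum>u\<in>set U. 1)"
        using 1 neqs(2,4) hE by (intro sum_mono) (simp add: route_def)
      then show ?thesis using card_U cap cap_G(1)[OF 1(1)] 1(2) by simp
    next
      case (2 w)
      have "(\<Sum>u\<in>set U. count_list (route u (h u)) a) = (\<Sum>u\<in>set U. if u = w then 1 else 0)"
        using 2 hE by (intro sum.cong refl) (simp add: route_def)
      then show ?thesis using 2 cap_G(2)[OF 2(1)] by simp
    next
      case (3 w e)
      have "(\<Sum>u\<in>set U. count_list (route u (h u)) a) \<le> (\<Sum>u\<in>set U. if u = w then 1 else 0)"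
        using 3 hE els_notin[OF 3(1,2)] by (intro sum_mono) (simp add: route_def, metis)
      then show ?thesis using 3 cap_G(3)[OF 3(1,2)] by simp
    qed
    finally show "(\<Sum>\<^sub>\<infinity>p\<in>?A. real (count_list p a) * x p) \<le> real (inst_cap I a)" by simp
  qed
qed

theorem yes_instance_iff:
  "yes_instance I \<longleftrightarrow> (\<exists>H\<subseteq>set E. card H \<le> k \<and> (\<forall>u\<in>set U. set (els u) \<inter> H \<noteq> {}))"
proof
  assume "yes_instance I"
  then obtain K where K: "feasible_placement G (inst_cap I) s d K" "card K \<le> k"
    by (auto simp: yes_instance_def hitting_instance_def)
  \<comment> \<open>A virtualized set vertex is traded for the first of its elements: it serves only
    its own routes, and its set is hit by that element as well. The exchange does not increase the
    cardinality.\<close>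
  let ?H = "(K \<inter> set E) \<union> (\<lambda>u. hd (els u)) ` (K \<inter> set U)"
  have "K \<subseteq> set E \<union> set U"
    using K(1) by (auto simp: feasible_placement_def verts_G)
  then have fin: "finite K" using finite_subset by blast
  have "card ?H \<le> card (K \<inter> set E) + card ((\<lambda>u. hd (els u)) ` (K \<inter> set U))"
    by (rule card_Un_le)
  also have "\<dots> \<le> card (K \<inter> set E) + card (K \<inter> set U)"
    using fin by (intro add_left_mono card_image_le) auto
  also have "\<dots> = card ((K \<inter> set E) \<union> (K \<inter> set U))"
    using neqs(6) by (intro card_Un_disjoint[symmetric]) auto
  also have "\<dots> \<le> card K" using fin by (intro card_mono) auto
  finally have "card ?H \<le> k" using K(2) by simp
  moreover have "?H \<subseteq> set E"
  proof -
    have "hd (els u) \<in> set E" if "u \<in> set U" for u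
      using els[OF that] hd_in_set[of "els u"] by blast
    then show ?thesis by auto
  qed
  moreover have "set (els u) \<inter> ?H \<noteq> {}" if u: "u \<in> set U" for u
    using feasible_imp_hit[OF K(1) u] els[OF u] u by (auto dest: hd_in_set)
  ultimately show "\<exists>H\<subseteq>set E. card H \<le> k \<and> (\<forall>u\<in>set U. set (els u) \<inter> H \<noteq> {})" by blast
next
  assume "\<exists>H\<subseteq>set E. card H \<le> k \<and> (\<forall>u\<in>set U. set (els u) \<inter> H \<noteq> {})"
  then obtain H where H: "H \<subseteq> set E" "card H \<le> k" "\<forall>u\<in>set U. set (els u) \<inter> H \<noteq> {}" by blast
  then have "feasible_placement G (inst_cap I) s d H" by (intro hit_imp_feasible) auto
  with H(2) show "yes_instance I"
    by (auto simp: yes_instance_def hitting_instance_def)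
qed

end

section \<open>Emitting instances\<close>

subsection \<open>Names of vertices\<close>

text \<open>Inverse of \<open>binary\<close> on digit lists without leading zeros, that is, on lists
  that are empty or end with \<open>True\<close>.\<close>

definition from_bits :: "bool list \<Rightarrow> nat" where
  "from_bits bs = foldr (\<lambda>b n. of_bool b + 2 * n) bs 0"

lemma from_bits_pos: "bs \<noteq> [] \<Longrightarrow> last bs \<Longrightarrow> 0 < from_bits bs"
  by (induction bs) (auto simp: from_bits_def split: if_splits)

lemma binary_from_bits: "bs = [] \<or> last bs \<Longrightarrow> binary (from_bits bs) = bs"
proof (induction bs)
  case Nil
  then show ?case by (simp add: from_bits_def binary_0)
next
  case (Cons b bs)
  then have pos: "from_bits (b # bs) \<noteq> 0" using from_bits_pos[of "b # bs"] by simp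
  have eq: "from_bits (b # bs) = of_bool b + 2 * from_bits bs" by (simp add: from_bits_def)
  have "bs = [] \<or> last bs" using Cons.prems by (auto split: if_splits)
  from Cons.IH[OF this] show ?case
    unfolding binary_pos[OF pos] by (simp add: eq)
qed

lemma from_bits_replicate: "n \<le> from_bits (replicate n True)"
  by (induction n) (auto simp: from_bits_def)

text \<open>Digits come least significant first, so the final \<open>True\<close> is the leading
  digit and makes the list the expansion of a number. The \<open>False\<close> after each block of
  ones delimits it, which yields injectivity.\<close>

definition name_bits :: "nat \<Rightarrow> nat \<Rightarrow> nat \<Rightarrow> bool list" where
  "name_bits c a b =
     replicate a True @ [False] @ replicate b True @ [False] @ replicate c True @ [False, True]"

definition name :: "nat \<Rightarrow> nat \<Rightarrow> nat \<Rightarrow> nat" where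
  "name c a b = from_bits (name_bits c a b)"

lemma binary_name: "binary (name c a b) = name_bits c a b"
  unfolding name_def by (rule binary_from_bits) (simp add: name_bits_def)

lemma replicate_True_False_eq:
  "replicate a True @ False # xs = replicate b True @ False # ys \<longleftrightarrow> a = b \<and> xs = ys"
proof (induction a arbitrary: b)
  case 0
  show ?case by (cases b) auto
next
  case (Suc a)
  then show ?case by (cases b) auto
qed

lemma name_inject: "name c a b = name c' a' b' \<longleftrightarrow> c = c' \<and> a = a' \<and> b = b'"
proof -
  have "name c a b = name c' a' b' \<longleftrightarrow> name_bits c a b = name_bits c' a' b'"
    by (metis binary_name binary_inject)
  then show ?thesis by (auto simp: name_bits_def replicate_True_False_eq)
qed

lemma enc_nat_name: "enc_nat (name c a b) =
    concat (replicate a [True, True]) @ [True, False] @ concat (replicate b [True, True]) @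
    [True, False] @ concat (replicate c [True, True]) @ [True, False, True, True, False]"
  unfolding enc_nat_def binary_name by (simp add: enc_bits_def name_bits_def map_replicate)

text \<open>The capacity \<open>2 ^ n - 1\<close> is written by one loop over a tape of length
  \<open>n\<close>, two bits per digit, and it is at least \<open>n\<close>.\<close>

lemma enc_nat_from_bits_replicate:
  "enc_nat (from_bits (replicate n True)) = concat (replicate n [True, True]) @ [False]"
  unfolding enc_nat_def by (subst binary_from_bits) (cases n, auto simp: enc_bits_def map_replicate)

lemma enc_nat_one: "enc_nat (Suc 0) = [True, True, False]"
  by (simp add: enc_nat_def enc_bits_def binary_pos[of "Suc 0"] binary_0)

subsection \<open>Coordinates\<close>

definition gseq :: "gen list \<Rightarrow> gen" where
  "gseq gs = foldr Both gs Nop"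

definition glit :: "bool list \<Rightarrow> gen" where
  "glit w = gseq (map Out w)"

lemma den_gseq: "den D e (gseq gs) = concat (map (den D e) gs)"
  by (induction gs) (simp_all add: gseq_def)

lemma den_glit: "den D e (glit w) = w"
  by (induction w) (simp_all add: glit_def gseq_def)

lemma wf_gseq: "wf_gen n (gseq gs) \<longleftrightarrow> (\<forall>g\<in>set gs. wf_gen n g)"
  by (induction gs) (simp_all add: gseq_def)

lemma parked_gseq: "parked (gseq gs) = (\<Union>g\<in>set gs. parked g)"
  by (induction gs) (simp_all add: gseq_def)

lemma wf_glit: "wf_gen n (glit w)"
  by (auto simp: glit_def wf_gseq)

lemma parked_glit: "parked (glit w) = {}"
  by (auto simp: glit_def parked_gseq)

text \<open>A triple \<open>(vs, bs, k)\<close> is the sum of the counters \<open>vs\<close>, the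
  lengths of the tapes \<open>bs\<close> and the constant \<open>k\<close>; coefficients are
  expressed by repetition. Such sums can be written in unary piece by piece.\<close>

type_synonym coord = "nat list \<times> nat list \<times> nat"

fun cval :: "bool list list \<Rightarrow> (nat \<Rightarrow> nat) \<Rightarrow> coord \<Rightarrow> nat" where
  "cval D e (vs, bs, k) = (\<Sum>v\<leftarrow>vs. e v) + (\<Sum>i\<leftarrow>bs. length (D ! i)) + k"

fun gcoord :: "coord \<Rightarrow> gen" where
  "gcoord (vs, bs, k) = gseq (map (\<lambda>v. Rep v [True, True]) vs @
     map (\<lambda>i. For i (glit [True, True])) bs @ [glit (concat (replicate k [True, True]))])"

text \<open>\<open>A\<close> collects the tapes of the enclosing loops. A tape length is emitted by
  a loop over that tape, which must not be running already; where a counter and the length of its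
  range are both needed, a second tape of equal length is used.\<close>

fun wf_coord :: "nat \<Rightarrow> nat set \<Rightarrow> coord \<Rightarrow> bool" where
  "wf_coord n A (vs, bs, k) \<longleftrightarrow> set vs \<union> set bs \<subseteq> {2..<n} \<and> set bs \<inter> A = {}"

lemma den_For_glit: "den D e (For i (glit w)) = concat (replicate (length (D ! i)) w)"
  by (simp add: den_glit map_replicate_const del: upt_Suc)

lemma den_gcoord: "den D e (gcoord x) = concat (replicate (cval D e x) [True, True])"
proof (cases x)
  case (fields vs bs k)
  have "concat (map (\<lambda>v. concat (replicate (f v) w)) vs) = concat (replicate (\<Sum>v\<leftarrow>vs. f v) w)"
    for f :: "nat \<Rightarrow> nat" and vs and w :: "bool list"
    by (induction vs) (simp_all add: replicate_add)
  then show ?thesis unfolding fields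
    by (simp add: den_gseq den_glit comp_def den_For_glit replicate_add del: den.simps(5))
qed

lemma wf_gcoord: "wf_coord n A x \<Longrightarrow> wf_gen n (gcoord x)"
  by (cases x) (auto simp: wf_gseq wf_glit parked_glit)

lemma parked_gcoord: "wf_coord n A x \<Longrightarrow> parked (gcoord x) \<inter> A = {}"
  by (cases x) (auto simp: parked_gseq parked_glit)

definition gname :: "nat \<Rightarrow> coord \<Rightarrow> coord \<Rightarrow> gen" where
  "gname c x y = gseq [gcoord x, glit [True, False], gcoord y,
     glit ([True, False] @ concat (replicate c [True, True]) @ [True, False, True, True, False])]"

lemma den_gname: "den D e (gname c x y) = enc_nat (name c (cval D e x) (cval D e y))"
  by (simp add: gname_def den_gseq den_glit den_gcoord enc_nat_name)

lemma wf_gname: "wf_coord n A x \<Longrightarrow> wf_coord n A y \<Longrightarrow> wf_gen n (gname c x y)"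
  by (auto simp: gname_def wf_gseq wf_glit intro: wf_gcoord)

lemma parked_gname:
  "wf_coord n A x \<Longrightarrow> wf_coord n A y \<Longrightarrow> parked (gname c x y) \<inter> A = {}"
  using parked_gcoord[of n A x] parked_gcoord[of n A y]
  by (auto simp: gname_def parked_gseq parked_glit)

abbreviation here :: "nat \<Rightarrow> coord" where "here l \<equiv> ([l], [], 0)"
abbreviation const :: "nat \<Rightarrow> coord" where "const k \<equiv> ([], [], k)"

subsection \<open>Families of sets\<close>

text \<open>
  A family consists of two tapes that are looped over and of the members of the set with given
  loop counters. A member is a tag with two coordinates; the members may depend on the bit
  under the head of the first tape.
\<close>

type_synonym family = "nat \<times> nat \<times> (bool \<Rightarrow> (nat \<times> coord \<times> coord) list)"

definition bit_at :: "bool list list \<Rightarrow> nat \<Rightarrow> nat \<Rightarrow> bool" where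
  "bit_at D l a \<longleftrightarrow> 0 < a \<and> a \<le> length (D ! l) \<and> D ! l ! (a - 1)"

fun members :: "bool list list \<Rightarrow> family \<Rightarrow> nat \<Rightarrow> nat \<Rightarrow> (nat \<times> nat \<times> nat) list" where
  "members D (l1, l2, L) a b = map (\<lambda>(c, x, y).
     (c, cval D ((\<lambda>_. 0)(l1 := a, l2 := b)) x, cval D ((\<lambda>_. 0)(l1 := a, l2 := b)) y)) (L (bit_at D l1 a))"

definition indices :: "bool list list \<Rightarrow> nat \<Rightarrow> nat \<Rightarrow> (nat \<times> nat) list" where
  "indices D l1 l2 = List.product [1..<Suc (length (D ! l1))] [1..<Suc (length (D ! l2))]"

definition loops :: "bool list list \<Rightarrow> family \<Rightarrow> (nat \<times> nat) list" where
  "loops D F = indices D (fst F) (fst (snd F))"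

fun wf_family :: "nat \<Rightarrow> family \<Rightarrow> bool" where
  "wf_family n (l1, l2, L) \<longleftrightarrow> l1 \<in> {2..<n} \<and> l2 \<in> {2..<n} \<and> l1 \<noteq> l2 \<and>
     (\<forall>\<beta>. \<forall>(c, x, y)\<in>set (L \<beta>). wf_coord n {l1, l2} x \<and> wf_coord n {l1, l2} y)"

definition gloop :: "nat \<Rightarrow> nat \<Rightarrow> gen \<Rightarrow> gen" where
  "gloop l1 l2 g = For l1 (For l2 g)"

lemma den_gloop: "den D (\<lambda>_. 0) (gloop l1 l2 g) =
    concat (map (\<lambda>(a, b). den D ((\<lambda>_. 0)(l1 := a, l2 := b)) g) (indices D l1 l2))"
proof -
  have "concat (map f (List.product xs ys)) = concat (map (\<lambda>x. concat (map (\<lambda>y. f (x, y)) ys)) xs)"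
    for f :: "nat \<times> nat \<Rightarrow> bool list" and xs ys
    by (induction xs) (simp_all add: comp_def)
  then show ?thesis by (simp add: gloop_def indices_def del: upt_Suc)
qed

lemma set_indices: "set (indices D l1 l2) = {1..length (D ! l1)} \<times> {1..length (D ! l2)}"
  by (auto simp: indices_def simp del: upt_Suc)

lemma distinct_concat_map:
  assumes "distinct xs" "\<And>x. x \<in> set xs \<Longrightarrow> distinct (f x)"
    "\<And>x y. x \<in> set xs \<Longrightarrow> y \<in> set xs \<Longrightarrow> x \<noteq> y \<Longrightarrow> set (f x) \<inter> set (f y) = {}"
  shows "distinct (concat (map f xs))"
  using assms
proof (induction xs)
  case (Cons x xs)
  have "set (f x) \<inter> set (concat (map f xs)) = {}"
    using Cons.prems(1) Cons.prems(3)[of x] by auto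
  with Cons show ?case by simp
qed simp

lemma distinct_indices: "distinct (indices D l1 l2)"
  by (simp add: indices_def distinct_product del: upt_Suc)

lemma concat_map_concat_map:
  "concat (map g (concat (map f xs))) = concat (map (\<lambda>x. concat (map g (f x))) xs)"
  by (induction xs) simp_all

subsection \<open>Instances given by families of sets\<close>

text \<open>
  The elements are triples of a tag below \<open>tags\<close> and two coordinates bounded by the tapes \<open>l\<close> and \<open>l'\<close>.
  Tape \<open>lb\<close> gives the bound in unary; the capacity of the arcs into the destination has
  as many binary digits as tape \<open>lc\<close> has cells.
\<close>

locale hit_system =
  fixes gs :: "gen list" and l l' lb lc tags :: nat and fams :: "family list"
  assumes wf_gs: "wf_gens gs"
    and tapes: "{l, l', lb, lc} \<subseteq> {2..<3 + length gs}" "l \<noteq> l'" "lc \<noteq> l" "lc \<noteq> l'"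
    and wf_fams: "F \<in> set fams \<Longrightarrow> wf_family (3 + length gs) F"
begin

text \<open>Tags 0 and 1 are reserved for the source and the destination. The tags of the elements
  follow, and after them one tag for each family of sets.\<close>

definition elems :: "bool list list \<Rightarrow> nat list" where
  "elems D = concat (map (\<lambda>(a, b). map (\<lambda>c. name (2 + c) a b) [0..<tags]) (indices D l l'))"

definition sets :: "bool list list \<Rightarrow> nat list" where
  "sets D = concat (map (\<lambda>f. map (\<lambda>(a, b). name (2 + tags + f) a b) (loops D (fams ! f))) [0..<length fams])"

text \<open>A \<open>hitting_instance\<close> takes the elements of a set as a function of its
  vertex, so the family and the loop counters have to be recovered from the number of that
  vertex.\<close>

definition unname :: "nat \<Rightarrow> nat \<times> nat \<times> nat" where
  "unname = inv (\<lambda>(c, a, b). name c a b)"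

definition els :: "bool list list \<Rightarrow> nat \<Rightarrow> nat list" where
  "els D u = (case unname u of (t, a, b) \<Rightarrow>
     map (\<lambda>(c, x, y). name (2 + c) x y) (members D (fams ! (t - 2 - tags)) a b))"

definition instance_of :: "bool list list \<Rightarrow> placement_instance" where
  "instance_of D = hitting_instance (name 0 0 0) (name 1 0 0) (elems D) (sets D) (els D)
     (from_bits (replicate (length (D ! lc)) True)) (length (D ! lb))"

definition source_gen :: gen where "source_gen = gname 0 (const 0) (const 0)"
definition dest_gen :: gen where "dest_gen = gname 1 (const 0) (const 0)"
definition elem_gen :: "nat \<Rightarrow> gen" where "elem_gen c = gname (2 + c) (here l) (here l')"

definition set_gen :: "nat \<Rightarrow> gen" where
  "set_gen f = gname (2 + tags + f) (here (fst (fams ! f))) (here (fst (snd (fams ! f))))"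

definition capacity_gen :: gen where
  "capacity_gen = gseq [For lc (glit [True, True]), glit [False]]"

definition set_edges_gen :: "nat \<Rightarrow> bool \<Rightarrow> gen" where
  "set_edges_gen f \<beta> = gseq (map (\<lambda>(c, x, y).
     gseq [glit [True], set_gen f, gname (2 + c) x y, glit [True, True, False]]) (snd (snd (fams ! f)) \<beta>))"

definition fam_gen :: "(nat \<Rightarrow> gen) \<Rightarrow> gen" where
  "fam_gen g = gseq (map (\<lambda>f. gloop (fst (fams ! f)) (fst (snd (fams ! f))) (g f)) [0..<length fams])"

text \<open>The order is that of \<open>enc_instance\<close>: \<open>True\<close> announces an entry
  of a list and \<open>False\<close> ends the list. Each set contributes its arc from the source and
  then the arcs to its members, as in \<open>hitting_instance\<close>. After source and destination,
  \<open>False\<close> is the sign of the bound, \<open>Bin lb\<close> gives its digits and the last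
  \<open>False\<close> closes their code.\<close>

definition main_gen :: gen where
  "main_gen = gseq [
     glit [True], source_gen, glit [True], dest_gen,
     gloop l l' (gseq (map (\<lambda>c. gseq [glit [True], elem_gen c]) [0..<tags])),
     fam_gen (\<lambda>f. gseq [glit [True], set_gen f]),
     glit [False],
     gloop l l' (gseq (map (\<lambda>c. gseq [glit [True], elem_gen c, dest_gen, capacity_gen]) [0..<tags])),
     fam_gen (\<lambda>f. gseq [glit [True], source_gen, set_gen f, glit [True, True, False],
       Ifb (fst (fams ! f)) (set_edges_gen f True) (set_edges_gen f False)]),
     glit [False], source_gen, dest_gen, glit [False], Bin lb, glit [False]]"

lemma fam_cases:
  assumes "f < length fams"
  obtains l1 l2 L where "fams ! f = (l1, l2, L)" "l1 \<in> {2..<3 + length gs}" "l2 \<in> {2..<3 + length gs}" "l1 \<noteq> l2"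
    "\<And>\<beta> c x y. (c, x, y) \<in> set (L \<beta>) \<Longrightarrow> wf_coord (3 + length gs) {l1, l2} x \<and> wf_coord (3 + length gs) {l1, l2} y"
proof (cases "fams ! f")
  case (fields l1 l2 L)
  then have "wf_family (3 + length gs) (l1, l2, L)" using wf_fams[OF nth_mem[OF assms]] by simp
  then show ?thesis by (intro that[OF fields]) auto
qed

lemma unname_name: "unname (name t a b) = (t, a, b)"
proof -
  have "inj (\<lambda>(c, a, b). name c a b)" by (auto simp: inj_on_def name_inject)
  from inv_f_f[OF this, of "(t, a, b)"] show ?thesis by (simp add: unname_def)
qed

lemma els_name:
  "els D (name (2 + tags + f) a b) = map (\<lambda>(c, x, y). name (2 + c) x y) (members D (fams ! f) a b)"
  by (simp add: els_def unname_name)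

lemma den_fam_gen:
  "den D (\<lambda>_. 0) (fam_gen g) = concat (map (\<lambda>f. concat (map (\<lambda>(a, b).
     den D ((\<lambda>_. 0)(fst (fams ! f) := a, fst (snd (fams ! f)) := b)) (g f)) (loops D (fams ! f)))) [0..<length fams])"
  by (simp add: fam_gen_def den_gseq den_gloop loops_def comp_def)

lemma den_main_gen: "den D (\<lambda>_. 0) main_gen = enc_instance (instance_of D)"
proof -
  let ?s = "name 0 0 0" and ?d = "name 1 0 0" and ?cap = "from_bits (replicate (length (D ! lc)) True)"
  have source: "den D e source_gen = enc_nat ?s" and dest: "den D e dest_gen = enc_nat ?d" for e
    by (simp_all add: source_gen_def dest_gen_def den_gname)
  have capacity: "den D e capacity_gen = enc_nat ?cap" for e
    by (simp add: capacity_gen_def den_gseq den_glit den_For_glit enc_nat_from_bits_replicate del: den.simps(5))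
  have elem: "den D ((\<lambda>_. 0)(l := a, l' := b)) (elem_gen c) = enc_nat (name (2 + c) a b)" for a b c
    using tapes(2) by (simp add: elem_gen_def den_gname)
  have set: "den D ((\<lambda>_. 0)(fst (fams ! f) := a, fst (snd (fams ! f)) := b)) (set_gen f) =
      enc_nat (name (2 + tags + f) a b)" if "f < length fams" for a b f
    using that by (cases rule: fam_cases) (simp_all add: set_gen_def den_gname)
  have edges: "den D ((\<lambda>_. 0)(fst (fams ! f) := a, fst (snd (fams ! f)) := b))
      (Ifb (fst (fams ! f)) (set_edges_gen f True) (set_edges_gen f False)) =
      concat (map (\<lambda>v. True # enc_edge (name (2 + tags + f) a b, v, 1)) (els D (name (2 + tags + f) a b)))"
    (is "den D ?e _ = _") if f: "f < length fams" for a b f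
  proof -
    obtain l1 l2 L where F: "fams ! f = (l1, l2, L)" "l1 \<noteq> l2" using f by (rule fam_cases)
    have "den D ?e (Ifb l1 (set_edges_gen f True) (set_edges_gen f False)) = den D ?e (set_edges_gen f (bit_at D l1 a))"
      using F by (cases "bit_at D l1 a") (auto simp: bit_at_def)
    also have "\<dots> = concat (map (\<lambda>(c, x, y). True # enc_edge (name (2 + tags + f) a b,
        name (2 + c) (cval D ?e x) (cval D ?e y), 1)) (L (bit_at D l1 a)))"
      using F set[OF f, of a b]
      by (simp add: set_edges_gen_def den_gseq comp_def case_prod_unfold den_glit den_gname enc_edge_def enc_nat_one)
    also have "\<dots> = concat (map (\<lambda>v. True # enc_edge (name (2 + tags + f) a b, v, 1)) (els D (name (2 + tags + f) a b)))"
      unfolding els_name F(1) by (simp add: comp_def case_prod_unfold)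
    finally show ?thesis using F by simp
  qed
  have 1: "den D (\<lambda>_. 0) (gloop l l' (gseq (map (\<lambda>c. gseq [glit [True], elem_gen c]) [0..<tags]))) =
      concat (map (\<lambda>v. True # enc_nat v) (elems D))"
    by (simp add: den_gloop den_gseq comp_def den_glit elem elems_def concat_map_concat_map case_prod_unfold)
  have 2: "den D (\<lambda>_. 0) (fam_gen (\<lambda>f. gseq [glit [True], set_gen f])) = concat (map (\<lambda>v. True # enc_nat v) (sets D))"
    unfolding den_fam_gen sets_def concat_map_concat_map
    by (intro arg_cong[of _ _ concat] map_cong refl)
      (auto simp: den_gseq den_glit set comp_def case_prod_unfold intro!: arg_cong[of _ _ concat])
  have 3: "den D (\<lambda>_. 0) (gloop l l' (gseq (map (\<lambda>c. gseq [glit [True], elem_gen c, dest_gen, capacity_gen]) [0..<tags]))) =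
      concat (map (\<lambda>v. True # enc_edge (v, ?d, ?cap)) (elems D))"
    by (simp add: den_gloop den_gseq comp_def den_glit elem elems_def concat_map_concat_map case_prod_unfold
        enc_edge_def dest capacity)
  have 4: "den D (\<lambda>_. 0) (fam_gen (\<lambda>f. gseq [glit [True], source_gen, set_gen f, glit [True, True, False],
       Ifb (fst (fams ! f)) (set_edges_gen f True) (set_edges_gen f False)])) =
      concat (map (\<lambda>u. True # enc_edge (?s, u, 1) @ concat (map (\<lambda>v. True # enc_edge (u, v, 1)) (els D u))) (sets D))"
    unfolding den_fam_gen sets_def concat_map_concat_map
    by (intro arg_cong[of _ _ concat] map_cong refl)
      (auto simp: den_gseq den_glit set edges source comp_def case_prod_unfold enc_edge_def enc_nat_one
        simp del: den.simps(4) intro!: arg_cong[of _ _ concat])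
  show ?thesis
    unfolding main_gen_def den_gseq
    by (simp add: 1 2 3 4 source dest den_glit instance_of_def hitting_instance_def enc_instance_def enc_list_def
        concat_map_concat_map comp_def enc_int_def enc_nat_def[of "length (D ! lb)"] enc_bits_def del: den.simps(4))
qed

lemma wf_main_gen: "wf_gen (3 + length gs) main_gen"
proof -
  let ?n = "3 + length gs"
  \<comment> \<open>Coordinates without tape lengths satisfy \<open>wf_coord\<close> even for
    \<open>A = UNIV\<close>, which shows that their names park no tape at all.\<close>
  have source: "wf_gen ?n source_gen" "parked source_gen = {}"
    and dest: "wf_gen ?n dest_gen" "parked dest_gen = {}"
    using wf_gname[of ?n UNIV "const 0" "const 0"] parked_gname[of ?n UNIV "const 0" "const 0"]
    by (auto simp: source_gen_def dest_gen_def)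
  have elem: "wf_gen ?n (elem_gen c)" "parked (elem_gen c) = {}" for c
    using wf_gname[of ?n UNIV "here l" "here l'"] parked_gname[of ?n UNIV "here l" "here l'"] tapes
    by (auto simp: elem_gen_def)
  have capacity: "wf_gen ?n capacity_gen" "parked capacity_gen = {lc}"
    using tapes by (auto simp: capacity_gen_def wf_gseq wf_glit parked_gseq parked_glit)
  have set: "wf_gen ?n (set_gen f)" "parked (set_gen f) = {}" if f: "f < length fams" for f
  proof -
    obtain l1 l2 L where F: "fams ! f = (l1, l2, L)" "l1 \<in> {2..<?n}" "l2 \<in> {2..<?n}"
      by (rule fam_cases[OF f]) (rule that)
    then have "wf_coord ?n UNIV (here l1)" "wf_coord ?n UNIV (here l2)" by auto
    with F(1) show "wf_gen ?n (set_gen f)" "parked (set_gen f) = {}"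
      using wf_gname[of ?n UNIV "here l1" "here l2"] parked_gname[of ?n UNIV "here l1" "here l2"]
      by (simp_all add: set_gen_def)
  qed
  have edges: "wf_gen ?n (set_edges_gen f \<beta>)"
      "parked (set_edges_gen f \<beta>) \<inter> {fst (fams ! f), fst (snd (fams ! f))} = {}"
    if f: "f < length fams" for f \<beta>
  proof -
    obtain l1 l2 L where F: "fams ! f = (l1, l2, L)"
      "\<And>\<beta> c x y. (c, x, y) \<in> set (L \<beta>) \<Longrightarrow> wf_coord ?n {l1, l2} x \<and> wf_coord ?n {l1, l2} y"
      by (rule fam_cases[OF f]) (rule that)
    show "wf_gen ?n (set_edges_gen f \<beta>)"
    proof -
      have "wf_gen ?n (gname (2 + c) x y)" if "(c, x, y) \<in> set (L \<beta>)" for c x y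
        using F(2)[OF that] wf_gname by blast
      then show ?thesis using F(1) set[OF f] by (fastforce simp: set_edges_gen_def wf_gseq wf_glit)
    qed
    have "parked (gname (2 + c) x y) \<inter> {l1, l2} = {}" if "(c, x, y) \<in> set (L \<beta>)" for c x y
      using F(2)[OF that] by (intro parked_gname) auto
    then show "parked (set_edges_gen f \<beta>) \<inter> {fst (fams ! f), fst (snd (fams ! f))} = {}"
      using F(1) set[OF f] by (fastforce simp: set_edges_gen_def parked_gseq parked_glit)
  qed
  have fam: "wf_gen ?n (fam_gen g)"
    if wf: "\<And>f. f < length fams \<Longrightarrow> wf_gen ?n (g f)"
      and park: "\<And>f. f < length fams \<Longrightarrow> parked (g f) \<inter> {fst (fams ! f), fst (snd (fams ! f))} = {}" for g
  proof -
    have "wf_gen ?n (gloop (fst (fams ! f)) (fst (snd (fams ! f))) (g f))" if f: "f < length fams" for f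
      using f wf[OF f] park[OF f] by (cases rule: fam_cases) (auto simp: gloop_def)
    then show ?thesis by (auto simp: fam_gen_def wf_gseq)
  qed
  have "wf_gen ?n (fam_gen (\<lambda>f. gseq [glit [True], set_gen f]))"
    by (rule fam) (auto simp: wf_gseq wf_glit parked_gseq parked_glit set)
  moreover have "wf_gen ?n (fam_gen (\<lambda>f. gseq [glit [True], source_gen, set_gen f, glit [True, True, False],
       Ifb (fst (fams ! f)) (set_edges_gen f True) (set_edges_gen f False)]))"
  proof (rule fam)
    fix f assume f: "f < length fams"
    then have "fst (fams ! f) \<in> {2..<?n}" by (cases rule: fam_cases) auto
    then show "wf_gen ?n (gseq [glit [True], source_gen, set_gen f, glit [True, True, False],
       Ifb (fst (fams ! f)) (set_edges_gen f True) (set_edges_gen f False)])"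
      using f edges(1)[OF f] by (auto simp: wf_gseq wf_glit set source)
    show "parked (gseq [glit [True], source_gen, set_gen f, glit [True, True, False],
       Ifb (fst (fams ! f)) (set_edges_gen f True) (set_edges_gen f False)]) \<inter>
       {fst (fams ! f), fst (snd (fams ! f))} = {}"
      using f edges(2)[OF f, of True] edges(2)[OF f, of False] by (auto simp: parked_gseq parked_glit set source)
  qed
  ultimately show ?thesis
    using tapes by (auto simp: main_gen_def gloop_def wf_gseq wf_glit parked_gseq parked_glit source dest elem capacity)
qed

lemma polytime_instances: "polytime_computable (\<lambda>xs. enc_instance (instance_of (contents gs xs)))"
  using polytime_computable_den[OF wf_gs wf_main_gen] by (simp add: den_main_gen)

end

section \<open>Emitted instances as hitting set problems\<close>

lemma ex_subset_image: "(\<exists>H\<subseteq>f ` A. P H) \<longleftrightarrow> (\<exists>H\<subseteq>A. P (f ` H))"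
  by (metis subset_image_iff)

definition grid :: "bool list list \<Rightarrow> nat \<Rightarrow> nat \<Rightarrow> nat \<Rightarrow> (nat \<times> nat \<times> nat) set" where
  "grid D l l' c = {..<c} \<times> {1..length (D ! l)} \<times> {1..length (D ! l')}"

context hit_system
begin

lemma set_elems: "set (elems D) = (\<lambda>(c, a, b). name (2 + c) a b) ` grid D l l' tags"
  by (force simp: elems_def grid_def set_indices)

lemma set_sets:
  "set (sets D) = {name (2 + tags + f) a b | f a b. f < length fams \<and> (a, b) \<in> set (loops D (fams ! f))}"
  by (force simp: sets_def)

lemma distinct_elems: "distinct (elems D)"
  unfolding elems_def
  by (rule distinct_concat_map) (auto simp: distinct_indices distinct_map inj_on_def name_inject)

lemma distinct_sets: "distinct (sets D)"
  unfolding sets_def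
  by (rule distinct_concat_map)
    (auto simp: loops_def distinct_indices distinct_map inj_on_def name_inject)

lemma length_sets: "length (sets D) = (\<Sum>F\<leftarrow>fams. length (loops D F))"
proof -
  have "length (sets D) = (\<Sum>f\<leftarrow>[0..<length fams]. length (loops D (fams ! f)))"
    by (simp add: sets_def length_concat comp_def)
  also have "\<dots> = (\<Sum>F\<leftarrow>map (\<lambda>f. fams ! f) [0..<length fams]. length (loops D F))"
    by (simp add: comp_def)
  finally show ?thesis by (simp add: map_nth)
qed

text \<open>The map from triples to vertex numbers is injective, so cardinalities and intersections
  may be computed on triples, where no encoding is visible any more.\<close>

theorem placement_iff_hitting_set:
  assumes members: "\<And>F a b. F \<in> set fams \<Longrightarrow> (a, b) \<in> set (loops D F) \<Longrightarrow>
      members D F a b \<noteq> [] \<and> distinct (members D F a b) \<and> set (members D F a b) \<subseteq> grid D l l' tags"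
    and cap: "length (sets D) \<le> length (D ! lc)"
  shows "enc_instance (instance_of D) \<in> vnf_placement \<longleftrightarrow>
    (\<exists>H\<subseteq>grid D l l' tags. card H \<le> length (D ! lb) \<and>
       (\<forall>F\<in>set fams. \<forall>(a, b)\<in>set (loops D F). set (members D F a b) \<inter> H \<noteq> {}))"
proof -
  define nm where "nm = (\<lambda>(c, a, b). name (2 + c) a b)"
  have inj: "inj nm" by (auto simp: nm_def inj_on_def name_inject)
  have els_nm: "els D (name (2 + tags + f) a b) = map nm (members D (fams ! f) a b)" for f a b
    by (simp only: els_name nm_def)
  have elems_nm: "set (elems D) = nm ` grid D l l' tags" by (simp add: set_elems nm_def)
  interpret hitting "name 0 0 0" "name 1 0 0" "elems D" "sets D" "els D"
    "from_bits (replicate (length (D ! lc)) True)" "length (D ! lb)"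
  proof
    show "distinct (name 0 0 0 # name 1 0 0 # elems D @ sets D)"
      using distinct_elems distinct_sets
      by (auto simp: elems_nm set_sets nm_def grid_def name_inject)
    \<comment> \<open>A number with \<open>n\<close> binary ones is at least \<open>n\<close>, so
      the length of tape \<open>lc\<close> already bounds the capacity from below.\<close>
    show "length (sets D) \<le> from_bits (replicate (length (D ! lc)) True)"
      using cap from_bits_replicate le_trans by blast
    fix u assume "u \<in> set (sets D)"
    then obtain f a b where u: "u = name (2 + tags + f) a b" "f < length fams" "(a, b) \<in> set (loops D (fams ! f))"
      unfolding set_sets by blast
    have "members D (fams ! f) a b \<noteq> [] \<and> distinct (members D (fams ! f) a b) \<and> set (members D (fams ! f) a b) \<subseteq> grid D l l' tags"
      using u by (intro members) auto
    then show "els D u \<noteq> [] \<and> distinct (els D u) \<and> set (els D u) \<subseteq> set (elems D)"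
      using inj unfolding u(1) els_nm elems_nm by (auto simp: distinct_map intro: inj_on_subset)
  qed
  have hits: "(\<forall>u\<in>set (sets D). set (els D u) \<inter> nm ` H \<noteq> {}) \<longleftrightarrow>
      (\<forall>F\<in>set fams. \<forall>(a, b)\<in>set (loops D F). set (members D F a b) \<inter> H \<noteq> {})" for H
  proof -
    have "(\<forall>u\<in>set (sets D). set (els D u) \<inter> nm ` H \<noteq> {}) \<longleftrightarrow>
      (\<forall>f<length fams. \<forall>(a, b)\<in>set (loops D (fams ! f)). set (els D (name (2 + tags + f) a b)) \<inter> nm ` H \<noteq> {})"
      unfolding set_sets by blast
    also have "\<dots> \<longleftrightarrow> (\<forall>f<length fams. \<forall>(a, b)\<in>set (loops D (fams ! f)). set (members D (fams ! f) a b) \<inter> H \<noteq> {})"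
      unfolding els_nm set_map image_Int[OF inj, symmetric] by simp
    also have "\<dots> \<longleftrightarrow> (\<forall>F\<in>set fams. \<forall>(a, b)\<in>set (loops D F). set (members D F a b) \<inter> H \<noteq> {})"
      unfolding all_set_conv_all_nth ..
    finally show ?thesis .
  qed
  have "enc_instance (instance_of D) \<in> vnf_placement \<longleftrightarrow> yes_instance (instance_of D)"
    using valid_I by (simp add: enc_instance_in_vnf_placement instance_of_def)
  also have "\<dots> \<longleftrightarrow> (\<exists>H\<subseteq>nm ` grid D l l' tags. card H \<le> length (D ! lb) \<and> (\<forall>u\<in>set (sets D). set (els D u) \<inter> H \<noteq> {}))"
    unfolding instance_of_def yes_instance_iff elems_nm ..
  also have "\<dots> \<longleftrightarrow> (\<exists>H\<subseteq>grid D l l' tags. card (nm ` H) \<le> length (D ! lb) \<and> (\<forall>u\<in>set (sets D). set (els D u) \<inter> nm ` H \<noteq> {}))"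
    by (rule ex_subset_image)
  also have "\<dots> \<longleftrightarrow> (\<exists>H\<subseteq>grid D l l' tags. card H \<le> length (D ! lb) \<and>
       (\<forall>F\<in>set fams. \<forall>(a, b)\<in>set (loops D F). set (members D F a b) \<inter> H \<noteq> {}))"
    unfolding hits using inj by (simp add: card_image inj_on_subset)
  finally show ?thesis .
qed

end

section \<open>Satisfiability as a hitting set problem\<close>

text \<open>
  A literal is a sign, the tag of a variable and two coordinates. Variable \<open>c\<close> at \<open>(a, b)\<close> yields
  elements with tags \<open>2 * c\<close> and \<open>2 * c + 1\<close>, one for each sign.
\<close>

type_synonym clause_family = "nat \<times> nat \<times> (bool \<Rightarrow> (bool \<times> nat \<times> coord \<times> coord) list)"

definition lit_tag :: "bool \<Rightarrow> nat \<Rightarrow> nat" where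
  "lit_tag s c = 2 * c + (if s then 0 else 1)"

lemma lit_tag_inject: "lit_tag s c = lit_tag s' c' \<longleftrightarrow> s = s' \<and> c = c'"
  unfolding lit_tag_def by (auto split: if_splits; presburger)

lemma lit_tag_less: "c < C \<Longrightarrow> lit_tag s c < 2 * C"
  by (auto simp: lit_tag_def)

fun family_of_clause :: "clause_family \<Rightarrow> family" where
  "family_of_clause (l1, l2, L) = (l1, l2, \<lambda>\<beta>. map (\<lambda>(s, c, x, y). (lit_tag s c, x, y)) (L \<beta>))"

definition variable_family :: "nat \<Rightarrow> nat \<Rightarrow> nat \<Rightarrow> family" where
  "variable_family l l' c = (l, l', \<lambda>_. [(lit_tag True c, here l, here l'), (lit_tag False c, here l, here l')])"

fun literals :: "bool list list \<Rightarrow> clause_family \<Rightarrow> nat \<Rightarrow> nat \<Rightarrow> (bool \<times> nat \<times> nat \<times> nat) list" where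
  "literals D (l1, l2, L) a b = map (\<lambda>(s, c, x, y).
     (s, c, cval D ((\<lambda>_. 0)(l1 := a, l2 := b)) x, cval D ((\<lambda>_. 0)(l1 := a, l2 := b)) y)) (L (bit_at D l1 a))"

fun wf_clause_family :: "nat \<Rightarrow> clause_family \<Rightarrow> bool" where
  "wf_clause_family n (l1, l2, L) \<longleftrightarrow> l1 \<in> {2..<n} \<and> l2 \<in> {2..<n} \<and> l1 \<noteq> l2 \<and>
     (\<forall>\<beta>. \<forall>(s, c, x, y)\<in>set (L \<beta>). wf_coord n {l1, l2} x \<and> wf_coord n {l1, l2} y)"

definition clause_loops :: "bool list list \<Rightarrow> clause_family \<Rightarrow> (nat \<times> nat) list" where
  "clause_loops D F = indices D (fst F) (fst (snd F))"

definition satisfiable :: "bool list list \<Rightarrow> clause_family list \<Rightarrow> bool" where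
  "satisfiable D Fs \<longleftrightarrow> (\<exists>\<alpha>. \<forall>F\<in>set Fs. \<forall>(a, b)\<in>set (clause_loops D F).
     \<exists>(s, c, x, y)\<in>set (literals D F a b). \<alpha> (c, x, y) = s)"

definition families :: "nat \<Rightarrow> nat \<Rightarrow> nat \<Rightarrow> clause_family list \<Rightarrow> family list" where
  "families l l' C Fs = map (variable_family l l') [0..<C] @ map family_of_clause Fs"

lemma members_family_of_clause:
  "members D (family_of_clause F) a b = map (\<lambda>(s, c, x, y). (lit_tag s c, x, y)) (literals D F a b)"
  by (cases F) auto

lemma loops_family_of_clause: "loops D (family_of_clause F) = clause_loops D F"
  by (cases F) (simp add: loops_def clause_loops_def)

lemma members_variable_family:
  "l \<noteq> l' \<Longrightarrow> members D (variable_family l l' c) a b = [(lit_tag True c, a, b), (lit_tag False c, a, b)]"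
  by (simp add: variable_family_def)

lemma loops_variable_family: "loops D (variable_family l l' c) = indices D l l'"
  by (simp add: variable_family_def loops_def)

lemma hitting_set_iff_satisfiable:
  assumes "l \<noteq> l'"
    and grid: "\<And>F a b s c x y. F \<in> set Fs \<Longrightarrow> (a, b) \<in> set (clause_loops D F) \<Longrightarrow>
      (s, c, x, y) \<in> set (literals D F a b) \<Longrightarrow> (c, x, y) \<in> grid D l l' C"
    and bound: "length (D ! lb) = C * length (D ! l) * length (D ! l')"
  shows "(\<exists>H \<subseteq> grid D l l' (2 * C). card H \<le> length (D ! lb) \<and>
       (\<forall>F\<in>set (families l l' C Fs). \<forall>(a, b)\<in>set (loops D F). set (members D F a b) \<inter> H \<noteq> {}))
     \<longleftrightarrow> satisfiable D Fs"
proof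
  let ?V = "grid D l l' C"
  have card_V: "card ?V = length (D ! lb)" by (simp add: grid_def bound card_cartesian_product)
  {
    assume "\<exists>H \<subseteq> grid D l l' (2 * C). card H \<le> length (D ! lb) \<and>
       (\<forall>F\<in>set (families l l' C Fs). \<forall>(a, b)\<in>set (loops D F). set (members D F a b) \<inter> H \<noteq> {})"
    then obtain H where H: "H \<subseteq> grid D l l' (2 * C)" "card H \<le> length (D ! lb)"
      and all: "\<forall>F\<in>set (families l l' C Fs). \<forall>(a, b)\<in>set (loops D F). set (members D F a b) \<inter> H \<noteq> {}"
      by (elim exE conjE)
    have hits: "set (members D F a b) \<inter> H \<noteq> {}"
      if "F \<in> set (families l l' C Fs)" "(a, b) \<in> set (loops D F)" for F a b
      using bspec[OF bspec[OF all that(1)] that(2)] by simp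
    have fin: "finite H" using H(1) by (rule finite_subset) (simp add: grid_def)
    \<comment> \<open>\<open>var\<close> forgets the sign. The sets of the variables make it map
      \<open>H\<close> onto all variables, and the bound on \<open>card H\<close> then forces it to
      be injective, so that \<open>H\<close> never contains both literals of a variable.\<close>
    define var where "var = (\<lambda>(t::nat, a::nat, b::nat). (t div 2, a, b))"
    have "?V \<subseteq> var ` H"
    proof
      fix v assume "v \<in> ?V"
      then obtain c a b where v: "v = (c, a, b)" "c < C" "(a, b) \<in> set (indices D l l')"
        by (auto simp: grid_def set_indices)
      have "set (members D (variable_family l l' c) a b) \<inter> H \<noteq> {}"
        using v by (intro hits) (auto simp: families_def loops_variable_family)
      then obtain s where "(lit_tag s c, a, b) \<in> H"
        unfolding members_variable_family[OF assms(1)] by auto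
      moreover have "var (lit_tag s c, a, b) = v" by (simp add: var_def lit_tag_def v)
      ultimately show "v \<in> var ` H" by (metis imageI)
    qed
    moreover have "card (var ` H) \<le> card ?V" using card_image_le[OF fin, of var] H(2) card_V by linarith
    moreover have "card ?V \<le> card (var ` H)" using fin calculation(1) by (intro card_mono) auto
    ultimately have "card (var ` H) = card H"
      using card_image_le[OF fin, of var] H(2) card_V by linarith
    then have inj: "inj_on var H" by (rule eq_card_imp_inj_on[OF fin])
    define \<alpha> where "\<alpha> = (\<lambda>(c, x, y). (lit_tag True c, x, y) \<in> H)"
    have "\<exists>(s, c, x, y)\<in>set (literals D F a b). \<alpha> (c, x, y) = s"
      if F: "F \<in> set Fs" "(a, b) \<in> set (clause_loops D F)" for F a b
    proof -
      have "set (members D (family_of_clause F) a b) \<inter> H \<noteq> {}"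
        using F by (intro hits) (auto simp: families_def loops_family_of_clause)
      then obtain s c x y where *: "(s, c, x, y) \<in> set (literals D F a b)" "(lit_tag s c, x, y) \<in> H"
        unfolding members_family_of_clause by auto
      have "\<alpha> (c, x, y) = s"
      proof (cases s)
        case False
        have "(lit_tag True c, x, y) \<notin> H"
        proof
          assume "(lit_tag True c, x, y) \<in> H"
          moreover have "var (lit_tag True c, x, y) = var (lit_tag s c, x, y)"
            by (simp add: var_def lit_tag_def)
          ultimately have "(lit_tag True c, x, y) = (lit_tag s c, x, y)"
            using inj *(2) by (meson inj_onD)
          then show False using False by (simp add: lit_tag_inject)
        qed
        then show ?thesis using False by (simp add: \<alpha>_def)
      qed (use * in \<open>simp add: \<alpha>_def\<close>)
      with * show ?thesis by blast
    qed
    then show "satisfiable D Fs" unfolding satisfiable_def by blast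
  next
    assume "satisfiable D Fs"
    then obtain \<alpha> where all: "\<forall>F\<in>set Fs. \<forall>(a, b)\<in>set (clause_loops D F).
      \<exists>(s, c, x, y)\<in>set (literals D F a b). \<alpha> (c, x, y) = s"
      unfolding satisfiable_def by (elim exE)
    have \<alpha>: "\<exists>(s, c, x, y)\<in>set (literals D F a b). \<alpha> (c, x, y) = s"
      if "F \<in> set Fs" "(a, b) \<in> set (clause_loops D F)" for F a b
      using bspec[OF bspec[OF all that(1)] that(2)] by simp
    define pick where "pick = (\<lambda>(c, x, y). (lit_tag (\<alpha> (c, x, y)) c, x :: nat, y :: nat))"
    let ?H = "pick ` ?V"
    have sub: "?H \<subseteq> grid D l l' (2 * C)"
      by (auto simp: grid_def pick_def lit_tag_less)
    have card: "card ?H \<le> length (D ! lb)"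
      using card_image_le[of ?V pick] card_V by (simp add: grid_def)
    have hit: "set (members D F a b) \<inter> ?H \<noteq> {}"
      if F: "F \<in> set (families l l' C Fs)" "(a, b) \<in> set (loops D F)" for F a b
      using F(1) unfolding families_def set_append Un_iff
    proof
      assume "F \<in> set (map (variable_family l l') [0..<C])"
      then obtain c where c: "c < C" "F = variable_family l l' c" by auto
      then have "(c, a, b) \<in> ?V" using F(2) by (auto simp: grid_def loops_variable_family set_indices)
      then have "pick (c, a, b) \<in> ?H" by blast
      moreover have "pick (c, a, b) \<in> set (members D F a b)"
        unfolding c(2) members_variable_family[OF assms(1)] by (cases "\<alpha> (c, a, b)") (simp_all add: pick_def)
      ultimately show ?thesis by blast
    next
      assume "F \<in> set (map family_of_clause Fs)"
      then obtain F' where F': "F' \<in> set Fs" "F = family_of_clause F'" by auto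
      have ab: "(a, b) \<in> set (clause_loops D F')" using F(2) F'(2) by (simp add: loops_family_of_clause)
      obtain s c x y where *: "(s, c, x, y) \<in> set (literals D F' a b)" "\<alpha> (c, x, y) = s"
        using \<alpha>[OF F'(1) ab] by blast
      have "pick (c, x, y) \<in> ?H" using grid[OF F'(1) ab *(1)] by blast
      moreover have "pick (c, x, y) \<in> set (members D F a b)"
        unfolding F'(2) members_family_of_clause using * by (force simp: pick_def)
      ultimately show ?thesis by blast
    qed
    show "\<exists>H \<subseteq> grid D l l' (2 * C). card H \<le> length (D ! lb) \<and>
       (\<forall>F\<in>set (families l l' C Fs). \<forall>(a, b)\<in>set (loops D F). set (members D F a b) \<inter> H \<noteq> {})"
    proof (intro exI conjI ballI)
      fix F p assume "F \<in> set (families l l' C Fs)" "p \<in> set (loops D F)"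
      then show "case p of (a, b) \<Rightarrow> set (members D F a b) \<inter> ?H \<noteq> {}"
        using hit[of F "fst p" "snd p"] by (simp only: prod.collapse case_prod_unfold not_False_eq_True)
    qed (rule sub card)+
  }
qed

text \<open>The length of tape \<open>lb\<close> has to be the exact number of variables. For
  \<open>lc\<close> an upper bound on the number of sets suffices, as it only widens the arcs into
  the destination.\<close>

theorem satisfiable_reducible:
  assumes gs: "wf_gens gs" "{l, l', lb, lc} \<subseteq> {2..<3 + length gs}" "l \<noteq> l'" "lc \<noteq> l" "lc \<noteq> l'"
    and wf: "\<And>F. F \<in> set Fs \<Longrightarrow> wf_clause_family (3 + length gs) F"
    and lits: "\<And>xs F a b. F \<in> set Fs \<Longrightarrow> (a, b) \<in> set (clause_loops (contents gs xs) F) \<Longrightarrow>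
      literals (contents gs xs) F a b \<noteq> [] \<and> distinct (literals (contents gs xs) F a b) \<and>
      (\<forall>(s, c, x, y)\<in>set (literals (contents gs xs) F a b). c < C \<and>
         x \<in> {1..length (contents gs xs ! l)} \<and> y \<in> {1..length (contents gs xs ! l')})"
    and bound: "\<And>xs. length (contents gs xs ! lb) = C * length (contents gs xs ! l) * length (contents gs xs ! l')"
    and cap: "\<And>xs. (\<Sum>F\<leftarrow>families l l' C Fs. length (loops (contents gs xs) F)) \<le> length (contents gs xs ! lc)"
  shows "polytime_reducible {xs. satisfiable (contents gs xs) Fs} vnf_placement"
proof -
  interpret hit_system gs l l' lb lc "2 * C" "families l l' C Fs"
  proof
    fix F assume "F \<in> set (families l l' C Fs)"
    then consider c where "F = variable_family l l' c" | F' where "F' \<in> set Fs" "F = family_of_clause F'"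
      by (auto simp: families_def)
    then show "wf_family (3 + length gs) F"
    proof cases
      case 1
      then show ?thesis using gs by (auto simp: variable_family_def)
    next
      case 2
      obtain l1 l2 L where "F' = (l1, l2, L)" by (cases F')
      with wf[OF 2(1)] 2(2) show ?thesis by fastforce
    qed
  qed (use gs in auto)
  have "satisfiable (contents gs xs) Fs \<longleftrightarrow> enc_instance (instance_of (contents gs xs)) \<in> vnf_placement" for xs
  proof -
    let ?D = "contents gs xs"
    have "enc_instance (instance_of ?D) \<in> vnf_placement \<longleftrightarrow> (\<exists>H\<subseteq>grid ?D l l' (2 * C). card H \<le> length (?D ! lb) \<and>
       (\<forall>F\<in>set (families l l' C Fs). \<forall>(a, b)\<in>set (loops ?D F). set (members ?D F a b) \<inter> H \<noteq> {}))"
    proof (rule placement_iff_hitting_set)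
      fix F a b assume F: "F \<in> set (families l l' C Fs)" "(a, b) \<in> set (loops ?D F)"
      then consider c where "c < C" "F = variable_family l l' c" | F' where "F' \<in> set Fs" "F = family_of_clause F'"
        by (auto simp: families_def)
      then show "members ?D F a b \<noteq> [] \<and> distinct (members ?D F a b) \<and> set (members ?D F a b) \<subseteq> grid ?D l l' (2 * C)"
      proof cases
        case 1
        have "(a, b) \<in> set (indices ?D l l')" using F(2) 1(2) by (simp add: loops_variable_family)
        then show ?thesis
          using 1 by (simp add: members_variable_family[OF gs(3)] lit_tag_inject grid_def lit_tag_less set_indices)
      next
        case 2
        have inj: "inj_on (\<lambda>(s, c, x, y). (lit_tag s c, x, y)) A" for A :: "(bool \<times> nat \<times> nat \<times> nat) set"
          by (auto simp: inj_on_def lit_tag_inject)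
        have "(a, b) \<in> set (clause_loops ?D F')" using F(2) 2(2) by (simp add: loops_family_of_clause)
        note * = lits[OF 2(1) this]
        have "distinct (map (\<lambda>(s, c, x, y). (lit_tag s c, x, y)) (literals ?D F' a b))"
          using * inj by (simp only: distinct_map simp_thms)
        moreover have "set (map (\<lambda>(s, c, x, y). (lit_tag s c, x, y)) (literals ?D F' a b)) \<subseteq> grid ?D l l' (2 * C)"
          using * by (auto simp: grid_def lit_tag_less simp del: atLeastAtMost_iff)
        ultimately show ?thesis
          unfolding 2(2) members_family_of_clause using * by simp
      qed
    next
      show "length (sets ?D) \<le> length (?D ! lc)" unfolding length_sets by (rule cap)
    qed
    also have "\<dots> \<longleftrightarrow> satisfiable ?D Fs"
      using gs(3) lits bound by (intro hitting_set_iff_satisfiable) (fastforce simp: grid_def)+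
    finally show ?thesis ..
  qed
  then show ?thesis
    unfolding polytime_reducible_def using polytime_instances by (intro exI conjI) auto
qed

section \<open>Tapes of polynomial length\<close>

definition counts :: "gen list \<Rightarrow> nat \<Rightarrow> (nat \<Rightarrow> nat) \<Rightarrow> bool" where
  "counts gs i f \<longleftrightarrow> i \<in> {2..<3 + length gs} \<and> (\<forall>xs. length (contents gs xs ! i) = f (length xs))"

lemma contents_append: "i < 3 + length gs \<Longrightarrow> contents (gs @ hs) xs ! i = contents gs xs ! i"
proof (induction hs rule: rev_induct)
  case (snoc h hs)
  then show ?case
    by (simp add: contents_snoc nth_append length_contents flip: append_assoc)
qed simp

lemma counts_append: "counts gs i f \<Longrightarrow> counts (gs @ hs) i f"
  by (auto simp: counts_def contents_append)

lemma contents_new: "contents (gs @ [g]) xs ! (3 + length gs) = den (contents gs xs) (\<lambda>_. 0) g"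
  by (simp add: contents_snoc nth_append length_contents)

definition sum_gen :: "nat list \<Rightarrow> nat \<Rightarrow> gen" where
  "sum_gen is k = gseq (map (\<lambda>i. For i (glit [True])) is @ [glit (replicate k True)])"

lemma length_concat_replicate: "length (concat (replicate n w)) = n * length w"
  by (induction n) simp_all

lemma sum_gen:
  assumes "wf_gens gs" "set is \<subseteq> {2..<3 + length gs}"
  shows "wf_gens (gs @ [sum_gen is k])"
    "length (contents (gs @ [sum_gen is k]) xs ! (3 + length gs)) = (\<Sum>i\<leftarrow>is. length (contents gs xs ! i)) + k"
proof -
  show "wf_gens (gs @ [sum_gen is k])"
    using assms by (auto simp: wf_gens_snoc sum_gen_def wf_gseq wf_glit parked_glit)
  show "length (contents (gs @ [sum_gen is k]) xs ! (3 + length gs)) = (\<Sum>i\<leftarrow>is. length (contents gs xs ! i)) + k"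
    unfolding contents_new
    by (simp add: sum_gen_def den_gseq den_glit den_For_glit length_concat length_concat_replicate comp_def
        del: den.simps(5))
qed

lemma length_den_For2:
  assumes "i \<noteq> j"
  shows "length (den D e (For i (For j (glit w)))) = length (D ! i) * (length (D ! j) * length w)"
  by (simp add: den_glit length_concat comp_def sum_list_triv del: upt_Suc)

text \<open>The condition \<open>i \<noteq> j\<close> records that tape \<open>j\<close> is fresh;
  this is the source of the distinctness that nested loops demand of their tapes.\<close>

definition extends :: "gen list \<Rightarrow> gen list \<Rightarrow> nat \<Rightarrow> bool" where
  "extends gs gs' j \<longleftrightarrow> wf_gens gs' \<and> (\<forall>i f. counts gs i f \<longrightarrow> counts gs' i f \<and> i \<noteq> j)"

lemma extendsI: "wf_gens (gs @ hs) \<Longrightarrow> 3 + length gs \<le> j \<Longrightarrow> extends gs (gs @ hs) j"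
  unfolding extends_def using counts_append[of gs _ _ hs] by (auto simp: counts_def)

lemma ex_sum_tape:
  assumes "wf_gens gs" "\<forall>(i, f)\<in>set ps. counts gs i f" "\<forall>n. (\<Sum>(i, f)\<leftarrow>ps. f n) + k = g n"
  shows "\<exists>gs' j. extends gs gs' j \<and> counts gs' j g"
proof -
  let ?is = "map fst ps"
  have sub: "set ?is \<subseteq> {2..<3 + length gs}" and
    sum: "(\<Sum>i\<leftarrow>?is. length (contents gs xs ! i)) = (\<Sum>(i, f)\<leftarrow>ps. f (length xs))" for xs
    using assms(2) by (induction ps) (auto simp: counts_def)
  have "extends gs (gs @ [sum_gen ?is k]) (3 + length gs)"
    using sum_gen(1)[OF assms(1) sub] by (rule extendsI) simp
  moreover have "counts (gs @ [sum_gen ?is k]) (3 + length gs) g"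
    using sum_gen(2)[OF assms(1) sub] sum assms(3) by (simp add: counts_def)
  ultimately show ?thesis by blast
qed

text \<open>A specification \<open>(ps, k, g)\<close> asks for a tape whose length is the sum of the
  lengths of the tapes in \<open>ps\<close> plus \<open>k\<close>. Equal specifications yield
  different tapes, which provides independent counters with the same range.\<close>

lemma ex_sum_tapes:
  assumes "wf_gens gs"
    "\<forall>(ps, k, g)\<in>set specs. (\<forall>(i, f)\<in>set ps. counts gs i f) \<and> (\<forall>n. (\<Sum>(i, f)\<leftarrow>ps. f n) + k = g n)"
  shows "\<exists>gs' js. wf_gens gs' \<and> (\<forall>i f. counts gs i f \<longrightarrow> counts gs' i f \<and> i \<notin> set js) \<and> distinct js \<and>
    list_all2 (counts gs') js (map (\<lambda>(ps, k, g). g) specs)"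
  using assms(2)
proof (induction specs)
  case Nil
  show ?case using assms(1) by (intro exI[of _ gs] exI[of _ "[]"]) simp
next
  case (Cons spec specs)
  then obtain gs1 js where IH: "wf_gens gs1" "\<forall>i f. counts gs i f \<longrightarrow> counts gs1 i f \<and> i \<notin> set js" "distinct js"
    "list_all2 (counts gs1) js (map (\<lambda>(ps, k, g). g) specs)" by auto
  obtain ps k g where spec: "spec = (ps, k, g)" by (cases spec)
  have "\<forall>(i, f)\<in>set ps. counts gs1 i f" "\<forall>n. (\<Sum>(i, f)\<leftarrow>ps. f n) + k = g n"
    using Cons.prems IH(2) by (auto simp: spec)
  from ex_sum_tape[OF IH(1) this] obtain gs' j where
    gs': "wf_gens gs'" "\<forall>i f. counts gs1 i f \<longrightarrow> counts gs' i f \<and> i \<noteq> j" "counts gs' j g"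
    unfolding extends_def by blast
  have "list_all2 (counts gs') js (map (\<lambda>(ps, k, g). g) specs)"
    using IH(4) gs'(2) by (auto elim: list_all2_mono)
  moreover have "j \<notin> set js"
    using IH(4) gs'(2) by (force simp: list_all2_conv_all_nth in_set_conv_nth)
  moreover have "counts gs' i f \<and> i \<notin> set (j # js)" if "counts gs i f" for i f
  proof -
    have "counts gs1 i f" "i \<notin> set js" using IH(2) that by blast+
    moreover from this have "counts gs' i f" "i \<noteq> j" using gs'(2) by blast+
    ultimately show ?thesis by simp
  qed
  ultimately show ?case
    using IH(3) gs'(1,3) by (intro exI[of _ gs'] exI[of _ "j # js"]) (simp add: spec)
qed

text \<open>Horner's scheme with one tape per coefficient: \<open>pCons a q\<close> is written as
  \<open>a\<close> symbols followed by a nested loop over tape \<open>i\<close> and the tape for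
  \<open>q\<close>. The latter lies beyond all tapes of \<open>gs\<close>, so the two loops use
  different tapes.\<close>

lemma ex_poly_tape:
  assumes "wf_gens gs" "counts gs i f"
  shows "\<exists>gs' j. extends gs gs' j \<and> counts gs' j (\<lambda>n. poly q (f n))"
proof -
  have "\<exists>hs j. wf_gens (gs @ hs) \<and> 3 + length gs \<le> j \<and> counts (gs @ hs) j (\<lambda>n. poly q (f n))"
  proof (induction q)
    case 0
    have "wf_gens (gs @ [sum_gen [] 0])" "counts (gs @ [sum_gen [] 0]) (3 + length gs) (\<lambda>_. 0)"
      using sum_gen[OF assms(1), of "[]" 0] by (simp_all add: counts_def)
    then show ?case by (intro exI[of _ "[sum_gen [] 0]"] exI[of _ "3 + length gs"]) simp
  next
    case (pCons a q)
    then obtain hs j where hs: "wf_gens (gs @ hs)" "3 + length gs \<le> j" "counts (gs @ hs) j (\<lambda>n. poly q (f n))"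
      by blast
    let ?g = "gseq [glit (replicate a True), For i (For j (glit [True]))]"
    let ?n = "3 + length (gs @ hs)"
    have i: "i \<noteq> j" "i \<in> {2..<?n}" "j \<in> {2..<?n}" using assms(2) hs(2,3) by (auto simp: counts_def)
    have "wf_gens ((gs @ hs) @ [?g])"
      unfolding wf_gens_snoc using hs(1) i by (simp add: wf_gseq wf_glit parked_glit)
    moreover have "length (contents ((gs @ hs) @ [?g]) xs ! ?n) = poly (pCons a q) (f (length xs))" for xs
    proof -
      have "length (contents (gs @ hs) xs ! i) = f (length xs)" "length (contents (gs @ hs) xs ! j) = poly q (f (length xs))"
        using counts_append[OF assms(2), of hs] hs(3) by (simp_all add: counts_def)
      then show ?thesis
        unfolding contents_new using length_den_For2[OF i(1), of "contents (gs @ hs) xs" "\<lambda>_. 0" "[True]"]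
        by (simp add: den_gseq den_glit del: den.simps(5))
    qed
    then have "counts ((gs @ hs) @ [?g]) ?n (\<lambda>n. poly (pCons a q) (f n))"
      by (simp add: counts_def)
    ultimately show ?case
      by (intro exI[of _ "hs @ [?g]"] exI[of _ ?n]) (simp add: append_assoc)
  qed
  then show ?thesis using extendsI by blast
qed

lemma counts_input: "counts gs 2 (\<lambda>n. n)" "contents gs xs ! 2 = xs"
proof -
  show 2: "contents gs xs ! 2 = xs" for xs
    using contents_append[of 2 "[]" gs xs] by (simp add: contents_Nil)
  show "counts gs 2 (\<lambda>n. n)" by (simp add: counts_def 2)
qed

text \<open>\<open>2 * n + 1 + poly p n\<close> is the length of the verifier's input for a longest
  witness, and \<open>poly r\<close> of it is its running time T. Tapes \<open>tl\<close>,
  \<open>zl\<close> and \<open>zb\<close> are copies of length T; \<open>t1\<close> counts the times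
  0 to T, and \<open>w\<close> covers all cell coordinates that occur in clauses, with some room for
  their offsets. The tapes of length 1 serve families that need no real loop.\<close>

lemma ex_tapes:
  fixes p r :: "nat poly"
  obtains gs ip tl zl zb t1 w one one2 where
    "wf_gens gs" "distinct [2, ip, tl, zl, zb, t1, w, one, one2]"
    "counts gs ip (poly p)"
    "counts gs tl (\<lambda>n. poly r (2 * n + 1 + poly p n))"
    "counts gs zl (\<lambda>n. poly r (2 * n + 1 + poly p n))"
    "counts gs zb (\<lambda>n. poly r (2 * n + 1 + poly p n))"
    "counts gs t1 (\<lambda>n. poly r (2 * n + 1 + poly p n) + 1)"
    "counts gs w (\<lambda>n. 2 * poly r (2 * n + 1 + poly p n) + 2 * n + poly p n + 5)"
    "counts gs one (\<lambda>_. 1)" "counts gs one2 (\<lambda>_. 1)"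
proof -
  let ?M = "\<lambda>n. 2 * n + 1 + poly p n"
  let ?T = "\<lambda>n. poly r (?M n)" and ?W = "\<lambda>n. 2 * poly r (2 * n + 1 + poly p n) + 2 * n + poly p n + 5"
  have wf: "wf_gens gs'" and old: "counts gs i f \<Longrightarrow> counts gs' i f \<and> i \<noteq> j"
    if "extends gs gs' j" for gs gs' i j f
    using that by (simp_all add: extends_def)
  have "wf_gens []" by (simp add: wf_gens_def)
  from ex_poly_tape[OF this counts_input(1), of p] obtain g1 ip where
    1: "extends [] g1 ip" "counts g1 ip (poly p)" by blast
  have "\<forall>(i, f)\<in>set [(2, \<lambda>n. n), (2, \<lambda>n. n), (ip, poly p)]. counts g1 i f"
    using 1(2) counts_input(1) by simp
  from ex_sum_tape[OF wf[OF 1(1)] this, of 1 ?M] obtain g2 m where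
    2: "extends g1 g2 m" "counts g2 m ?M" by auto
  obtain g3 tl where 3: "extends g2 g3 tl" "counts g3 tl ?T"
    using ex_poly_tape[OF wf[OF 2(1)] 2(2), of r] by blast
  have ip: "counts g3 ip (poly p)" "ip \<noteq> tl" "2 \<noteq> ip" "2 \<noteq> tl"
    using old[OF 3(1)] old[OF 2(1) 1(2)] old[OF 1(1) counts_input(1)] counts_input(1) by blast+
  let ?specs = "[([(tl, ?T)], 0, ?T), ([(tl, ?T)], 0, ?T), ([(tl, ?T)], 1, \<lambda>n. ?T n + 1),
    ([(tl, ?T), (tl, ?T), (2, \<lambda>n. n), (2, \<lambda>n. n), (ip, poly p)], 5 :: nat, ?W), ([], 1, \<lambda>_. 1), ([], 1, \<lambda>_. 1)]"
  have "\<forall>(ps, k, g)\<in>set ?specs. (\<forall>(i, f)\<in>set ps. counts g3 i f) \<and> (\<forall>n. (\<Sum>(i, f)\<leftarrow>ps. f n) + k = g n)"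
    using 3(2) ip(1) counts_input(1)[of g3] by simp
  from ex_sum_tapes[OF wf[OF 3(1)] this] obtain gs js where
    gs: "wf_gens gs" "\<forall>i f. counts g3 i f \<longrightarrow> counts gs i f \<and> i \<notin> set js" "distinct js" and
    js: "list_all2 (counts gs) js (map (\<lambda>(ps, k, g). g) ?specs)" by (elim exE conjE)
  from js obtain zl zb t1 w one one2 where "js = [zl, zb, t1, w, one, one2]"
    and "counts gs zl ?T" "counts gs zb ?T" "counts gs t1 (\<lambda>n. ?T n + 1)" "counts gs w ?W"
    "counts gs one (\<lambda>_. 1)" "counts gs one2 (\<lambda>_. 1)"
    by (auto simp: list_all2_Cons2)
  moreover have "counts gs ip (poly p) \<and> ip \<notin> set js" "counts gs tl ?T \<and> tl \<notin> set js" "2 \<notin> set js"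
    using gs(2) ip(1) 3(2) counts_input(1) by blast+
  ultimately show ?thesis
    using that[of gs ip tl zl zb t1 w one one2] gs(1,3) ip(2-4) by simp
qed

section \<open>Configurations relative to the head\<close>

definition content :: "tape \<Rightarrow> int \<Rightarrow> nat" where
  "content t i = fst t (snd t + i)"

text \<open>The transition function with the halting state turned into idling, so that the clauses
  for a step need no exception for halted configurations.\<close>

definition outcome :: "tm \<Rightarrow> nat \<Rightarrow> nat list \<Rightarrow> nat \<times> (nat \<times> dir) list" where
  "outcome M q rs = (if q = 1 then (1, map (\<lambda>a. (a, Stay)) rs) else delta M q rs)"

definition wf_config :: "tm \<Rightarrow> config \<Rightarrow> bool" where
  "wf_config M cf \<longleftrightarrow> fst cf < nstates M \<and> length (snd cf) = ntapes M \<and>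
     (\<forall>t\<in>set (snd cf). \<forall>i. fst t i < nsyms M)"

lemma content_0: "content t 0 = scan t"
  by (simp add: content_def scan_def)

lemma content_act:
  "content (act t a) i = (if i + offset (snd a) = 0 then fst a else content t (i + offset (snd a)))"
  by (auto simp: content_def act_def algebra_simps)

lemma outcome_wf:
  assumes "wf_tm M" "q < nstates M" "length rs = ntapes M" "set rs \<subseteq> {..<nsyms M}"
  shows "fst (outcome M q rs) < nstates M" "length (snd (outcome M q rs)) = ntapes M"
    "fst ` set (snd (outcome M q rs)) \<subseteq> {..<nsyms M}"
  using assms by (auto simp: outcome_def wf_tm_def)

lemma tm_step_outcome:
  assumes "length (snd cf) = ntapes M"
  shows "tm_step M cf = (fst (outcome M (fst cf) (map scan (snd cf))),
    map2 act (snd cf) (snd (outcome M (fst cf) (map scan (snd cf)))))"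
proof (cases "fst cf = 1")
  case True
  have "map2 act ts (map (\<lambda>a. (a, Stay)) (map scan ts)) = ts" for ts
    by (induction ts) (simp_all add: act_stay)
  then show ?thesis using True by (cases cf) (simp add: tm_step_def outcome_def comp_def)
qed (simp add: tm_step_def outcome_def Let_def)

lemma set_scan: "wf_config M cf \<Longrightarrow> set (map scan (snd cf)) \<subseteq> {..<nsyms M}"
  by (auto simp: wf_config_def scan_def)

lemma wf_config_step:
  assumes "wf_tm M" "wf_config M cf"
  shows "wf_config M (tm_step M cf)"
proof -
  let ?r = "outcome M (fst cf) (map scan (snd cf))"
  have r: "fst ?r < nstates M" "length (snd ?r) = ntapes M" "fst ` set (snd ?r) \<subseteq> {..<nsyms M}"
    using assms(2) outcome_wf[OF assms(1) _ _ set_scan[OF assms(2)], of "fst cf"]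
    by (simp_all add: wf_config_def)
  have "fst u i < nsyms M" if u: "u \<in> set (map2 act (snd cf) (snd ?r))" for u i
  proof -
    obtain t a where ta: "(t, a) \<in> set (zip (snd cf) (snd ?r))" "u = act t a" using u by auto
    have "fst a < nsyms M" using set_zip_rightD[OF ta(1)] r(3) by blast
    moreover have "fst t i < nsyms M"
      using set_zip_leftD[OF ta(1)] assms(2) by (simp add: wf_config_def)
    ultimately show ?thesis by (simp add: ta(2) act_def)
  qed
  then show ?thesis
    using assms(2) r tm_step_outcome[of cf M] by (simp add: wf_config_def)
qed

lemma wf_config_init: "wf_tm M \<Longrightarrow> wf_config M (init_config M ys)"
  by (auto simp: wf_config_def wf_tm_def init_config_def input_tape_def bit_sym_def)

lemma wf_config_steps: "wf_tm M \<Longrightarrow> wf_config M ((tm_step M ^^ t) (init_config M ys))"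
  by (induction t) (simp_all add: wf_config_init wf_config_step)

section \<open>The tableau of a computation\<close>

definition holds :: "(nat \<times> nat \<times> nat \<Rightarrow> bool) \<Rightarrow> bool list list \<Rightarrow> clause_family \<Rightarrow> bool" where
  "holds \<alpha> D F \<longleftrightarrow> (\<forall>(a, b)\<in>set (clause_loops D F). \<exists>(s, c, x, y)\<in>set (literals D F a b). \<alpha> (c, x, y) = s)"

lemma satisfiable_iff: "satisfiable D Fs \<longleftrightarrow> (\<exists>\<alpha>. \<forall>F\<in>set Fs. holds \<alpha> D F)"
  by (simp add: satisfiable_def holds_def)

lemma holds_iff: "holds \<alpha> D (l1, l2, L) \<longleftrightarrow>
    (\<forall>a\<in>{1..length (D ! l1)}. \<forall>b\<in>{1..length (D ! l2)}. \<exists>(s, c, x, y)\<in>set (L (bit_at D l1 a)).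
       \<alpha> (c, cval D ((\<lambda>_. 0)(l1 := a, l2 := b)) x, cval D ((\<lambda>_. 0)(l1 := a, l2 := b)) y) = s)"
  by (simp add: holds_def clause_loops_def set_indices case_prod_unfold)

text \<open>How the coordinate of a cell changes with a move of the head, plus one to stay within the naturals.\<close>

fun drift :: "dir \<Rightarrow> nat" where
  "drift ToLeft = 2"
| "drift Stay = 1"
| "drift ToRight = 0"

lemma int_drift: "int (drift d) = 1 - offset d"
  by (cases d) auto

text \<open>
  Time \<open>t\<close> has coordinate \<open>t + 1\<close>. Cells are numbered relative to the head, which thus always has
  the same second coordinate, the length of tape \<open>zb\<close> plus 2. The second coordinate of a state is 1.
  All clauses but the rejecting one force a variable to be true, so that there is no need to exclude that
  a cell has several symbols.
\<close>

locale tableau =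
  fixes M :: tm and x ip tl zl zb t1 w one one2 :: nat
  assumes wf_M: "wf_tm M"
    and dist: "distinct [x, ip, tl, zl, zb, t1, w, one, one2]"
begin

abbreviation "K \<equiv> ntapes M"
abbreviation "S \<equiv> nsyms M"
abbreviation "Q \<equiv> nstates M"

text \<open>With T the length of tape \<open>zb\<close>, variable \<open>St q\<close> at (\<tau>, 1)
  says that the state at time \<tau> - 1 is \<open>q\<close>; variable \<open>Ce k a\<close> at
  (\<tau>, j) says that at this time tape \<open>k\<close> has symbol \<open>a\<close> in the cell j
  - T - 2 relative to the head.\<close>

definition St :: "nat \<Rightarrow> nat" where "St q = q"
definition Ce :: "nat \<Rightarrow> nat \<Rightarrow> nat" where "Ce k a = Q + k * S + a"
definition vars :: nat where "vars = Q + K * S"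

definition centre :: coord where "centre = ([], [zb], 2)"

text \<open>Tape 0 starts with the code of the input: each bit is preceded by symbol 2, and symbol 1
  ends the code. Only the \<open>ip\<close> cells behind it are free: each is blank or a bit, and a
  blank is followed by a blank, which describes exactly the witnesses of bounded length. Further
  cells on both sides are blank as far as the head can travel, and so are the other tapes.\<close>

definition init_clauses :: "clause_family list" where
  "init_clauses = [
     (one, one2, \<lambda>_. [(True, St 0, const 1, const 1)]),
     (x, one, \<lambda>_. [(True, Ce 0 2, const 1, ([x, x], [zb], 0))]),
     (x, one, \<lambda>\<beta>. [(True, Ce 0 (bit_sym \<beta>), const 1, ([x, x], [zb], 1))]),
     (one, one2, \<lambda>_. [(True, Ce 0 1, const 1, ([], [x, x, zb], 2))]),
     (ip, one, \<lambda>_. [(True, Ce 0 0, const 1, ([ip], [x, x, zb], 2)),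
        (True, Ce 0 1, const 1, ([ip], [x, x, zb], 2)), (True, Ce 0 2, const 1, ([ip], [x, x, zb], 2))]),
     (ip, one, \<lambda>_. [(False, Ce 0 0, const 1, ([ip], [x, x, zb], 2)), (True, Ce 0 0, const 1, ([ip], [x, x, zb], 3))]),
     (zl, one, \<lambda>_. [(True, Ce 0 0, const 1, ([zl], [x, x, zb, ip], 2))]),
     (zl, one, \<lambda>_. [(True, Ce 0 0, const 1, ([zl], [], 1))])] @
     map (\<lambda>k. (w, one, \<lambda>_. [(True, Ce k 0, const 1, here w)])) [1..<K]"

text \<open>The answer stands under the head of tape 0, where symbol 1 means \<open>False\<close>;
  the clause forbids it after T steps.\<close>

definition reject_clause :: clause_family where
  "reject_clause = (one, one2, \<lambda>_. [(False, Ce 0 1, ([], [zb], 1), centre)])"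

text \<open>The negated premise of an implication: the machine is in state \<open>q\<close> and
  scans \<open>rs\<close> at the time counted by \<open>tl\<close>.\<close>

definition guard_lits :: "nat \<Rightarrow> nat list \<Rightarrow> (bool \<times> nat \<times> coord \<times> coord) list" where
  "guard_lits q rs = (False, St q, here tl, const 1) # map (\<lambda>k. (False, Ce k (rs ! k), here tl, centre)) [0..<K]"

text \<open>A move renumbers the cells, which is the shift by \<open>drift\<close>. The cell under
  the head receives the written symbol; the cells left of it (coordinates 2 to T + 1) and right of
  it (from T + 3 on) are copied. Coordinate T + 2 is omitted since its old symbol is
  overwritten.\<close>

definition move_clauses :: "nat \<Rightarrow> nat list \<Rightarrow> nat \<Rightarrow> nat \<times> dir \<Rightarrow> clause_family list" where
  "move_clauses q rs k m =
     (tl, one, \<lambda>_. guard_lits q rs @ [(True, Ce k (fst m), ([tl], [], 1), ([], [zb], 1 + drift (snd m)))]) #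
     concat (map (\<lambda>a. [
       (tl, zl, \<lambda>_. guard_lits q rs @ [(False, Ce k a, here tl, ([zl], [], 1)),
          (True, Ce k a, ([tl], [], 1), ([zl], [], drift (snd m)))]),
       (tl, zl, \<lambda>_. guard_lits q rs @ [(False, Ce k a, here tl, ([zl], [zb], 2)),
          (True, Ce k a, ([tl], [], 1), ([zl], [zb], 1 + drift (snd m)))])]) [0..<S])"

definition step_clauses :: "nat \<Rightarrow> nat list \<Rightarrow> clause_family list" where
  "step_clauses q rs =
     (tl, one, \<lambda>_. guard_lits q rs @ [(True, St (fst (outcome M q rs)), ([tl], [], 1), const 1)]) #
     concat (map (\<lambda>k. move_clauses q rs k (snd (outcome M q rs) ! k)) [0..<K])"

definition clauses :: "clause_family list" where
  "clauses = init_clauses @ [reject_clause] @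
     concat (map (\<lambda>q. concat (map (step_clauses q) (List.n_lists K [0..<S]))) [0..<Q])"

lemma wf_clauses:
  assumes "{x, ip, tl, zl, zb, t1, w, one, one2} \<subseteq> {2..<n}" "F \<in> set clauses"
  shows "wf_clause_family n F"
proof -
  have "wf_clause_family n F" if "F \<in> set init_clauses"
    using that assms(1) dist by (auto simp: init_clauses_def)
  moreover have "wf_clause_family n reject_clause"
    using assms(1) dist by (auto simp: reject_clause_def centre_def)
  moreover have "wf_clause_family n F" if "F \<in> set (step_clauses q rs)" for q rs
    using that assms(1) dist
    by (auto simp: step_clauses_def move_clauses_def guard_lits_def centre_def)
  ultimately show ?thesis using assms(2) by (auto simp: clauses_def)
qed

lemma S_K_Q: "3 \<le> S" "1 \<le> K" "2 \<le> Q"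
  using wf_M by (auto simp: wf_tm_def)

lemma Ce_inject: "a < S \<Longrightarrow> a' < S \<Longrightarrow> Ce k a = Ce k' a' \<longleftrightarrow> k = k' \<and> a = a'"
proof -
  assume a: "a < S" "a' < S"
  have "k = (k * S + a) div S" "k' = (k' * S + a') div S"
    using a by (simp_all add: div_mult_self3)
  then show ?thesis unfolding Ce_def by (metis add.assoc add_left_cancel)
qed

lemma St_neq_Ce: "q < Q \<Longrightarrow> St q \<noteq> Ce k a"
  by (simp add: St_def Ce_def)

lemma St_less: "q < Q \<Longrightarrow> St q < vars"
  by (simp add: St_def vars_def)

lemma Ce_less: "k < K \<Longrightarrow> a < S \<Longrightarrow> Ce k a < vars"
proof -
  assume "k < K" "a < S"
  then have "k * S + a < Suc k * S" by simp
  also have "\<dots> \<le> K * S" using \<open>k < K\<close> by (intro mult_le_mono1) simp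
  finally show ?thesis by (simp add: Ce_def vars_def)
qed

end

section \<open>Meaning of the clauses for a given input\<close>

locale tableau_at = tableau +
  fixes D :: "bool list list" and xs :: "bool list" and P T :: nat
  assumes D: "D ! x = xs" "length (D ! ip) = P" "length (D ! tl) = T" "length (D ! zl) = T"
    "length (D ! zb) = T" "length (D ! t1) = T + 1" "length (D ! w) = 2 * T + 2 * length xs + P + 5"
    "length (D ! one) = 1" "length (D ! one2) = 1"
begin

abbreviation "n \<equiv> length xs"

definition guard :: "(nat \<times> nat \<times> nat \<Rightarrow> bool) \<Rightarrow> nat \<Rightarrow> nat list \<Rightarrow> nat \<Rightarrow> bool" where
  "guard \<alpha> q rs \<tau> \<longleftrightarrow> \<alpha> (St q, \<tau>, 1) \<and> (\<forall>k<K. \<alpha> (Ce k (rs ! k), \<tau>, T + 2))"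

lemma dist': "distinct [one2, one, w, t1, zb, zl, tl, ip, x]"
  using dist by auto

text \<open>The disjunction of the guard literals is the negation of \<open>guard\<close>, so a
  clause that starts with them is an implication.\<close>

lemma holds_guarded:
  assumes "l2 \<noteq> tl"
  shows "holds \<alpha> D (tl, l2, \<lambda>_. guard_lits q rs @ ls) \<longleftrightarrow>
    (\<forall>\<tau>\<in>{1..T}. \<forall>b\<in>{1..length (D ! l2)}. guard \<alpha> q rs \<tau> \<longrightarrow> (\<exists>(s, c, y, z)\<in>set ls.
       \<alpha> (c, cval D ((\<lambda>_. 0)(tl := \<tau>, l2 := b)) y, cval D ((\<lambda>_. 0)(tl := \<tau>, l2 := b)) z) = s))"
proof -
  have *: "(\<exists>(s, c, y, z)\<in>set (guard_lits q rs). \<alpha> (c, cval D ((\<lambda>_. 0)(tl := \<tau>, l2 := b)) y,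
      cval D ((\<lambda>_. 0)(tl := \<tau>, l2 := b)) z) = s) \<longleftrightarrow> \<not> guard \<alpha> q rs \<tau>" for \<tau> b
    using assms by (auto simp: guard_lits_def guard_def centre_def D)
  show ?thesis
    unfolding holds_iff set_append bex_Un D(3) * imp_conv_disj by (rule refl)
qed

definition initialises :: "(nat \<times> nat \<times> nat \<Rightarrow> bool) \<Rightarrow> bool" where
  "initialises \<alpha> \<longleftrightarrow> \<alpha> (St 0, 1, 1) \<and>
     (\<forall>v\<in>{1..n}. \<alpha> (Ce 0 2, 1, 2 * v + T) \<and> \<alpha> (Ce 0 (bit_sym (xs ! (v - 1))), 1, 2 * v + T + 1)) \<and>
     \<alpha> (Ce 0 1, 1, 2 * n + T + 2) \<and>
     (\<forall>v\<in>{1..P}. (\<alpha> (Ce 0 0, 1, v + 2 * n + T + 2) \<or> \<alpha> (Ce 0 1, 1, v + 2 * n + T + 2) \<or>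
        \<alpha> (Ce 0 2, 1, v + 2 * n + T + 2)) \<and>
        (\<alpha> (Ce 0 0, 1, v + 2 * n + T + 2) \<longrightarrow> \<alpha> (Ce 0 0, 1, v + 2 * n + T + 3))) \<and>
     (\<forall>v\<in>{1..T}. \<alpha> (Ce 0 0, 1, v + 2 * n + T + P + 2) \<and> \<alpha> (Ce 0 0, 1, v + 1)) \<and>
     (\<forall>k\<in>{1..<K}. \<forall>v\<in>{1..2 * T + 2 * n + P + 5}. \<alpha> (Ce k 0, 1, v))"

lemma holds_init_clauses: "(\<forall>F\<in>set init_clauses. holds \<alpha> D F) \<longleftrightarrow> initialises \<alpha>"
proof -
  have "bit_at D x v = xs ! (v - 1)" if "v \<in> {1..n}" for v
    using that by (auto simp: bit_at_def D)
  then show ?thesis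
    using dist dist'
    unfolding init_clauses_def initialises_def
    by (simp add: holds_iff D) (simp only: ac_simps mult_2 mult_2_right ball_conj_distrib)
qed

definition moves :: "(nat \<times> nat \<times> nat \<Rightarrow> bool) \<Rightarrow> nat \<Rightarrow> nat \<Rightarrow> nat \<Rightarrow> nat \<Rightarrow> bool" where
  "moves \<alpha> k b d \<tau> \<longleftrightarrow> \<alpha> (Ce k b, \<tau> + 1, T + 1 + d) \<and>
     (\<forall>a<S. \<forall>i\<in>{1..T}.
        (\<alpha> (Ce k a, \<tau>, i + 1) \<longrightarrow> \<alpha> (Ce k a, \<tau> + 1, i + d)) \<and>
        (\<alpha> (Ce k a, \<tau>, i + T + 2) \<longrightarrow> \<alpha> (Ce k a, \<tau> + 1, i + T + 1 + d)))"

definition continues :: "(nat \<times> nat \<times> nat \<Rightarrow> bool) \<Rightarrow> nat \<Rightarrow> nat list \<Rightarrow> nat \<Rightarrow> bool" where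
  "continues \<alpha> q rs \<tau> \<longleftrightarrow> \<alpha> (St (fst (outcome M q rs)), \<tau> + 1, 1) \<and>
     (\<forall>k<K. moves \<alpha> k (fst (snd (outcome M q rs) ! k)) (drift (snd (snd (outcome M q rs) ! k))) \<tau>)"

lemma holds_step_clauses:
  "(\<forall>F\<in>set (step_clauses q rs). holds \<alpha> D F) \<longleftrightarrow> (\<forall>\<tau>\<in>{1..T}. guard \<alpha> q rs \<tau> \<longrightarrow> continues \<alpha> q rs \<tau>)"
proof -
  have ne: "one \<noteq> tl" "zl \<noteq> tl" "tl \<noteq> one" "tl \<noteq> zl" using dist by auto
  have 1: "holds \<alpha> D (tl, one, \<lambda>_. guard_lits q rs @ [(True, St (fst (outcome M q rs)), ([tl], [], 1), const 1)]) \<longleftrightarrow>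
      (\<forall>\<tau>\<in>{1..T}. guard \<alpha> q rs \<tau> \<longrightarrow> \<alpha> (St (fst (outcome M q rs)), \<tau> + 1, 1))"
    using ne by (simp add: holds_guarded[OF ne(1)] D)
  have 2: "(\<forall>F\<in>set (move_clauses q rs k m). holds \<alpha> D F) \<longleftrightarrow>
      (\<forall>\<tau>\<in>{1..T}. guard \<alpha> q rs \<tau> \<longrightarrow> moves \<alpha> k (fst m) (drift (snd m)) \<tau>)" for k m
  proof -
    have a: "holds \<alpha> D (tl, one, \<lambda>_. guard_lits q rs @ [(True, Ce k (fst m), ([tl], [], 1), ([], [zb], 1 + drift (snd m)))]) \<longleftrightarrow>
        (\<forall>\<tau>\<in>{1..T}. guard \<alpha> q rs \<tau> \<longrightarrow> \<alpha> (Ce k (fst m), \<tau> + 1, T + 1 + drift (snd m)))"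
      using ne by (simp add: holds_guarded[OF ne(1)] D)
    have b: "holds \<alpha> D (tl, zl, \<lambda>_. guard_lits q rs @ [(False, Ce k a, here tl, ([zl], [], 1)),
          (True, Ce k a, ([tl], [], 1), ([zl], [], drift (snd m)))]) \<longleftrightarrow>
        (\<forall>\<tau>\<in>{1..T}. \<forall>i\<in>{1..T}. guard \<alpha> q rs \<tau> \<longrightarrow> \<alpha> (Ce k a, \<tau>, i + 1) \<longrightarrow> \<alpha> (Ce k a, \<tau> + 1, i + drift (snd m)))" for a
      using ne by (simp add: holds_guarded[OF ne(2)] D imp_conv_disj[symmetric] de_Morgan_disj[symmetric])
    have c: "holds \<alpha> D (tl, zl, \<lambda>_. guard_lits q rs @ [(False, Ce k a, here tl, ([zl], [zb], 2)),
          (True, Ce k a, ([tl], [], 1), ([zl], [zb], 1 + drift (snd m)))]) \<longleftrightarrow>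
        (\<forall>\<tau>\<in>{1..T}. \<forall>i\<in>{1..T}. guard \<alpha> q rs \<tau> \<longrightarrow> \<alpha> (Ce k a, \<tau>, i + T + 2) \<longrightarrow>
           \<alpha> (Ce k a, \<tau> + 1, i + T + 1 + drift (snd m)))" for a
      using ne by (simp add: holds_guarded[OF ne(2)] D add.assoc)
    have "(\<forall>F\<in>set (move_clauses q rs k m). holds \<alpha> D F) \<longleftrightarrow>
        holds \<alpha> D (tl, one, \<lambda>_. guard_lits q rs @ [(True, Ce k (fst m), ([tl], [], 1), ([], [zb], 1 + drift (snd m)))]) \<and>
        (\<forall>a<S. holds \<alpha> D (tl, zl, \<lambda>_. guard_lits q rs @ [(False, Ce k a, here tl, ([zl], [], 1)),
            (True, Ce k a, ([tl], [], 1), ([zl], [], drift (snd m)))]) \<and>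
          holds \<alpha> D (tl, zl, \<lambda>_. guard_lits q rs @ [(False, Ce k a, here tl, ([zl], [zb], 2)),
            (True, Ce k a, ([tl], [], 1), ([zl], [zb], 1 + drift (snd m)))]))"
      by (auto simp: move_clauses_def)
    then show ?thesis unfolding a b c moves_def by blast
  qed
  have "(\<forall>F\<in>set (step_clauses q rs). holds \<alpha> D F) \<longleftrightarrow>
      (\<forall>\<tau>\<in>{1..T}. guard \<alpha> q rs \<tau> \<longrightarrow> \<alpha> (St (fst (outcome M q rs)), \<tau> + 1, 1)) \<and>
      (\<forall>k<K. \<forall>F\<in>set (move_clauses q rs k (snd (outcome M q rs) ! k)). holds \<alpha> D F)"
    unfolding step_clauses_def 1[symmetric] by auto
  then show ?thesis
    unfolding continues_def 2 by blast
qed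

definition solves :: "(nat \<times> nat \<times> nat \<Rightarrow> bool) \<Rightarrow> bool" where
  "solves \<alpha> \<longleftrightarrow> initialises \<alpha> \<and> \<not> \<alpha> (Ce 0 1, T + 1, T + 2) \<and>
     (\<forall>q<Q. \<forall>rs. length rs = K \<and> set rs \<subseteq> {..<S} \<longrightarrow>
        (\<forall>\<tau>\<in>{1..T}. guard \<alpha> q rs \<tau> \<longrightarrow> continues \<alpha> q rs \<tau>))"

lemma satisfiable_clauses: "satisfiable D clauses \<longleftrightarrow> (\<exists>\<alpha>. solves \<alpha>)"
proof -
  have r: "holds \<alpha> D reject_clause \<longleftrightarrow> \<not> \<alpha> (Ce 0 1, T + 1, T + 2)" for \<alpha>
    by (simp add: reject_clause_def holds_iff centre_def D)
  have n: "set (List.n_lists K [0..<S]) = {rs. length rs = K \<and> set rs \<subseteq> {..<S}}"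
    by (auto simp: set_n_lists)
  have "(\<forall>F\<in>set clauses. holds \<alpha> D F) \<longleftrightarrow> (\<forall>F\<in>set init_clauses. holds \<alpha> D F) \<and> holds \<alpha> D reject_clause \<and>
      (\<forall>q<Q. \<forall>rs\<in>set (List.n_lists K [0..<S]). \<forall>F\<in>set (step_clauses q rs). holds \<alpha> D F)" for \<alpha>
    unfolding clauses_def by auto
  then show ?thesis
    unfolding satisfiable_iff solves_def holds_init_clauses holds_step_clauses r n by simp
qed

end

section \<open>Literals stay within the grid of variables\<close>

context tableau_at
begin

text \<open>What the hitting set problem demands of a clause: sets are nonempty, arcs are listed
  once, and all elements exist. The two ranges are the lengths of \<open>t1\<close> and
  \<open>w\<close>.\<close>

definition fine :: "(bool \<times> nat \<times> nat \<times> nat) list \<Rightarrow> bool" where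
  "fine ls \<longleftrightarrow> ls \<noteq> [] \<and> distinct ls \<and>
     (\<forall>(s, c, y, z)\<in>set ls. c < vars \<and> y \<in> {1..T + 1} \<and> z \<in> {1..2 * T + 2 * n + P + 5})"

lemma set_clause_loops: "set (clause_loops D (l1, l2, L)) = {1..length (D ! l1)} \<times> {1..length (D ! l2)}"
  by (simp add: clause_loops_def set_indices)

lemma fine_init_clauses:
  assumes "F \<in> set init_clauses" "(a, b) \<in> set (clause_loops D F)"
  shows "fine (literals D F a b)"
proof -
  have bits: "bit_sym \<beta> < S" for \<beta> using S_K_Q by (auto simp: bit_sym_def)
  have less: "St 0 < vars" "Ce 0 0 < vars" "Ce 0 1 < vars" "Ce 0 2 < vars" "Ce 0 (bit_sym \<beta>) < vars"
    "Ce 0 0 \<noteq> Ce 0 1" "Ce 0 0 \<noteq> Ce 0 2" "Ce 0 1 \<noteq> Ce 0 2" for \<beta>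
    using S_K_Q bits[of \<beta>] by (simp_all add: St_less Ce_less Ce_inject)
  \<comment> \<open>The eight clauses listed one by one are checked by evaluation; the rest are
    those for the tapes from 1 on.\<close>
  consider "F \<in> set (take 8 init_clauses)"
    | k where "k < K" "F = (w, one, \<lambda>_. [(True, Ce k 0, const 1, here w)])"
    using assms(1) by (auto simp: init_clauses_def)
  then show ?thesis
  proof cases
    case 1
    have "\<forall>F\<in>set (take 8 init_clauses). \<forall>a\<in>{1..length (D ! fst F)}. \<forall>b\<in>{1..length (D ! fst (snd F))}.
        fine (literals D F a b)"
      using dist dist' less unfolding init_clauses_def by (simp add: D fine_def)
    moreover have "a \<in> {1..length (D ! fst F)}" "b \<in> {1..length (D ! fst (snd F))}"
      using assms(2) by (cases F, simp add: set_clause_loops)+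
    ultimately show ?thesis using 1 by blast
  next
    case 2
    then show ?thesis
      using assms(2) dist dist' Ce_less[of k 0] S_K_Q
      by (auto simp: fine_def set_clause_loops D)
  qed
qed

lemma fine_reject_clause: "fine (literals D reject_clause a b)"
  using S_K_Q by (simp add: reject_clause_def fine_def centre_def D Ce_less)

definition guard_at :: "nat \<Rightarrow> nat list \<Rightarrow> nat \<Rightarrow> (bool \<times> nat \<times> nat \<times> nat) list" where
  "guard_at q rs \<tau> = (False, St q, \<tau>, 1) # map (\<lambda>k. (False, Ce k (rs ! k), \<tau>, T + 2)) [0..<K]"

lemma literals_guard:
  "l2 \<noteq> tl \<Longrightarrow> literals D (tl, l2, \<lambda>_. guard_lits q rs @ ls) \<tau> b = guard_at q rs \<tau> @ literals D (tl, l2, \<lambda>_. ls) \<tau> b"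
  by (simp add: guard_lits_def guard_at_def centre_def D)

lemma fine_guard_at:
  assumes "q < Q" "length rs = K" "set rs \<subseteq> {..<S}" "\<tau> \<in> {1..T}"
  shows "fine (guard_at q rs \<tau>)"
proof -
  have rs: "rs ! k < S" if "k < K" for k
  proof -
    have "rs ! k \<in> set rs" using assms(2) that by simp
    then show ?thesis using assms(3) by blast
  qed
  then show ?thesis
    using assms(1,4) St_neq_Ce[OF assms(1)] St_less[OF assms(1)] Ce_less
    by (auto simp: fine_def guard_at_def distinct_map inj_on_def Ce_inject)
qed

lemma fine_append:
  "fine us \<Longrightarrow> fine vs \<Longrightarrow> set us \<inter> set vs = {} \<Longrightarrow> fine (us @ vs)"
  by (auto simp: fine_def)

lemma set_guard_at:
  assumes "(s, c, y, z) \<in> set (guard_at q rs \<tau>)"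
  shows "\<not> s" "y = \<tau>" "c = St q \<or> z = T + 2"
  using assms by (auto simp: guard_at_def)

text \<open>The literals after the guard do not repeat it: the positive ones differ in sign, and a
  negative one speaks of a cell other than the centre, whereas the cells of the guard are all at the
  centre.\<close>

lemma fine_step_clauses:
  assumes "q < Q" "length rs = K" "set rs \<subseteq> {..<S}" "F \<in> set (step_clauses q rs)" "(\<tau>, b) \<in> set (clause_loops D F)"
  shows "fine (literals D F \<tau> b)"
proof -
  have ne: "one \<noteq> tl" "zl \<noteq> tl" "tl \<noteq> one" "tl \<noteq> zl" using dist by auto
  let ?r = "outcome M q rs"
  have r: "fst ?r < Q" "length (snd ?r) = K" "fst ` set (snd ?r) \<subseteq> {..<S}"
    using outcome_wf[OF wf_M assms(1-3)] by auto
  have b: "fst (snd ?r ! k) < S" if "k < K" for k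
  proof -
    have "snd ?r ! k \<in> set (snd ?r)" using r(2) that by simp
    then show ?thesis using r(3) by blast
  qed
  have drift: "drift d \<le> 2" for d by (cases d) auto
  have cell: "z = T + 2" if "(s, Ce k a, y, z) \<in> set (guard_at q rs \<tau>)" for s k a y z
    using set_guard_at(3)[OF that] St_neq_Ce[OF assms(1), of k a] by auto
  have F: "\<exists>l2 ls. F = (tl, l2, \<lambda>_. guard_lits q rs @ ls) \<and> l2 \<noteq> tl \<and> (\<tau> \<in> {1..T} \<longrightarrow> b \<in> {1..length (D ! l2)} \<longrightarrow>
      fine (literals D (tl, l2, \<lambda>_. ls) \<tau> b) \<and>
      set (guard_at q rs \<tau>) \<inter> set (literals D (tl, l2, \<lambda>_. ls) \<tau> b) = {})"
  proof -
    consider "F = (tl, one, \<lambda>_. guard_lits q rs @ [(True, St (fst ?r), ([tl], [], 1), const 1)])"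
      | k where "k < K" "F = (tl, one, \<lambda>_. guard_lits q rs @
          [(True, Ce k (fst (snd ?r ! k)), ([tl], [], 1), ([], [zb], 1 + drift (snd (snd ?r ! k))))])"
      | k a where "k < K" "a < S" "F = (tl, zl, \<lambda>_. guard_lits q rs @ [(False, Ce k a, here tl, ([zl], [], 1)),
          (True, Ce k a, ([tl], [], 1), ([zl], [], drift (snd (snd ?r ! k))))])"
      | k a where "k < K" "a < S" "F = (tl, zl, \<lambda>_. guard_lits q rs @ [(False, Ce k a, here tl, ([zl], [zb], 2)),
          (True, Ce k a, ([tl], [], 1), ([zl], [zb], 1 + drift (snd (snd ?r ! k))))])"
      using assms(4) by (auto simp: step_clauses_def move_clauses_def)
    then show ?thesis
    proof cases
      case 1
      then show ?thesis
        using ne r(1) St_less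
        by (intro exI[of _ one] exI[of _ "[(True, St (fst ?r), ([tl], [], 1), const 1)]"])
          (auto simp: fine_def dest: set_guard_at)
    next
      case (2 k)
      then show ?thesis
        using ne b[of k] Ce_less drift[of "snd (snd ?r ! k)"]
        by (intro exI[of _ one] exI[of _ "[(True, Ce k (fst (snd ?r ! k)), ([tl], [], 1), ([], [zb], 1 + drift (snd (snd ?r ! k))))]"])
          (auto simp: fine_def D dest: set_guard_at)
    next
      case (3 k a)
      then show ?thesis
        using ne Ce_less drift[of "snd (snd ?r ! k)"]
        by (intro exI[of _ zl] exI[of _ "[(False, Ce k a, here tl, ([zl], [], 1)),
          (True, Ce k a, ([tl], [], 1), ([zl], [], drift (snd (snd ?r ! k))))]"])
          (auto simp: fine_def D dest: set_guard_at(1) cell)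
    next
      case (4 k a)
      then show ?thesis
        using ne Ce_less drift[of "snd (snd ?r ! k)"]
        by (intro exI[of _ zl] exI[of _ "[(False, Ce k a, here tl, ([zl], [zb], 2)),
          (True, Ce k a, ([tl], [], 1), ([zl], [zb], 1 + drift (snd (snd ?r ! k))))]"])
          (auto simp: fine_def D dest: set_guard_at(1) cell)
    qed
  qed
  then obtain l2 ls where F: "F = (tl, l2, \<lambda>_. guard_lits q rs @ ls)" "l2 \<noteq> tl" and
    fine: "\<tau> \<in> {1..T} \<Longrightarrow> b \<in> {1..length (D ! l2)} \<Longrightarrow> fine (literals D (tl, l2, \<lambda>_. ls) \<tau> b) \<and>
      set (guard_at q rs \<tau>) \<inter> set (literals D (tl, l2, \<lambda>_. ls) \<tau> b) = {}"
    by (elim exE conjE) blast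
  have "\<tau> \<in> {1..T}" "b \<in> {1..length (D ! l2)}"
    using assms(5) unfolding F(1) set_clause_loops D by auto
  then show ?thesis
    unfolding F(1) literals_guard[OF F(2)] using fine fine_guard_at[OF assms(1-3)]
    by (intro fine_append) blast+
qed

lemma fine_clauses:
  assumes "F \<in> set clauses" "(a, b) \<in> set (clause_loops D F)"
  shows "fine (literals D F a b)"
proof -
  consider "F \<in> set init_clauses" | "F = reject_clause"
    | q rs where "q < Q" "length rs = K" "set rs \<subseteq> {..<S}" "F \<in> set (step_clauses q rs)"
    using assms(1) by (auto simp: clauses_def set_n_lists atLeast0LessThan)
  then show ?thesis
    by cases (use assms(2) fine_init_clauses fine_reject_clause fine_step_clauses in auto)
qed

end

section \<open>Symbols of an encoded pair\<close>

lemma length_enc_bits: "length (enc_bits xs) = 2 * length xs + 1"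
  by (induction xs) (simp_all add: enc_bits_simps)

lemma nth_enc_bits:
  "i \<le> 2 * length xs \<Longrightarrow> enc_bits xs ! i = (if i = 2 * length xs then False else if even i then True else xs ! (i div 2))"
proof (induction xs arbitrary: i)
  case (Cons b xs)
  show ?case
  proof (cases "i < 2")
    case True
    then show ?thesis by (cases i) (auto simp: enc_bits_simps less_Suc_eq)
  next
    case False
    then obtain j where j: "i = j + 2" by (metis add.commute le_Suc_ex not_less)
    then have "enc_bits (b # xs) ! i = enc_bits xs ! j" by (simp add: enc_bits_simps)
    with j Cons show ?thesis by simp
  qed
qed (simp add: enc_bits_simps)

lemma length_enc_pair: "length (enc_pair xs ws) = 2 * length xs + 1 + length ws"
  by (simp add: enc_pair_def length_enc_bits)

lemma nth_enc_pair:
  "v < length xs \<Longrightarrow> enc_pair xs ws ! (2 * v) = True"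
  "v < length xs \<Longrightarrow> enc_pair xs ws ! (2 * v + 1) = xs ! v"
  "enc_pair xs ws ! (2 * length xs) = False"
  "enc_pair xs ws ! (2 * length xs + 1 + v) = ws ! v"
  by (simp_all add: enc_pair_def nth_append length_enc_bits nth_enc_bits)

section \<open>Satisfying assignments and accepted witnesses\<close>

context tableau_at
begin

definition config_at :: "bool list \<Rightarrow> nat \<Rightarrow> config" where
  "config_at ys t = (tm_step M ^^ t) (init_config M ys)"

definition cell :: "bool list \<Rightarrow> nat \<Rightarrow> nat \<Rightarrow> int \<Rightarrow> nat" where
  "cell ys t k i = content (snd (config_at ys t) ! k) i"

definition out_at :: "bool list \<Rightarrow> nat \<Rightarrow> nat \<times> (nat \<times> dir) list" where
  "out_at ys t = outcome M (fst (config_at ys t)) (map scan (snd (config_at ys t)))"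

lemma config_0: "fst (config_at ys 0) = 0"
  by (simp add: config_at_def init_config_def)

lemma cell_0: "k < K \<Longrightarrow> cell ys 0 k i =
    (if k = 0 \<and> 0 \<le> i \<and> i < int (length ys) then bit_sym (ys ! nat i) else 0)"
  by (auto simp: cell_def content_def config_at_def init_config_def input_tape_def nth_Cons split: nat.splits)

lemma wf_config_at: "wf_config M (config_at ys t)"
  unfolding config_at_def by (rule wf_config_steps[OF wf_M])

lemma state_less: "fst (config_at ys t) < Q"
  using wf_config_at by (simp add: wf_config_def)

lemma length_tapes: "length (snd (config_at ys t)) = K"
  using wf_config_at by (simp add: wf_config_def)

lemma cell_less: "k < K \<Longrightarrow> cell ys t k i < S"
  using wf_config_at[of ys t] length_tapes[of ys t] by (simp add: wf_config_def cell_def content_def)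

lemma scan_cell: "k < K \<Longrightarrow> map scan (snd (config_at ys t)) ! k = cell ys t k 0"
  using length_tapes[of ys t] by (simp add: cell_def content_0)

lemma length_out_at: "length (snd (out_at ys t)) = K"
  using outcome_wf(2)[OF wf_M state_less _ set_scan[OF wf_config_at]] length_tapes by (simp add: out_at_def)

lemma config_Suc: "config_at ys (Suc t) = (fst (out_at ys t), map2 act (snd (config_at ys t)) (snd (out_at ys t)))"
  using tm_step_outcome[OF length_tapes] by (simp add: config_at_def out_at_def)

lemma cell_Suc:
  assumes "k < K"
  shows "cell ys (Suc t) k i = (if i + offset (snd (snd (out_at ys t) ! k)) = 0 then fst (snd (out_at ys t) ! k)
    else cell ys t k (i + offset (snd (snd (out_at ys t) ! k))))"
  using assms length_tapes[of ys t] length_out_at[of ys t]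
  by (simp add: cell_def config_Suc content_act)

text \<open>Clauses only ever force the true symbols of cells. The window of cells known to be
  correct shrinks by one on each side per step, because a head moves by at most one; a window of
  radius T at the start suffices for T steps.\<close>

lemma solves_imp_cells:
  assumes "solves \<alpha>" "t \<le> T"
    and init: "\<And>k i. k < K \<Longrightarrow> \<bar>i\<bar> \<le> int T \<Longrightarrow> \<alpha> (Ce k (cell ys 0 k i), 1, nat (i + int T + 2))"
  shows "\<alpha> (St (fst (config_at ys t)), t + 1, 1) \<and>
    (\<forall>k<K. \<forall>i. \<bar>i\<bar> \<le> int T - int t \<longrightarrow> \<alpha> (Ce k (cell ys t k i), t + 1, nat (i + int T + 2)))"
  using assms(2)
proof (induction t)
  case 0
  then show ?case using assms(1) init by (simp add: config_0 solves_def initialises_def)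
next
  case (Suc t)
  let ?rs = "map scan (snd (config_at ys t))" and ?q = "fst (config_at ys t)" and ?r = "out_at ys t"
  have IH: "\<alpha> (St ?q, t + 1, 1)"
    "\<And>k i. k < K \<Longrightarrow> \<bar>i\<bar> \<le> int T - int t \<Longrightarrow> \<alpha> (Ce k (cell ys t k i), t + 1, nat (i + int T + 2))"
    using Suc by simp_all
  have "guard \<alpha> ?q ?rs (t + 1)"
    unfolding guard_def
  proof (intro conjI allI impI)
    fix k assume k: "k < K"
    have "nat (int T + 2) = T + 2" by simp
    then show "\<alpha> (Ce k (?rs ! k), t + 1, T + 2)"
      using IH(2)[OF k, of 0] Suc.prems by (simp only: scan_cell[OF k]) simp
  qed (rule IH(1))
  moreover have "length ?rs = K" "set ?rs \<subseteq> {..<S}" using length_tapes set_scan[OF wf_config_at] by auto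
  ultimately have c: "continues \<alpha> ?q ?rs (t + 1)"
    using assms(1) state_less[of ys t] Suc.prems unfolding solves_def by simp
  have "\<alpha> (Ce k (cell ys (Suc t) k i), Suc t + 1, nat (i + int T + 2))"
    if k: "k < K" and i: "\<bar>i\<bar> \<le> int T - int (Suc t)" for k i
  proof -
    let ?d = "snd (snd ?r ! k)"
    let ?i = "i + offset ?d"
    have m: "moves \<alpha> k (fst (snd ?r ! k)) (drift ?d) (t + 1)"
      using c k by (simp add: continues_def out_at_def)
    have off: "\<bar>offset ?d\<bar> \<le> 1" by (cases ?d) auto
    have dr: "int (drift ?d) = 1 - offset ?d" by (rule int_drift)
    have bound: "\<bar>?i\<bar> \<le> int T - int t" using i off by linarith
    \<comment> \<open>\<open>?i\<close> is the old number of the cell. Either it has just been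
      written, or it is copied by the clause for its side of the head.\<close>
    consider "?i = 0" | "?i < 0" | "?i > 0" by linarith
    then show ?thesis
    proof cases
      case 1
      have "nat (i + int T + 2) = T + 1 + drift ?d" using 1 dr by linarith
      with m 1 show ?thesis by (simp add: moves_def cell_Suc[OF k])
    next
      case 2
      let ?j = "nat (?i + int T + 1)"
      have j: "?j \<in> {1..T}" "nat (?i + int T + 2) = ?j + 1" "nat (i + int T + 2) = ?j + drift ?d"
        using 2 bound dr by auto
      have "\<alpha> (Ce k (cell ys t k ?i), t + 1, ?j + 1)"
        using IH(2)[OF k bound] j(2) by simp
      with m j(1) cell_less[OF k, of ys t ?i] have "\<alpha> (Ce k (cell ys t k ?i), t + 1 + 1, ?j + drift ?d)"
        unfolding moves_def by blast
      with 2 j(3) show ?thesis by (simp add: cell_Suc[OF k])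
    next
      case 3
      let ?j = "nat ?i"
      have j: "?j \<in> {1..T}" "nat (?i + int T + 2) = ?j + T + 2" "nat (i + int T + 2) = ?j + T + 1 + drift ?d"
        using 3 bound dr by auto
      have "\<alpha> (Ce k (cell ys t k ?i), t + 1, ?j + T + 2)"
        using IH(2)[OF k bound] j(2) by simp
      with m j(1) cell_less[OF k, of ys t ?i] have "\<alpha> (Ce k (cell ys t k ?i), t + 1 + 1, ?j + T + 1 + drift ?d)"
        unfolding moves_def by blast
      with 3 j(3) show ?thesis by (simp add: cell_Suc[OF k])
    qed
  qed
  moreover have "\<alpha> (St (fst (config_at ys (Suc t))), Suc t + 1, 1)"
    using c by (simp add: continues_def config_Suc out_at_def)
  ultimately show ?case by blast
qed

text \<open>An assignment may give several symbols to one cell, so a witness has to be extracted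
  from it. The real symbol of every cell is then among the assigned ones; this holds for the centre
  at time T as well, where symbol 1 is excluded.\<close>

lemma solves_imp_witness:
  assumes "solves \<alpha>"
  shows "\<exists>ws. length ws \<le> P \<and> cell (enc_pair xs ws) T 0 0 \<noteq> 1"
proof -
  have ini: "initialises \<alpha>" using assms by (simp add: solves_def)
  let ?at = "\<lambda>j. j + 1 + 2 * n + T + 2"
  \<comment> \<open>The witness ends before the first free cell that may be blank, or after all
    \<open>P\<close> cells.\<close>
  define len where "len = (LEAST j. j = P \<or> \<alpha> (Ce 0 0, 1, ?at j))"
  \<comment> \<open>Before \<open>len\<close> a cell is not marked blank, hence it is marked 1 or 2;
    if both, 2 is preferred.\<close>
  define ws where "ws = map (\<lambda>j. \<alpha> (Ce 0 2, 1, ?at j)) [0..<len]"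
  have len: "len \<le> P" "len = P \<or> \<alpha> (Ce 0 0, 1, ?at len)"
    using Least_le[of "\<lambda>j. j = P \<or> \<alpha> (Ce 0 0, 1, ?at j)" P] LeastI[of "\<lambda>j. j = P \<or> \<alpha> (Ce 0 0, 1, ?at j)" P]
    by (auto simp: len_def)
  have before: "\<not> \<alpha> (Ce 0 0, 1, ?at j)" "j < P" if "j < len" for j
    using not_less_Least[of j "\<lambda>j. j = P \<or> \<alpha> (Ce 0 0, 1, ?at j)"] that len(1) by (auto simp: len_def)
  have after: "\<alpha> (Ce 0 0, 1, ?at j)" if "len \<le> j" "j < P" for j
    using that
  proof (induction j rule: dec_induct)
    case base
    then show ?case using len by auto
  next
    case (step j)
    then have "\<alpha> (Ce 0 0, 1, ?at j)" "j + 1 \<in> {1..P}" by auto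
    with ini have "\<alpha> (Ce 0 0, 1, (j + 1) + 2 * n + T + 3)" unfolding initialises_def by blast
    then show ?case by (simp add: numeral_eq_Suc)
  qed
  let ?ys = "enc_pair xs ws"
  have ys: "length ?ys = 2 * n + 1 + len" by (simp add: length_enc_pair ws_def)
  have init: "\<alpha> (Ce k (cell ?ys 0 k i), 1, nat (i + int T + 2))" if k: "k < K" and i: "\<bar>i\<bar> \<le> int T" for k i
  proof -
    \<comment> \<open>The initial cells: other tapes, left of the input, the prefix bits, the bits
      of \<open>xs\<close>, the end of its code, and the witness with the blanks behind it.\<close>
    consider "k \<noteq> 0" | "k = 0" "i < 0" | v where "k = 0" "v < n" "i = int (2 * v)"
      | v where "k = 0" "v < n" "i = int (2 * v + 1)" | "k = 0" "i = int (2 * n)"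
      | j where "k = 0" "i = int (2 * n + 1 + j)"
    proof (cases "k \<noteq> 0 \<or> i < 0")
      case False
      then obtain m where m: "i = int m" "k = 0" by (metis nonneg_int_cases not_less)
      consider "m < 2 * n" "even m" | "m < 2 * n" "odd m" | "m = 2 * n" | "2 * n < m" by linarith
      then show ?thesis
      proof cases
        case 1
        then obtain v where "m = 2 * v" by blast
        with 1 m that(3)[of v] show ?thesis by auto
      next
        case 2
        then obtain v where "m = 2 * v + 1" using oddE by blast
        with 2 m that(4)[of v] show ?thesis by auto
      next
        case 3
        with m that(5) show ?thesis by auto
      next
        case 4
        then obtain j where "m = 2 * n + 1 + j" by (metis Suc_eq_plus1 less_iff_Suc_add add_Suc_right add_Suc)
        with m that(6)[of j] show ?thesis by auto
      qed
    qed (use that in blast)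
    then show ?thesis
    proof cases
      case 1
      have "nat (i + int T + 2) \<in> {1..2 * T + 2 * n + P + 5}" "k \<in> {1..<K}" using i k 1 by auto
      with ini have "\<alpha> (Ce k 0, 1, nat (i + int T + 2))" unfolding initialises_def by blast
      with 1 k show ?thesis by (simp add: cell_0)
    next
      case 2
      have v: "nat (i + int T + 1) \<in> {1..T}" "nat (i + int T + 2) = nat (i + int T + 1) + 1" using i 2 by auto
      with ini have "\<alpha> (Ce 0 0, 1, nat (i + int T + 1) + 1)" unfolding initialises_def by blast
      with 2 k v(2) show ?thesis by (simp add: cell_0)
    next
      case (3 v)
      have "Suc v \<in> {1..n}" using 3 by simp
      with ini have "\<alpha> (Ce 0 2, 1, 2 * Suc v + T)" unfolding initialises_def by blast
      moreover have "nat (i + int T + 2) = 2 * Suc v + T" using 3 by simp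
      moreover have "cell ?ys 0 k i = 2"
        using 3 k ys nth_enc_pair(1)[OF 3(2)] by (simp add: cell_0 bit_sym_def nat_mult_distrib)
      ultimately show ?thesis using 3 by simp
    next
      case (4 v)
      have "Suc v \<in> {1..n}" using 4 by simp
      with ini have "\<alpha> (Ce 0 (bit_sym (xs ! (Suc v - 1))), 1, 2 * Suc v + T + 1)"
        unfolding initialises_def by blast
      moreover have "nat (i + int T + 2) = 2 * Suc v + T + 1" using 4 by simp
      moreover have "cell ?ys 0 k i = bit_sym (xs ! v)"
      proof -
        have "nat i = 2 * v + 1" "0 \<le> i" "i < int (length ?ys)" using 4 ys by simp_all
        then show ?thesis using 4 k nth_enc_pair(2)[OF 4(2)] by (simp add: cell_0 del: One_nat_def)
      qed
      ultimately show ?thesis using 4 by simp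
    next
      case 5
      have "\<alpha> (Ce 0 1, 1, 2 * n + T + 2)" using ini unfolding initialises_def by simp
      moreover have "nat (i + int T + 2) = 2 * n + T + 2" using 5 by simp
      moreover have "cell ?ys 0 k i = 1"
      proof -
        have "nat i = 2 * n" "0 \<le> i" "i < int (length ?ys)" using 5 ys by simp_all
        then show ?thesis using 5 k nth_enc_pair(3)[of xs ws] by (simp add: cell_0 bit_sym_def)
      qed
      ultimately show ?thesis using 5 by simp
    next
      case (6 j)
      have idx: "nat (i + int T + 2) = ?at j" using 6 by simp
      have ni: "nat i = 2 * n + 1 + j" "0 \<le> i" using 6 by simp_all
      show ?thesis
      proof (cases "j < len")
        case True
        have "j + 1 \<in> {1..P}" using before(2)[OF True] by simp
        with ini have "\<alpha> (Ce 0 0, 1, ?at j) \<or> \<alpha> (Ce 0 1, 1, ?at j) \<or> \<alpha> (Ce 0 2, 1, ?at j)"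
          unfolding initialises_def by blast
        with before(1)[OF True] have "\<alpha> (Ce 0 (bit_sym (ws ! j)), 1, ?at j)"
          using True by (auto simp: ws_def bit_sym_def)
        moreover have "i < int (length ?ys)" using 6 ys True by simp
        with 6 k ni have "cell ?ys 0 k i = bit_sym (ws ! j)"
          using nth_enc_pair(4)[of xs ws j] by (simp add: cell_0 del: One_nat_def)
        ultimately show ?thesis using idx 6 by (simp only:)
      next
        case False
        have "cell ?ys 0 k i = 0" using 6 k ys False by (simp add: cell_0)
        moreover have "\<alpha> (Ce 0 0, 1, ?at j)"
        proof (cases "j < P")
          case True
          with False after show ?thesis by simp
        next
          case j: False
          \<comment> \<open>Beyond the free cells the blanks come from the clauses over
            \<open>zl\<close>, whose counter starts after \<open>P\<close> cells.\<close>
          have v: "j + 1 - P \<in> {1..T}" "(j + 1 - P) + 2 * n + T + P + 2 = ?at j"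
            using i 6 j by auto
          from ini v(1) have "\<alpha> (Ce 0 0, 1, (j + 1 - P) + 2 * n + T + P + 2)"
            unfolding initialises_def by blast
          then show ?thesis unfolding v(2) .
        qed
        ultimately show ?thesis using idx 6 by (simp only:)
      qed
    qed
  qed
  have K: "0 < K" using S_K_Q by simp
  have "\<alpha> (Ce 0 (cell ?ys T 0 0), T + 1, nat (0 + int T + 2))"
    using solves_imp_cells[OF assms order.refl init] K by simp
  moreover have "nat (0 + int T + 2) = T + 2" by simp
  ultimately have "cell ?ys T 0 0 \<noteq> 1"
    using assms unfolding solves_def by (metis)
  moreover have "length ws \<le> P" using len(1) by (simp add: ws_def)
  ultimately show ?thesis by blast
qed

definition history :: "bool list \<Rightarrow> nat \<times> nat \<times> nat \<Rightarrow> bool" where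
  "history ys = (\<lambda>(c, \<tau>, j). c = St (fst (config_at ys (\<tau> - 1))) \<or>
     (\<exists>k<K. c = Ce k (cell ys (\<tau> - 1) k (int j - int T - 2))))"

lemma history_St: "q < Q \<Longrightarrow> history ys (St q, \<tau>, j) \<longleftrightarrow> q = fst (config_at ys (\<tau> - 1))"
  using St_neq_Ce by (auto simp: history_def St_def[of q] St_def[of "fst _"]) (metis St_def St_neq_Ce)

lemma history_Ce:
  assumes "k < K" "a < S"
  shows "history ys (Ce k a, \<tau>, j) \<longleftrightarrow> a = cell ys (\<tau> - 1) k (int j - int T - 2)"
proof -
  have "Ce k a = Ce k' (cell ys (\<tau> - 1) k' i) \<longleftrightarrow> k = k' \<and> a = cell ys (\<tau> - 1) k' i" if "k' < K" for k' i
    using assms(2) cell_less[OF that] by (rule Ce_inject)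
  moreover have "Ce k a \<noteq> St (fst (config_at ys (\<tau> - 1)))"
    using St_neq_Ce[OF state_less] by metis
  ultimately show ?thesis using assms(1) unfolding history_def by auto
qed

text \<open>In a real computation a guard holds only for the actual state and the symbols actually
  scanned. Thus only the transition taken has to be checked, and all other step clauses hold
  vacuously.\<close>

lemma solves_history:
  assumes ws: "length ws \<le> P" and final: "cell (enc_pair xs ws) T 0 0 \<noteq> 1"
  shows "solves (history (enc_pair xs ws))"
  unfolding solves_def
proof (intro conjI allI impI ballI)
  let ?ys = "enc_pair xs ws"
  have ys: "length ?ys = 2 * n + 1 + length ws" by (rule length_enc_pair)
  have small: "0 < K" "0 < S" "1 < S" "2 < S" "bit_sym \<beta> < S" for \<beta> using S_K_Q by (auto simp: bit_sym_def)
  note sim = history_Ce cell_0 small ys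
  show "initialises (history ?ys)"
    unfolding initialises_def
  proof (intro conjI ballI)
    show "history ?ys (St 0, 1, 1)" using S_K_Q by (simp add: history_St config_0)
  next
    fix v assume v: "v \<in> {1..n}"
    then have i: "nat (int (2 * v + T) - int T - 2) = 2 * (v - 1)" "0 \<le> int (2 * v + T) - int T - 2"
      "int (2 * v + T) - int T - 2 < int (length ?ys)"
      and j: "nat (int (2 * v + T + 1) - int T - 2) = 2 * (v - 1) + 1" "0 \<le> int (2 * v + T + 1) - int T - 2"
      "int (2 * v + T + 1) - int T - 2 < int (length ?ys)" and v1: "v - 1 < n"
      by (auto simp: ys)
    show "history ?ys (Ce 0 2, 1, 2 * v + T)"
      unfolding history_Ce[OF small(1,4)] diff_self_eq_0 cell_0[OF small(1)] i(1) nth_enc_pair(1)[OF v1]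
      using i(2,3) by (simp add: bit_sym_def)
    show "history ?ys (Ce 0 (bit_sym (xs ! (v - 1))), 1, 2 * v + T + 1)"
      unfolding history_Ce[OF small(1,5)] diff_self_eq_0 cell_0[OF small(1)] j(1) nth_enc_pair(2)[OF v1]
      using j(2,3) by simp
  next
    have i: "nat (int (2 * n + T + 2) - int T - 2) = 2 * n" "0 \<le> int (2 * n + T + 2) - int T - 2"
      "int (2 * n + T + 2) - int T - 2 < int (length ?ys)"
      by (auto simp: ys)
    show "history ?ys (Ce 0 1, 1, 2 * n + T + 2)"
      unfolding history_Ce[OF small(1,3)] diff_self_eq_0 cell_0[OF small(1)] i(1) nth_enc_pair(3)
      using i(2,3) by (simp add: bit_sym_def)
  next
    fix v assume v: "v \<in> {1..P}"
    have "bit_sym \<beta> = 1 \<or> bit_sym \<beta> = 2" for \<beta> by (simp add: bit_sym_def)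
    then show "history ?ys (Ce 0 0, 1, v + 2 * n + T + 2) \<or> history ?ys (Ce 0 1, 1, v + 2 * n + T + 2) \<or>
        history ?ys (Ce 0 2, 1, v + 2 * n + T + 2)"
      unfolding history_Ce[OF small(1,2)] history_Ce[OF small(1,3)] history_Ce[OF small(1,4)]
        diff_self_eq_0 cell_0[OF small(1)] by (simp split: if_splits) metis
    show "history ?ys (Ce 0 0, 1, v + 2 * n + T + 2) \<longrightarrow> history ?ys (Ce 0 0, 1, v + 2 * n + T + 3)"
      unfolding history_Ce[OF small(1,2)] diff_self_eq_0 cell_0[OF small(1)] ys
      by (auto simp: bit_sym_def split: if_splits)
  next
    fix v assume v: "v \<in> {1..T}"
    show "history ?ys (Ce 0 0, 1, v + 2 * n + T + P + 2)"
      unfolding history_Ce[OF small(1,2)] diff_self_eq_0 cell_0[OF small(1)] ys using v ws by auto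
    show "history ?ys (Ce 0 0, 1, v + 1)"
      unfolding history_Ce[OF small(1,2)] diff_self_eq_0 cell_0[OF small(1)] ys using v by auto
  next
    fix k v assume "k \<in> {1..<K}"
    then show "history ?ys (Ce k 0, 1, v)"
      using small by (simp add: history_Ce cell_0)
  qed
  have "int (T + 2) - int T - 2 = 0" by simp
  then show "\<not> history ?ys (Ce 0 1, T + 1, T + 2)"
    unfolding history_Ce[OF small(1,3)] using final by simp
  fix q rs \<tau>
  assume q: "q < Q" and rs: "length rs = K \<and> set rs \<subseteq> {..<S}" and \<tau>: "\<tau> \<in> {1..T}"
    and guard: "guard (history ?ys) q rs \<tau>"
  obtain t where t: "\<tau> = Suc t" using \<tau> by (cases \<tau>) auto
  have state: "q = fst (config_at ?ys t)" using guard q by (simp add: guard_def history_St t)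
  have "rs = map scan (snd (config_at ?ys t))"
  proof (rule nth_equalityI)
    show "length rs = length (map scan (snd (config_at ?ys t)))" using rs by (simp add: length_tapes)
    fix k assume "k < length rs"
    then have "k < K" "rs ! k \<in> set rs" using rs by simp_all
    then have k: "k < K" "rs ! k < S" using rs by blast+
    have "history ?ys (Ce k (rs ! k), \<tau>, T + 2)" using guard k(1) by (simp add: guard_def)
    then have "rs ! k = cell ?ys t k 0" unfolding history_Ce[OF k] by (simp add: t)
    then show "rs ! k = map scan (snd (config_at ?ys t)) ! k" by (simp add: scan_cell[OF k(1)])
  qed
  with state have out: "outcome M q rs = out_at ?ys t" by (simp add: out_at_def)
  have "fst (out_at ?ys t) < Q" and img: "fst ` set (snd (out_at ?ys t)) \<subseteq> {..<S}"
    using outcome_wf[OF wf_M q, of rs] rs unfolding out by simp_all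
  moreover have "fst (snd (out_at ?ys t) ! k) < S" if "k < K" for k
  proof -
    have "snd (out_at ?ys t) ! k \<in> set (snd (out_at ?ys t))" using that length_out_at[of ?ys t] by simp
    then show ?thesis using img by blast
  qed
  ultimately have r: "fst (out_at ?ys t) < Q" "\<And>k. k < K \<Longrightarrow> fst (snd (out_at ?ys t) ! k) < S"
    by blast+
  show "continues (history ?ys) q rs \<tau>"
    unfolding continues_def out
  proof (intro conjI allI impI)
    show "history ?ys (St (fst (out_at ?ys t)), \<tau> + 1, 1)"
      unfolding history_St[OF r(1)] by (simp add: t config_Suc)
    fix k assume k: "k < K"
    let ?d = "snd (snd (out_at ?ys t) ! k)"
    have dr: "int (drift ?d) = 1 - offset ?d" by (rule int_drift)
    \<comment> \<open>A cell not under the head keeps its symbol, while its coordinate changes by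
      the opposite of the head movement.\<close>
    have keep: "history ?ys (Ce k a, \<tau> + 1, j')"
      if a: "a < S" "history ?ys (Ce k a, \<tau>, j)" and j: "int j' = int j - offset ?d" "j \<noteq> T + 2" for a j j'
    proof -
      have "a = cell ?ys t k (int j - int T - 2)" using a(2) unfolding history_Ce[OF k a(1)] by (simp add: t)
      moreover have e: "int j' - int T - 2 + offset ?d = int j - int T - 2" and "int j - int T - 2 \<noteq> 0"
        using j by linarith+
      then have "cell ?ys (Suc t) k (int j' - int T - 2) = cell ?ys t k (int j - int T - 2)"
        unfolding cell_Suc[OF k] e by (simp only: if_False)
      ultimately show ?thesis unfolding history_Ce[OF k a(1)] by (simp add: t)
    qed
    show "moves (history ?ys) k (fst (snd (out_at ?ys t) ! k)) (drift ?d) \<tau>"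
      unfolding moves_def
    proof (intro conjI allI impI ballI)
      have "int (T + 1 + drift ?d) - int T - 2 + offset ?d = 0" using dr by simp
      then show "history ?ys (Ce k (fst (snd (out_at ?ys t) ! k)), \<tau> + 1, T + 1 + drift ?d)"
        unfolding history_Ce[OF k r(2)[OF k]] by (simp add: t cell_Suc[OF k])
      fix a i assume a: "a < S" and i: "i \<in> {1..T}"
      show "history ?ys (Ce k a, \<tau> + 1, i + drift ?d)" if "history ?ys (Ce k a, \<tau>, i + 1)"
        using dr i by (intro keep[OF a that]) auto
      show "history ?ys (Ce k a, \<tau> + 1, i + T + 1 + drift ?d)" if "history ?ys (Ce k a, \<tau>, i + T + 2)"
        using dr i by (intro keep[OF a that]) auto
    qed
  qed
qed

theorem satisfiable_iff_witness:
  "satisfiable D clauses \<longleftrightarrow> (\<exists>ws. length ws \<le> P \<and> cell (enc_pair xs ws) T 0 0 \<noteq> 1)"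
  unfolding satisfiable_clauses using solves_imp_witness solves_history by blast

end

section \<open>NP-hardness\<close>

lemma poly_nat_mono: "a \<le> b \<Longrightarrow> poly r a \<le> poly r b" for a b :: nat
  by (induction r) (auto intro!: add_mono mult_mono)

theorem lemma4:
  shows "np_hard vnf_placement"
  unfolding np_hard_def
proof (intro allI impI)
  fix A assume "in_NP A"
  then obtain V and p :: "nat poly" where V: "in_P V"
    and A: "\<And>xs. xs \<in> A \<longleftrightarrow> (\<exists>ws. length ws \<le> poly p (length xs) \<and> enc_pair xs ws \<in> V)"
    unfolding in_NP_def by blast
  from V obtain M and r :: "nat poly" where M: "wf_tm M"
    and verifies: "\<And>ys. computes_within M ys [ys \<in> V] (poly r (length ys))"
    unfolding in_P_def polytime_computable_def by blast
  \<comment> \<open>The running time for the longest possible witness; a machine that halts earlier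
    stays in its final configuration, so one time serves all witnesses.\<close>
  define time where "time n = poly r (2 * n + 1 + poly p n)" for n
  obtain gs ip tl zl zb t1 w one one2 where gs: "wf_gens gs" "distinct [2, ip, tl, zl, zb, t1, w, one, one2]"
    and counts: "counts gs ip (poly p)" "counts gs tl time" "counts gs zl time" "counts gs zb time"
      "counts gs t1 (\<lambda>n. time n + 1)" "counts gs w (\<lambda>n. 2 * time n + 2 * n + poly p n + 5)"
      "counts gs one (\<lambda>_. 1)" "counts gs one2 (\<lambda>_. 1)"
    unfolding time_def by (rule ex_tapes[of p r])
  interpret tableau M 2 ip tl zl zb t1 w one one2
    using M gs(2) by unfold_locales
  have range: "{2, ip, tl, zl, zb, t1, w, one, one2} \<subseteq> {2..<3 + length gs}"
    using counts by (simp add: counts_def)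
  let ?fams = "families t1 w vars clauses"
  \<comment> \<open>There is a variable for each tag and each pair of coordinates, so this tape has
    as many cells as there are variables.\<close>
  define bound where "bound = For t1 (For w (glit (replicate vars True)))"
  \<comment> \<open>One cell for every set of the hitting set problem, including the pairs of
    opposite literals.\<close>
  define cap where "cap = gseq (map (\<lambda>F. For (fst F) (For (fst (snd F)) (glit [True]))) ?fams)"
  define gs' where "gs' = (gs @ [bound]) @ [cap]"
  let ?lb = "3 + length gs" and ?lc = "3 + length (gs @ [bound])"
  have t1_w: "t1 \<noteq> w" using gs(2) by simp
  have fams: "fst F \<in> {2..<3 + length gs} \<and> fst (snd F) \<in> {2..<3 + length gs} \<and> fst F \<noteq> fst (snd F)"
    if F: "F \<in> set ?fams" for F
  proof -
    consider c where "F = variable_family t1 w c" | F' where "F' \<in> set clauses" "F = family_of_clause F'"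
      using F by (auto simp: families_def)
    then show ?thesis
    proof cases
      case 1
      then show ?thesis using range t1_w by (simp add: variable_family_def)
    next
      case 2
      with wf_clauses[OF range 2(1)] show ?thesis by (cases F') simp
    qed
  qed
  have wf_bound: "wf_gens (gs @ [bound])"
    using gs(1) range t1_w by (simp add: wf_gens_snoc bound_def wf_glit parked_glit)
  have "wf_gen (3 + length (gs @ [bound])) cap"
    unfolding cap_def wf_gseq using fams by (fastforce simp: wf_glit parked_glit)
  with wf_bound have wf: "wf_gens gs'" unfolding gs'_def wf_gens_snoc[of "gs @ [bound]"] by blast
  have old: "contents gs' xs ! i = contents gs xs ! i" "contents (gs @ [bound]) xs ! i = contents gs xs ! i"
    if "i < 3 + length gs" for xs i
    using that contents_append[of i gs "[bound] @ [cap]" xs] contents_append[of i gs "[bound]" xs]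
    by (simp_all add: gs'_def)
  have len_bound: "length (contents gs' xs ! ?lb) = vars * length (contents gs' xs ! t1) * length (contents gs' xs ! w)" for xs
  proof -
    have "contents gs' xs ! ?lb = den (contents gs xs) (\<lambda>_. 0) bound"
      using contents_append[of ?lb "gs @ [bound]" "[cap]" xs] contents_new[of gs bound xs] by (simp add: gs'_def)
    then show ?thesis
      using old(1)[of t1 xs] old(1)[of w xs] range length_den_For2[OF t1_w]
      by (simp add: bound_def del: den.simps(5))
  qed
  have len_cap: "(\<Sum>F\<leftarrow>?fams. length (loops (contents gs' xs) F)) \<le> length (contents gs' xs ! ?lc)" for xs
  proof -
    have "length (den (contents (gs @ [bound]) xs) (\<lambda>_. 0) (For (fst F) (For (fst (snd F)) (glit [True])))) =
        length (loops (contents gs' xs) F)" if "F \<in> set ?fams" for F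
      using fams[OF that] old(1)[of "fst F" xs] old(1)[of "fst (snd F)" xs] old(2)[of "fst F" xs] old(2)[of "fst (snd F)" xs]
        length_den_For2[of "fst F" "fst (snd F)" "contents (gs @ [bound]) xs" "\<lambda>_. 0" "[True]"]
      by (simp add: loops_def indices_def length_product del: den.simps(5) upt_Suc)
    then have "(\<Sum>F\<leftarrow>?fams. length (loops (contents gs' xs) F)) = length (den (contents (gs @ [bound]) xs) (\<lambda>_. 0) cap)"
      unfolding cap_def den_gseq length_concat map_map comp_def
      by (intro arg_cong[of _ _ sum_list] map_cong) (simp_all del: den.simps(5))
    then show ?thesis
      unfolding gs'_def contents_new[of "gs @ [bound]" cap xs] by (simp only: order.refl)
  qed
  have at: "tableau_at M 2 ip tl zl zb t1 w one one2 (contents gs' xs) xs (poly p (length xs)) (time (length xs))" for xs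
  proof unfold_locales
    show "contents gs' xs ! 2 = xs" by (rule counts_input(2))
  qed (use counts old(1)[of _ xs] in \<open>simp_all add: counts_def\<close>)
  have "polytime_reducible {xs. satisfiable (contents gs' xs) clauses} vnf_placement"
  proof (rule satisfiable_reducible[where l = t1 and l' = w and lb = ?lb and lc = ?lc and C = vars])
    show "wf_gens gs'" by (rule wf)
    show "{t1, w, ?lb, ?lc} \<subseteq> {2..<3 + length gs'}" using range by (simp add: gs'_def)
    show "t1 \<noteq> w" by (rule t1_w)
    show "?lc \<noteq> t1" "?lc \<noteq> w" using range by auto
    fix F assume F: "F \<in> set clauses"
    have "{2, ip, tl, zl, zb, t1, w, one, one2} \<subseteq> {2..<3 + length gs'}"
      using range by (simp add: gs'_def)
    then show "wf_clause_family (3 + length gs') F" using F by (rule wf_clauses)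
    fix xs a b assume ab: "(a, b) \<in> set (clause_loops (contents gs' xs) F)"
    interpret tableau_at M 2 ip tl zl zb t1 w one one2 "contents gs' xs" xs "poly p (length xs)" "time (length xs)"
      by (rule at)
    show "literals (contents gs' xs) F a b \<noteq> [] \<and> distinct (literals (contents gs' xs) F a b) \<and>
      (\<forall>(s, c, x, y)\<in>set (literals (contents gs' xs) F a b). c < vars \<and>
         x \<in> {1..length (contents gs' xs ! t1)} \<and> y \<in> {1..length (contents gs' xs ! w)})"
      using fine_clauses[OF F ab] unfolding fine_def D(6,7) .
  qed (rule len_bound len_cap)+
  moreover have "{xs. satisfiable (contents gs' xs) clauses} = A"
  proof (intro set_eqI iffI; simp only: mem_Collect_eq)
    fix xs
    interpret tableau_at M 2 ip tl zl zb t1 w one one2 "contents gs' xs" xs "poly p (length xs)" "time (length xs)"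
      by (rule at)
    have "cell (enc_pair xs ws) (time n) 0 0 \<noteq> 1 \<longleftrightarrow> enc_pair xs ws \<in> V" if "length ws \<le> poly p n" for ws
    proof -
      let ?ys = "enc_pair xs ws"
      let ?t = "poly r (length ?ys)"
      have le: "?t \<le> time n"
        unfolding time_def by (rule poly_nat_mono) (use that in \<open>simp add: length_enc_pair\<close>)
      have halted: "(tm_step M ^^ ?t) (init_config M ?ys) = (1, snd ((tm_step M ^^ ?t) (init_config M ?ys)))"
        using verifies[of ?ys] by (simp add: computes_within_def prod_eq_iff)
      have "config_at ?ys (time n) = (tm_step M ^^ ?t) (init_config M ?ys)"
        unfolding config_at_def tm_steps_halted[OF halted le] using halted by (rule sym)
      moreover have "snd (config_at ?ys (time n)) \<noteq> []"
        using length_tapes[of ?ys "time n"] S_K_Q by auto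
      \<comment> \<open>The verifier has halted by then, and the first symbol of its output is its
        answer, so differing from symbol 1 means acceptance.\<close>
      ultimately have "cell ?ys (time n) 0 0 = bit_sym (?ys \<in> V)"
        using verifies[of ?ys]
        by (simp add: computes_within_def shows_output_def cell_def content_def hd_conv_nth)
      then show ?thesis by (simp add: bit_sym_def)
    qed
    then have "satisfiable (contents gs' xs) clauses \<longleftrightarrow> xs \<in> A"
      unfolding satisfiable_iff_witness A by blast
    then show "satisfiable (contents gs' xs) clauses \<Longrightarrow> xs \<in> A" "xs \<in> A \<Longrightarrow> satisfiable (contents gs' xs) clauses"
      by blast+
  qed
  ultimately show "polytime_reducible A vnf_placement" by simp
qed

end
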